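(* Let $G$ and $H$ be two locally compact Polish groups acting in a Borel, measure-preserving, ergodic manner on a standard $\sigma$-finite space $(X,\lambda)$. Then any group isomorphism between the orbit full groups $[\mathcal{R}_G]$ and $[\mathcal{R}_H]$ is the conjugation by a bijection $S:X\to X$ which preserves the measure $\lambda$ up to multiplication by an element of $\mathbb{R}_+^*$ (i.e. $S_*\lambda=k\lambda$ for some real $k>0$).
   Context: A standard $\sigma$-finite space $(X,\lambda)$ is a standard Borel space $X$ with an atomless $\sigma$-finite Borel measure $\lambda$ such that $\lambda(X)=+\infty$. $\mathrm{Aut}(X,\lambda)$ is the group of Borel bijections $T$ of $X$ with $\lambda(T(A))=\lambda(T^{-1}(A))=\lambda(A)$ for every Borel $A$. Here and throughout, bijections are Borel and are identified when they coincide on a conull set. For a Borel action of a Polish group $G$ on $(X,\lambda)$, the orbit full group is $[\mathcal{R}_G]=\{T\in\mathrm{Aut}(X,\lambda) : T(x)\in G\cdot x \text{ for almost all } x\in X\}$. A subgroup $\mathbb{G}\leqslant\mathrm{Aut}(X,\lambda)$ is ergodic if every Borel $A\subseteq X$ with $\lambda(T(A)\Delta A)=0$ for all $T\in\mathbb{G}$ is null or conull. A measure-preserving action of $G$ is ergodic if the image of $G$ in $\mathrm{Aut}(X,\lambda)$ is ergodic. *)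

theory Defs
  imports "HOL-Analysis.Analysis" "HOL-Algebra.Group_Action"
begin

section \<open>Standard sigma-finite spaces\<close>

definition borel_of :: "'a topology \<Rightarrow> 'a measure" where
  "borel_of T = sigma (topspace T) {U. openin T U}"

definition polish_topology :: "'a topology \<Rightarrow> bool" where
  "polish_topology T \<longleftrightarrow> completely_metrizable_space T \<and> second_countable T"

definition standard_borel :: "'a measure \<Rightarrow> bool" where
  "standard_borel M \<longleftrightarrow> (\<exists>T. polish_topology T \<and> topspace T = space M \<and> sets M = sets (borel_of T))"

text \<open>An atom is a measurable set of positive measure that cannot be split into two
  measurable parts of positive measure.\<close>

definition atomless :: "'a measure \<Rightarrow> bool" where
  "atomless M \<longleftrightarrow>
     \<not> (\<exists>A\<in>sets M. A \<notin> null_sets M \<and>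
          (\<forall>B\<in>sets M. B \<subseteq> A \<longrightarrow> B \<in> null_sets M \<or> A - B \<in> null_sets M))"

definition standard_sigma_finite :: "'a measure \<Rightarrow> bool" where
  "standard_sigma_finite M \<longleftrightarrow>
     standard_borel M \<and> sigma_finite_measure M \<and> atomless M \<and> emeasure M (space M) = \<infinity>"


section \<open>The group of measure-preserving Borel bijections modulo null sets\<close>

text \<open>As in \<^const>\<open>BijGroup\<close>, a bijection of \<open>space M\<close> is represented by a function that is
  undefined outside \<open>space M\<close>. Measurability of the inverse is stated explicitly; on a standard
  Borel space it is automatic.\<close>

definition borel_bij :: "'a measure \<Rightarrow> ('a \<Rightarrow> 'a) set" where
  "borel_bij M = {T \<in> Bij (space M). T \<in> measurable M M \<and> (\<forall>A\<in>sets M. T ` A \<in> sets M)}"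

definition mp_bij :: "'a measure \<Rightarrow> ('a \<Rightarrow> 'a) set" where
  "mp_bij M = {T \<in> borel_bij M. \<forall>A\<in>sets M.
      emeasure M (T ` A) = emeasure M A \<and> emeasure M (T -` A \<inter> space M) = emeasure M A}"

definition mp_group :: "'a measure \<Rightarrow> ('a \<Rightarrow> 'a) monoid" where
  "mp_group M = BijGroup (space M)\<lparr>carrier := mp_bij M\<rparr>"

definition ae_identities :: "'a measure \<Rightarrow> ('a \<Rightarrow> 'a) set" where
  "ae_identities M = {T \<in> mp_bij M. AE x in M. T x = x}"

text \<open>The cosets are the classes of bijections that agree almost everywhere;
  see \<open>ae_class_eq\<close> below.\<close>

definition ae_class :: "'a measure \<Rightarrow> ('a \<Rightarrow> 'a) \<Rightarrow> ('a \<Rightarrow> 'a) set" where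
  "ae_class M T = ae_identities M #>\<^bsub>mp_group M\<^esub> T"

definition aut_group :: "'a measure \<Rightarrow> ('a \<Rightarrow> 'a) set monoid" where
  "aut_group M = mp_group M Mod ae_identities M"

definition ergodic :: "'a measure \<Rightarrow> ('a \<Rightarrow> 'a) set set \<Rightarrow> bool" where
  "ergodic M \<GG> \<longleftrightarrow>
     (\<forall>A\<in>sets M. (\<forall>C\<in>\<GG>. \<forall>T\<in>C. sym_diff (T ` A) A \<in> null_sets M) \<longrightarrow>
        A \<in> null_sets M \<or> space M - A \<in> null_sets M)"


section \<open>Actions of locally compact Polish groups and orbit full groups\<close>

locale locally_compact_polish_group = group G
  for G :: "('g, 'm) monoid_scheme" (structure) and \<tau> :: "'g topology" +
  assumes topspace_eq: "topspace \<tau> = carrier G"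
    and polish: "polish_topology \<tau>"
    and locally_compact: "locally_compact_space \<tau>"
    and continuous_mult: "continuous_map (prod_topology \<tau> \<tau>) \<tau> (\<lambda>(g, h). g \<otimes> h)"
    and continuous_inv: "continuous_map \<tau> \<tau> (\<lambda>g. inv g)"

locale ergodic_mp_action =
  locally_compact_polish_group G \<tau> + group_action G "space M" \<phi>
  for G :: "('g, 'm) monoid_scheme" (structure) and \<tau> :: "'g topology"
    and M :: "'a measure" and \<phi> :: "'g \<Rightarrow> 'a \<Rightarrow> 'a" +
  assumes borel_action: "(\<lambda>(g, x). \<phi> g x) \<in> measurable (borel_of \<tau> \<Otimes>\<^sub>M M) M"
    and measure_preserving: "\<And>g. g \<in> carrier G \<Longrightarrow> \<phi> g \<in> mp_bij M"
    and ergodic_image: "ergodic M ((\<lambda>g. ae_class M (\<phi> g)) ` carrier G)"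

definition orbit_full_group ::
  "('g, 'm) monoid_scheme \<Rightarrow> 'a measure \<Rightarrow> ('g \<Rightarrow> 'a \<Rightarrow> 'a) \<Rightarrow> ('a \<Rightarrow> 'a) set monoid" where
  "orbit_full_group G M \<phi> =
     aut_group M\<lparr>carrier := {C \<in> carrier (aut_group M). \<forall>T\<in>C. AE x in M. T x \<in> orbit G \<phi> x}\<rparr>"


section \<open>The objects defined above are groups\<close>

lemma mp_bijD:
  assumes "T \<in> mp_bij M"
  shows "T \<in> Bij (space M)" "bij_betw T (space M) (space M)" "T \<in> measurable M M"
    "\<And>x. x \<in> space M \<Longrightarrow> T x \<in> space M"
  using assms by (auto simp: mp_bij_def borel_bij_def Bij_def measurable_def)

lemma mp_bij_AE:
  assumes T: "T \<in> mp_bij M" and P: "AE x in M. P x"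
  shows "AE x in M. P (T x)"
proof -
  obtain N where N: "N \<in> null_sets M" "{x \<in> space M. \<not> P x} \<subseteq> N"
    using P by (auto simp: eventually_ae_filter)
  have "T -` N \<inter> space M \<in> null_sets M"
    using N T measurable_sets[OF mp_bijD(3)[OF T], of N]
    by (auto simp: mp_bij_def null_sets_def)
  moreover have "{x \<in> space M. \<not> P (T x)} \<subseteq> T -` N \<inter> space M"
    using N mp_bijD(4)[OF T] by auto
  ultimately show ?thesis unfolding eventually_ae_filter by blast
qed

lemma mult_BijGroup:
  "S \<in> Bij X \<Longrightarrow> T \<in> Bij X \<Longrightarrow> S \<otimes>\<^bsub>BijGroup X\<^esub> T = compose X S T"
  by (simp add: BijGroup_def)

lemma subgroup_mp_bij: "subgroup (mp_bij M) (BijGroup (space M))"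
proof -
  interpret B: group "BijGroup (space M)" by (rule group_BijGroup)
  show ?thesis
  proof (rule B.subgroupI)
    show "mp_bij M \<subseteq> carrier (BijGroup (space M))"
      by (auto simp: BijGroup_def mp_bij_def borel_bij_def)
    define I where "I = (\<lambda>x\<in>space M. x)"
    have im: "I ` A = A" "I -` A \<inter> space M = A" if "A \<in> sets M" for A
      using sets.sets_into_space[OF that] unfolding I_def by (force simp: image_iff)+
    have "I \<in> measurable M M"
      by (rule measurableI) (auto simp: im(2), simp add: I_def)
    moreover have "I \<in> Bij (space M)" unfolding I_def by (rule id_Bij)
    ultimately have "I \<in> mp_bij M" by (simp add: mp_bij_def borel_bij_def im)
    then show "mp_bij M \<noteq> {}" by auto
  next
    fix T assume T: "T \<in> mp_bij M"
    let ?I = "\<lambda>x\<in>space M. inv_into (space M) T x"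
    have b: "bij_betw T (space M) (space M)" using mp_bijD[OF T] by simp
    have im: "?I ` A = T -` A \<inter> space M" if A: "A \<in> sets M" for A
    proof -
      have "?I ` A = inv_into (space M) T ` A"
        using sets.sets_into_space[OF A] by (auto intro!: image_cong)
      also have "\<dots> = T -` A \<inter> space M"
      proof (intro equalityI subsetI)
        fix x assume "x \<in> inv_into (space M) T ` A"
        then obtain y where "y \<in> A" "x = inv_into (space M) T y" by auto
        then show "x \<in> T -` A \<inter> space M"
          using b sets.sets_into_space[OF A]
          by (auto simp: bij_betw_def inv_into_into f_inv_into_f subset_iff)
      next
        fix x assume "x \<in> T -` A \<inter> space M"
        then show "x \<in> inv_into (space M) T ` A"
          using b by (auto simp: bij_betw_def intro!: rev_image_eqI[of "T x"])
      qed
      finally show ?thesis .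
    qed
    have vim: "?I -` A \<inter> space M = T ` A" if A: "A \<in> sets M" for A
    proof (intro equalityI subsetI)
      fix y assume y: "y \<in> ?I -` A \<inter> space M"
      then have "T (inv_into (space M) T y) = y"
        using b by (simp add: bij_betw_def f_inv_into_f)
      with y show "y \<in> T ` A" by (auto intro: rev_image_eqI)
    next
      fix y assume "y \<in> T ` A"
      then obtain x where x: "x \<in> A" "y = T x" by auto
      then have "x \<in> space M" "y \<in> space M"
        using sets.sets_into_space[OF A] mp_bijD(4)[OF T] by auto
      then show "y \<in> ?I -` A \<inter> space M"
        using x b by (simp add: bij_betw_def)
    qed
    have inv: "inv\<^bsub>BijGroup (space M)\<^esub> T = ?I"
      using inv_BijGroup[OF mp_bijD(1)[OF T]] .
    have TM: "T ` A \<in> sets M" "T -` A \<inter> space M \<in> sets M"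
      "emeasure M (T ` A) = emeasure M A" "emeasure M (T -` A \<inter> space M) = emeasure M A"
      if "A \<in> sets M" for A
      using T that measurable_sets[OF mp_bijD(3)[OF T] that] by (auto simp: mp_bij_def borel_bij_def)
    have "?I \<in> Bij (space M)" using mp_bijD(1)[OF T] by (rule restrict_inv_into_Bij)
    moreover have "?I \<in> measurable M M"
    proof (rule measurableI)
      show "?I x \<in> space M" if "x \<in> space M" for x
        using Bij_inv_into_mem[OF mp_bijD(1)[OF T] that] that by simp
      show "?I -` A \<inter> space M \<in> sets M" if "A \<in> sets M" for A
        unfolding vim[OF that] using that by (rule TM)
    qed
    ultimately show "inv\<^bsub>BijGroup (space M)\<^esub> T \<in> mp_bij M"
      unfolding inv mp_bij_def borel_bij_def
      by (intro CollectI conjI ballI; (simp only: im vim TM)?)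
  next
    fix S T assume S: "S \<in> mp_bij M" and T: "T \<in> mp_bij M"
    have im: "compose (space M) S T ` A = S ` T ` A" if A: "A \<in> sets M" for A
      using sets.sets_into_space[OF A] by (force simp: compose_def image_iff)
    have vim: "compose (space M) S T -` A \<inter> space M = T -` (S -` A \<inter> space M) \<inter> space M" for A
      using mp_bijD(4)[OF T] by (auto simp: compose_def)
    have "compose (space M) S T \<in> measurable M M"
      using measurable_comp[OF mp_bijD(3)[OF T] mp_bijD(3)[OF S]]
      by (subst measurable_cong[where g="S \<circ> T"]) (auto simp: compose_def)
    moreover have "U ` A \<in> sets M \<and> U -` A \<inter> space M \<in> sets M \<and>
        emeasure M (U ` A) = emeasure M A \<and> emeasure M (U -` A \<inter> space M) = emeasure M A"
      if "U \<in> mp_bij M" "A \<in> sets M" for U A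
      using that measurable_sets[OF mp_bijD(3)[OF that(1)] that(2)]
      by (auto simp: mp_bij_def borel_bij_def)
    ultimately show "S \<otimes>\<^bsub>BijGroup (space M)\<^esub> T \<in> mp_bij M"
      unfolding mult_BijGroup[OF mp_bijD(1)[OF S] mp_bijD(1)[OF T]]
      using S T compose_Bij[OF mp_bijD(1)[OF S] mp_bijD(1)[OF T]]
      by (simp add: mp_bij_def[of M] borel_bij_def im vim del: vimage_Int)
  qed
qed

lemma group_mp_group: "group (mp_group M)"
  unfolding mp_group_def
  by (rule subgroup.subgroup_is_group[OF subgroup_mp_bij group_BijGroup])

lemma carrier_mp_group [simp]: "carrier (mp_group M) = mp_bij M"
  by (simp add: mp_group_def)

lemma mult_mp_group:
  "S \<in> mp_bij M \<Longrightarrow> T \<in> mp_bij M \<Longrightarrow> x \<in> space M \<Longrightarrow> (S \<otimes>\<^bsub>mp_group M\<^esub> T) x = S (T x)"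
  by (simp add: mp_group_def mult_BijGroup mp_bijD(1) compose_def)

lemma one_mp_group: "x \<in> space M \<Longrightarrow> \<one>\<^bsub>mp_group M\<^esub> x = x"
  by (simp add: mp_group_def BijGroup_def)

lemma inv_mp_group:
  assumes "T \<in> mp_bij M" "x \<in> space M"
  shows "T ((inv\<^bsub>mp_group M\<^esub> T) x) = x" "(inv\<^bsub>mp_group M\<^esub> T) (T x) = x"
proof -
  interpret group "mp_group M" by (rule group_mp_group)
  have T: "T \<in> carrier (mp_group M)" "inv\<^bsub>mp_group M\<^esub> T \<in> mp_bij M"
    using assms inv_closed by auto
  show "T ((inv\<^bsub>mp_group M\<^esub> T) x) = x" "(inv\<^bsub>mp_group M\<^esub> T) (T x) = x"
    using r_inv[OF T(1)] l_inv[OF T(1)] mult_mp_group[OF assms(1) T(2) assms(2)]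
      mult_mp_group[OF T(2) assms(1) assms(2)] one_mp_group[OF assms(2)] by auto
qed

lemma normal_ae_identities: "ae_identities M \<lhd> mp_group M"
proof -
  interpret group "mp_group M" by (rule group_mp_group)
  have inv: "inv\<^bsub>mp_group M\<^esub> T \<in> mp_bij M" if "T \<in> mp_bij M" for T
    using inv_closed[of T] that by simp
  have mult: "S \<otimes>\<^bsub>mp_group M\<^esub> T \<in> mp_bij M" if "S \<in> mp_bij M" "T \<in> mp_bij M" for S T
    using m_closed[of S T] that by simp
  have "subgroup (ae_identities M) (mp_group M)"
  proof (rule subgroupI)
    show "ae_identities M \<subseteq> carrier (mp_group M)" by (auto simp: ae_identities_def)
    have "\<one>\<^bsub>mp_group M\<^esub> \<in> ae_identities M"
      using one_closed by (auto simp: ae_identities_def one_mp_group)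
    then show "ae_identities M \<noteq> {}" by auto
  next
    fix T assume T: "T \<in> ae_identities M"
    then have *: "T \<in> mp_bij M" "AE x in M. T x = x" by (auto simp: ae_identities_def)
    have "AE x in M. (inv\<^bsub>mp_group M\<^esub> T) x = x"
      using *(2) AE_space by eventually_elim (metis inv_mp_group(2)[OF *(1)])
    then show "inv\<^bsub>mp_group M\<^esub> T \<in> ae_identities M"
      using inv[OF *(1)] by (simp add: ae_identities_def)
  next
    fix S T assume "S \<in> ae_identities M" "T \<in> ae_identities M"
    then have *: "S \<in> mp_bij M" "AE x in M. S x = x" "T \<in> mp_bij M" "AE x in M. T x = x"
      by (auto simp: ae_identities_def)
    have "AE x in M. (S \<otimes>\<^bsub>mp_group M\<^esub> T) x = x"
      using *(2,4) AE_space by eventually_elim (simp add: mult_mp_group[OF *(1,3)])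
    then show "S \<otimes>\<^bsub>mp_group M\<^esub> T \<in> ae_identities M"
      using mult[OF *(1,3)] by (simp add: ae_identities_def)
  qed
  moreover have "S \<otimes>\<^bsub>mp_group M\<^esub> T \<otimes>\<^bsub>mp_group M\<^esub> inv\<^bsub>mp_group M\<^esub> S \<in> ae_identities M"
    if "S \<in> carrier (mp_group M)" "T \<in> ae_identities M" for S T
  proof -
    have *: "S \<in> mp_bij M" "T \<in> mp_bij M" "AE x in M. T x = x"
      using that by (auto simp: ae_identities_def)
    note i = inv[OF *(1)]
    have "AE x in M. (S \<otimes>\<^bsub>mp_group M\<^esub> T \<otimes>\<^bsub>mp_group M\<^esub> inv\<^bsub>mp_group M\<^esub> S) x = x"
      using mp_bij_AE[OF i *(3)] AE_space
    proof eventually_elim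
      case (elim x)
      then show ?case
        by (simp add: mult_mp_group[OF mult[OF *(1,2)] i] mult_mp_group[OF *(1,2)]
            mp_bijD(4)[OF i] inv_mp_group(1)[OF *(1)])
    qed
    then show ?thesis using mult[OF mult[OF *(1,2)] i] by (simp add: ae_identities_def)
  qed
  ultimately show ?thesis by (simp add: normal_inv_iff)
qed

lemma group_aut_group: "group (aut_group M)"
  unfolding aut_group_def by (rule normal.factorgroup_is_group[OF normal_ae_identities])

lemma ae_class_eq:
  assumes T: "T \<in> mp_bij M"
  shows "ae_class M T = {U \<in> mp_bij M. AE x in M. U x = T x}"
proof -
  interpret group "mp_group M" by (rule group_mp_group)
  show ?thesis
  proof (intro equalityI subsetI)
    fix U assume "U \<in> ae_class M T"
    then obtain S where S: "S \<in> mp_bij M" "AE x in M. S x = x" "U = S \<otimes>\<^bsub>mp_group M\<^esub> T"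
      by (auto simp: ae_class_def r_coset_def ae_identities_def)
    have "AE x in M. U x = T x"
      using mp_bij_AE[OF T S(2)] AE_space
      by eventually_elim (simp add: S(3) mult_mp_group[OF S(1) T])
    then show "U \<in> {U \<in> mp_bij M. AE x in M. U x = T x}"
      using m_closed[of S T] S T by simp
  next
    fix U assume "U \<in> {U \<in> mp_bij M. AE x in M. U x = T x}"
    then have U: "U \<in> mp_bij M" "AE x in M. U x = T x" by auto
    let ?i = "inv\<^bsub>mp_group M\<^esub> T"
    have i: "?i \<in> mp_bij M" using inv_closed[of T] T by simp
    have "AE x in M. (U \<otimes>\<^bsub>mp_group M\<^esub> ?i) x = x"
      using mp_bij_AE[OF i U(2)] AE_space
      by eventually_elim (simp add: mult_mp_group[OF U(1) i] inv_mp_group(1)[OF T])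
    then have "U \<otimes>\<^bsub>mp_group M\<^esub> ?i \<in> ae_identities M"
      using m_closed[of U ?i] U i by (simp add: ae_identities_def)
    moreover have "U = U \<otimes>\<^bsub>mp_group M\<^esub> ?i \<otimes>\<^bsub>mp_group M\<^esub> T"
      using U T i by (simp add: m_assoc)
    ultimately show "U \<in> ae_class M T" by (auto simp: ae_class_def r_coset_def)
  qed
qed

lemma carrier_aut_group: "carrier (aut_group M) = ae_class M ` mp_bij M"
  by (auto simp: aut_group_def FactGroup_def RCOSETS_def ae_class_def)

lemma mult_aut_group:
  assumes "S \<in> mp_bij M" "T \<in> mp_bij M"
  shows "ae_class M S \<otimes>\<^bsub>aut_group M\<^esub> ae_class M T = ae_class M (S \<otimes>\<^bsub>mp_group M\<^esub> T)"
  using normal.rcos_sum[OF normal_ae_identities, of S M T] assms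
  by (simp add: aut_group_def FactGroup_def ae_class_def)

lemma ae_class_in_orbit_full_group:
  assumes T: "T \<in> mp_bij M"
  shows "ae_class M T \<in> carrier (orbit_full_group G M \<phi>) \<longleftrightarrow> (AE x in M. T x \<in> orbit G \<phi> x)"
proof
  assume "ae_class M T \<in> carrier (orbit_full_group G M \<phi>)"
  then show "AE x in M. T x \<in> orbit G \<phi> x"
    using T by (auto simp: orbit_full_group_def ae_class_eq)
next
  assume *: "AE x in M. T x \<in> orbit G \<phi> x"
  have "AE x in M. U x \<in> orbit G \<phi> x" if "AE x in M. U x = T x" for U
    using that * by eventually_elim simp
  then show "ae_class M T \<in> carrier (orbit_full_group G M \<phi>)"
    using T by (auto simp: orbit_full_group_def carrier_aut_group ae_class_eq)
qed

lemma (in group_action) group_orbit_full_group: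
  assumes E: "E = space M"
  shows "group (orbit_full_group G M \<phi>)"
proof -
  interpret P: group "mp_group M" by (rule group_mp_group)
  interpret A: group "aut_group M" by (rule group_aut_group)
  let ?F = "carrier (orbit_full_group G M \<phi>)"
  have F: "\<exists>T\<in>mp_bij M. C = ae_class M T \<and> (AE x in M. T x \<in> orbit G \<phi> x)" if "C \<in> ?F" for C
  proof -
    have "C \<in> carrier (aut_group M)" using that by (simp add: orbit_full_group_def)
    then obtain T where "T \<in> mp_bij M" "C = ae_class M T" by (auto simp: carrier_aut_group)
    then show ?thesis using that ae_class_in_orbit_full_group by blast
  qed
  have "subgroup ?F (aut_group M)"
  proof (rule A.subgroupI)
    show "?F \<subseteq> carrier (aut_group M)" by (auto simp: orbit_full_group_def)
    have "AE x in M. \<one>\<^bsub>mp_group M\<^esub> x \<in> orbit G \<phi> x"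
      using AE_space by eventually_elim (simp add: one_mp_group orbit_refl E)
    then show "?F \<noteq> {}"
      using ae_class_in_orbit_full_group[of "\<one>\<^bsub>mp_group M\<^esub>" M G \<phi>] P.one_closed by auto
  next
    fix C assume "C \<in> ?F"
    then obtain T where T: "T \<in> mp_bij M" "C = ae_class M T" "AE x in M. T x \<in> orbit G \<phi> x"
      using F by blast
    let ?i = "inv\<^bsub>mp_group M\<^esub> T"
    have i: "?i \<in> mp_bij M" using P.inv_closed[of T] T by simp
    have "AE x in M. ?i x \<in> orbit G \<phi> x"
      using mp_bij_AE[OF i T(3)] AE_space
    proof eventually_elim
      case (elim x)
      then show ?case
        using orbit_sym_aux[of _ "?i x" x] mp_bijD(4)[OF i] orbit_sym[of "?i x" x]
        by (simp add: inv_mp_group(1)[OF T(1)] E)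
    qed
    then have "ae_class M ?i \<in> ?F" using ae_class_in_orbit_full_group[OF i] by blast
    moreover have "inv\<^bsub>aut_group M\<^esub> C = ae_class M ?i"
    proof (rule A.inv_equality)
      have "ae_class M ?i \<otimes>\<^bsub>aut_group M\<^esub> C = ae_class M \<one>\<^bsub>mp_group M\<^esub>"
        using mult_aut_group[OF i T(1)] T by (simp add: P.l_inv)
      also have "\<dots> = \<one>\<^bsub>aut_group M\<^esub>"
        using P.coset_mult_one[OF subgroup.subset[OF normal_imp_subgroup[OF normal_ae_identities[of M]]]]
        by (simp add: ae_class_def aut_group_def FactGroup_def)
      finally show "ae_class M ?i \<otimes>\<^bsub>aut_group M\<^esub> C = \<one>\<^bsub>aut_group M\<^esub>" .
    qed (use T i in \<open>auto simp: carrier_aut_group\<close>)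
    ultimately show "inv\<^bsub>aut_group M\<^esub> C \<in> ?F" by simp
  next
    fix C D assume "C \<in> ?F" "D \<in> ?F"
    then obtain S T where S: "S \<in> mp_bij M" "C = ae_class M S" "AE x in M. S x \<in> orbit G \<phi> x"
      and T: "T \<in> mp_bij M" "D = ae_class M T" "AE x in M. T x \<in> orbit G \<phi> x"
      using F by blast
    have m: "S \<otimes>\<^bsub>mp_group M\<^esub> T \<in> mp_bij M" using P.m_closed[of S T] S T by simp
    have "AE x in M. (S \<otimes>\<^bsub>mp_group M\<^esub> T) x \<in> orbit G \<phi> x"
      using mp_bij_AE[OF T(1) S(3)] T(3) AE_space
    proof eventually_elim
      case (elim x)
      then show ?case
        using orbit_trans[of x "T x" "S (T x)"] mp_bijD(4)[OF T(1)] mp_bijD(4)[OF S(1)]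
        by (simp add: mult_mp_group[OF S(1) T(1)] E)
    qed
    then show "C \<otimes>\<^bsub>aut_group M\<^esub> D \<in> ?F"
      unfolding S(2) T(2) mult_aut_group[OF S(1) T(1)]
      by (rule iffD2[OF ae_class_in_orbit_full_group[OF m]])
  qed
  then have "group (aut_group M\<lparr>carrier := ?F\<rparr>)"
    by (rule subgroup.subgroup_is_group) (rule group_aut_group)
  then show ?thesis by (simp add: orbit_full_group_def)
qed

end

theory Submission
  imports Defs
begin

text \<open>Only the orbit equivalence relation and ergodicity matter, not the topologies of the groups.
  Ergodicity yields, inside every non-null set, the support of a non-trivial involution of the full
  group, and by exhaustion every measurable set is the support of an involution modulo null sets.
  Following Fremlin, the elements supported in the support of an involution \<open>p\<close> can be described by
  commutation relations in the abstract group. A group isomorphism therefore induces an automorphism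
  of the measure algebra, sending the support of \<open>p\<close> to the support of its image. Since the space is
  standard Borel, this automorphism lifts to a Borel bijection \<open>S\<close>, which implements the isomorphism.
  The measure \<open>S\<^sub>*\<lambda>\<close> is equivalent to \<open>\<lambda>\<close> and invariant under the ergodic full group, so its density is
  constant.\<close>

section \<open>Exhaustion in sigma-finite measures\<close>

text \<open>The isomorphism is purely algebraic: nothing links it to null sets, so supports must be
  seen through products alone. Commuting with an involution \<open>p\<close> says too little about
  where an element lives; squares resolve this. An element commuting with every restriction of
  \<open>p\<close> to an invariant set can send a point of the support of \<open>p\<close> only to
  itself or to its \<open>p\<close>-image, so its square is trivial there, whereas every non-null
  set carries an element with non-trivial square. The lift is contravariant: the automorphism of the
  measure algebra becomes the preimage map of \<open>S\<close>. This is why the argument is run with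
  the inverse isomorphism. Borel structure enters through one device, a measurable retraction of a
  Cantor space onto \<open>M\<close>, which turns equality of points into countably many Boolean
  coordinates. The constant \<open>k\<close> remains because the total mass is infinite: comparing
  the masses of the whole space does not determine it.\<close>

text \<open>In a set \<open>a\<close> of finite measure only finitely many disjoint sets can have a
  trace of measure above \<open>1 / Suc n\<close>. Countably many pairs of such \<open>a\<close> and
  \<open>n\<close> account for the whole family, since a non-null set has a trace of positive
  measure on some \<open>a\<close>.\<close>

lemma (in sigma_finite_measure) countable_disjoint_nonnull:
  assumes "\<D> \<subseteq> sets M" "disjoint \<D>" "\<D> \<inter> null_sets M = {}"
  shows "countable \<D>"
proof -
  obtain A where A: "countable A" "A \<subseteq> sets M" "\<Union>A = space M" "\<forall>a\<in>A. emeasure M a \<noteq> \<infinity>"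
    using sigma_finite_countable by (elim exE conjE)
  define L where "L = (\<lambda>a n. {E\<in>\<D>. measure M (E \<inter> a) > 1 / real (Suc n)})"
  have fin: "finite (L a n)" if a: "a \<in> A" for a n
  proof (rule ccontr)
    assume inf: "infinite (L a n)"
    obtain m :: nat where m: "real (Suc n) * measure M a < real m" using reals_Archimedean2 by blast
    obtain F where F: "F \<subseteq> L a n" "finite F" "card F = m"
      using infinite_arbitrarily_large[OF inf] by blast
    have FD: "F \<subseteq> \<D>" using F(1) by (auto simp: L_def)
    have fm: "a \<in> fmeasurable M" using A a by (auto simp: fmeasurable_def less_top)
    have "real m * (1 / real (Suc n)) = (\<Sum>E\<in>F. 1 / real (Suc n))" using F by simp
    also have "\<dots> \<le> (\<Sum>E\<in>F. measure M (E \<inter> a))"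
      by (rule sum_mono) (use F in \<open>auto simp: L_def\<close>)
    also have "\<dots> = measure M (\<Union>E\<in>F. E \<inter> a)"
    proof (rule measure_finite_Union[symmetric])
      show "disjoint_family_on (\<lambda>E. E \<inter> a) F"
        using assms(2) FD unfolding disjoint_family_on_def disjoint_def by blast
      show "(\<lambda>E. E \<inter> a) ` F \<subseteq> sets M" using FD assms(1) a A(2) by auto
      show "emeasure M (E \<inter> a) \<noteq> \<infinity>" for E
        using emeasure_mono[of "E \<inter> a" a M] A(2,4) a by (auto simp: top_unique)
    qed (rule F(2))
    also have "\<dots> \<le> measure M a"
    proof (rule measure_mono_fmeasurable[OF _ _ fm])
      have "E \<inter> a \<in> sets M" if "E \<in> F" for E using that FD assms(1) a A(2) by auto
      then show "(\<Union>E\<in>F. E \<inter> a) \<in> sets M" using F(2) by (intro sets.finite_UN)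
    qed auto
    finally show False using m by (simp add: field_simps)
  qed
  have "\<D> \<subseteq> (\<Union>a\<in>A. \<Union>n. L a n)"
  proof
    fix E assume E: "E \<in> \<D>"
    have Es: "E \<in> sets M" "E \<notin> null_sets M" using assms E by auto
    have "\<exists>a\<in>A. E \<inter> a \<notin> null_sets M"
    proof (rule ccontr)
      assume "\<not> ?thesis"
      then have "(\<Union>a\<in>A. E \<inter> a) \<in> null_sets M" using A(1) by (intro null_sets_UN') auto
      moreover have "(\<Union>a\<in>A. E \<inter> a) = E" using A(3) sets.sets_into_space[OF Es(1)] by auto
      ultimately show False using Es by simp
    qed
    then obtain a where a: "a \<in> A" "E \<inter> a \<notin> null_sets M" by auto
    have "a \<in> sets M" "emeasure M a < \<infinity>" using A a(1) by (auto simp: less_top)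
    then have "emeasure M (E \<inter> a) < \<infinity>" using emeasure_mono[of "E \<inter> a" a M] by (simp add: le_less_trans)
    moreover have "emeasure M (E \<inter> a) \<noteq> 0"
      using a(2) Es(1) \<open>a \<in> sets M\<close> by (simp add: null_sets_def)
    ultimately have "measure M (E \<inter> a) > 0"
      unfolding measure_def by (simp add: enn2real_positive_iff zero_less_iff_neq_zero)
    then obtain n where "inverse (real (Suc n)) < measure M (E \<inter> a)" using reals_Archimedean by blast
    then show "E \<in> (\<Union>a\<in>A. \<Union>n. L a n)" using a E by (auto simp: L_def inverse_eq_divide)
  qed
  moreover have "countable (\<Union>a\<in>A. \<Union>n. L a n)"
    by (intro countable_UN A(1) countableI_type countable_finite fin)
  ultimately show ?thesis by (rule countable_subset)
qed

text \<open>A maximal disjoint family of non-null sets with property \<open>P\<close> is countable,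
  and maximality is the last clause. The union of the family serves as an essential union of all
  sets with property \<open>P\<close>.\<close>

lemma (in sigma_finite_measure) exhaustion:
  fixes P :: "'a set \<Rightarrow> bool"
  obtains \<D> where "countable \<D>" "disjoint \<D>" "\<D> \<subseteq> sets M"
    "\<And>E. E \<in> \<D> \<Longrightarrow> P E"
    "\<And>E. E \<in> sets M \<Longrightarrow> P E \<Longrightarrow> E \<inter> \<Union>\<D> = {} \<Longrightarrow> E \<in> null_sets M"
proof -
  define \<Z> where "\<Z> = {\<D>. disjoint \<D> \<and> \<D> \<subseteq> {E\<in>sets M. E \<notin> null_sets M \<and> P E}}"
  have "\<exists>D\<in>\<Z>. \<forall>X\<in>\<Z>. D \<subseteq> X \<longrightarrow> X = D"
  proof (rule subset_Zorn_nonempty)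
    show "\<Z> \<noteq> {}" by (auto simp: \<Z>_def intro!: exI[of _ "{}"])
    fix \<C> assume C: "\<C> \<noteq> {}" "subset.chain \<Z> \<C>"
    have "disjoint (\<Union>\<C>)"
      unfolding disjoint_def
    proof (intro ballI impI)
      fix a b assume ab: "a \<in> \<Union>\<C>" "b \<in> \<Union>\<C>" "a \<noteq> b"
      then obtain X Y where "X \<in> \<C>" "Y \<in> \<C>" "a \<in> X" "b \<in> Y" by auto
      moreover have "X \<subseteq> Y \<or> Y \<subseteq> X" using C calculation by (auto simp: subset.chain_def)
      moreover have "X \<in> \<Z>" "Y \<in> \<Z>" using C calculation by (auto simp: subset.chain_def)
      ultimately obtain Z where "Z \<in> \<Z>" "a \<in> Z" "b \<in> Z" by blast
      then show "a \<inter> b = {}" using ab(3) by (auto simp: \<Z>_def disjoint_def)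
    qed
    then show "\<Union>\<C> \<in> \<Z>" using C unfolding \<Z>_def subset.chain_def by blast
  qed
  then obtain \<D> where D: "\<D> \<in> \<Z>" "\<And>X. X \<in> \<Z> \<Longrightarrow> \<D> \<subseteq> X \<Longrightarrow> X = \<D>" by blast
  show ?thesis
  proof (rule that)
    show "countable \<D>" using D(1) by (intro countable_disjoint_nonnull) (auto simp: \<Z>_def)
    show "disjoint \<D>" "\<D> \<subseteq> sets M" "\<And>E. E \<in> \<D> \<Longrightarrow> P E" using D(1) by (auto simp: \<Z>_def)
    fix E assume E: "E \<in> sets M" "P E" "E \<inter> \<Union>\<D> = {}"
    show "E \<in> null_sets M"
    proof (rule ccontr)
      assume n: "E \<notin> null_sets M"
      then have "insert E \<D> \<in> \<Z>" using E D(1) by (auto simp: \<Z>_def disjoint_def)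
      then have "E \<in> \<D>" using D(2) by blast
      then have "E = {}" using E(3) by auto
      then show False using n by simp
    qed
  qed
qed

section \<open>Standard Borel spaces and the Cantor space\<close>

abbreviation cantor :: "'i itself \<Rightarrow> ('i \<Rightarrow> bool) measure" where
  "cantor _ \<equiv> (\<Pi>\<^sub>M i\<in>UNIV. count_space UNIV)"

lemma standard_borelE:
  assumes "standard_borel M"
  obtains d where "Metric_space (space M) d" "Metric_space.mcomplete (space M) d"
    "second_countable (Metric_space.mtopology (space M) d)"
    "sets M = sigma_sets (space M) {U. openin (Metric_space.mtopology (space M) d) U}"
proof -
  obtain T where T: "polish_topology T" "topspace T = space M" "sets M = sets (borel_of T)"
    using assms by (auto simp: standard_borel_def)
  obtain X d where X: "Metric_space X d" "Metric_space.mcomplete X d" "T = Metric_space.mtopology X d"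
    using T(1) by (auto simp: polish_topology_def completely_metrizable_space_def)
  have "X = space M" using X T(2) Metric_space.topspace_mtopology by metis
  moreover have "sets (borel_of T) = sigma_sets (topspace T) {U. openin T U}"
    unfolding borel_of_def by (rule sets_measure_of) (auto dest: openin_subset)
  ultimately show ?thesis using that X T by (auto simp: polish_topology_def)
qed

text \<open>The code \<open>h x\<close> records which closed balls of radius
  \<open>1 / Suc m\<close> around the points of a dense sequence contain \<open>x\<close>. The
  decoder \<open>r\<close> takes, for each radius, the first ball listed and passes to the limit of
  the centres. Thus \<open>M\<close> is a Borel retract of a Cantor space, and questions of
  measurability in \<open>M\<close> reduce to countably many Boolean coordinates.\<close>

lemma standard_borel_retract:
  assumes "standard_borel M" "space M \<noteq> {}"
  obtains h :: "'a \<Rightarrow> nat \<times> nat \<Rightarrow> bool" and r where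
    "h \<in> M \<rightarrow>\<^sub>M cantor TYPE(nat \<times> nat)" "r \<in> cantor TYPE(nat \<times> nat) \<rightarrow>\<^sub>M M"
    "\<And>x. x \<in> space M \<Longrightarrow> r (h x) = x"
proof -
  obtain d where d: "Metric_space (space M) d" "Metric_space.mcomplete (space M) d"
    "second_countable (Metric_space.mtopology (space M) d)"
    "sets M = sigma_sets (space M) {U. openin (Metric_space.mtopology (space M) d) U}"
    by (rule standard_borelE[OF assms(1)])
  interpret Metric_space "space M" d by fact
  obtain C where C: "countable C" "C \<subseteq> space M" "mtopology closure_of C = space M"
    using second_countable_imp_separable_space[OF d(3)] by (auto simp: separable_space_def)
  have "C \<noteq> {}" using C assms by auto
  define D where "D = from_nat_into C"
  have D: "D i \<in> space M" for i using C \<open>C \<noteq> {}\<close> by (auto simp: D_def intro!: subsetD[OF C(2)] from_nat_into)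
  have dense: "\<exists>i. d x (D i) < e" if x: "x \<in> space M" and e: "e > 0" for x e
  proof -
    have "x \<in> mtopology closure_of C" using C x by simp
    then obtain y where "y \<in> C" "y \<in> mball x e"
      using e unfolding metric_closure_of by (auto)
    then show ?thesis using range_from_nat_into[OF \<open>C \<noteq> {}\<close> C(1)] by (auto simp: D_def in_mball) (metis imageE)
  qed
  define \<epsilon> :: "nat \<Rightarrow> real" where "\<epsilon> = (\<lambda>m. 1 / real (Suc m))"
  have \<epsilon>0: "\<epsilon> m > 0" for m by (simp add: \<epsilon>_def)
  have \<epsilon>lim: "\<epsilon> \<longlonglongrightarrow> 0" unfolding \<epsilon>_def using LIMSEQ_inverse_real_of_nat by (simp add: inverse_eq_divide)
  have cball_sets: "mcball x e \<in> sets M" for x e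
  proof -
    have "mcball x e = space M - (space M - mcball x e)" using mcball_subset_mspace by auto
    moreover have "space M - mcball x e \<in> sets M"
      using closedin_mcball[of x e] unfolding d(4) closedin_def by auto
    ultimately show ?thesis by (metis sets.compl_sets)
  qed
  define h where "h = (\<lambda>x (i, m). x \<in> mcball (D i) (\<epsilon> m))"
  define I where "I = (\<lambda>(\<alpha>::nat\<times>nat\<Rightarrow>bool) m. LEAST i. \<alpha> (i, m))"
  \<comment> \<open>Balls through a common point have centres at most the sum of the radii apart.
    Asking this of the chosen centres makes them a Cauchy sequence and is a countable condition on
    the code. Codes that fail it are sent to the arbitrary point \<open>D 0\<close>.\<close>
  define V where "V = (\<lambda>\<alpha>. \<forall>m m'. d (D (I \<alpha> m)) (D (I \<alpha> m')) \<le> \<epsilon> m + \<epsilon> m')"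
  define r where "r = (\<lambda>\<alpha>. if V \<alpha> then (SOME x. limitin mtopology (\<lambda>m. D (I \<alpha> m)) x sequentially) else D 0)"
  have I_meas[measurable]: "(\<lambda>\<alpha>. I \<alpha> m) \<in> cantor TYPE(nat \<times> nat) \<rightarrow>\<^sub>M count_space UNIV" for m
    unfolding I_def by measurable
  have I_pred: "Measurable.pred (cantor TYPE(nat \<times> nat)) (\<lambda>\<alpha>. Q (I \<alpha> m) (I \<alpha> m'))" for Q :: "nat \<Rightarrow> nat \<Rightarrow> bool" and m m'
    by (rule measurable_compose_countable[where f="\<lambda>i \<alpha>. Q i (I \<alpha> m')", OF _ I_meas])
      (rule measurable_compose[OF I_meas], simp)
  have V_meas[measurable]: "Measurable.pred (cantor TYPE(nat \<times> nat)) V"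
    unfolding V_def by (intro pred_intros_countable I_pred)
  have r: "limitin mtopology (\<lambda>m. D (I \<alpha> m)) (r \<alpha>) sequentially" if "V \<alpha>" for \<alpha>
  proof -
    have "MCauchy (\<lambda>m. D (I \<alpha> m))"
      unfolding MCauchy_def
    proof (intro conjI allI impI)
      show "range (\<lambda>m. D (I \<alpha> m)) \<subseteq> space M" using D by auto
      fix e :: real assume "e > 0"
      then have "\<forall>\<^sub>F m in sequentially. \<epsilon> m < e / 2" using \<epsilon>lim by (auto dest: order_tendstoD(2)[of _ _ _ "e/2"])
      then obtain N where N: "\<And>m. m \<ge> N \<Longrightarrow> \<epsilon> m < e / 2" by (auto simp: eventually_sequentially)
      have "d (D (I \<alpha> n)) (D (I \<alpha> n')) < e" if "N \<le> n" "N \<le> n'" for n n'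
        using that(1,2)[THEN N] \<open>V \<alpha>\<close>[unfolded V_def, rule_format, of n n'] by linarith
      then show "\<exists>N. \<forall>n n'. N \<le> n \<longrightarrow> N \<le> n' \<longrightarrow> d (D (I \<alpha> n)) (D (I \<alpha> n')) < e" by blast
    qed
    then have "\<exists>x. limitin mtopology (\<lambda>m. D (I \<alpha> m)) x sequentially" using d(2) by (auto simp: mcomplete_def)
    from someI_ex[OF this] show ?thesis using that by (simp add: r_def)
  qed
  have r_space: "r \<alpha> \<in> space M" for \<alpha>
    using r[of \<alpha>] D[of 0] limitin_mspace by (cases "V \<alpha>") (auto simp: r_def)
  have r_dist: "d (D (I \<alpha> m)) (r \<alpha>) \<le> \<epsilon> m" if "V \<alpha>" for \<alpha> m
  proof (rule field_le_epsilon)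
    fix e :: real assume e: "e > 0"
    have "\<forall>\<^sub>F k in sequentially. D (I \<alpha> k) \<in> space M \<and> d (D (I \<alpha> k)) (r \<alpha>) < e / 2"
      using r[OF that] half_gt_zero[OF e] unfolding limitin_metric by blast
    moreover have "\<forall>\<^sub>F m in sequentially. \<epsilon> m < e / 2"
      using \<epsilon>lim e by (auto dest: order_tendstoD(2)[of _ _ _ "e/2"])
    ultimately have "\<forall>\<^sub>F k in sequentially. d (D (I \<alpha> k)) (r \<alpha>) < e / 2 \<and> \<epsilon> k < e / 2"
      by eventually_elim auto
    then obtain k where k: "d (D (I \<alpha> k)) (r \<alpha>) < e / 2" "\<epsilon> k < e / 2"
      using eventually_happens'[OF sequentially_bot] by blast
    have "d (D (I \<alpha> m)) (r \<alpha>) \<le> d (D (I \<alpha> m)) (D (I \<alpha> k)) + d (D (I \<alpha> k)) (r \<alpha>)"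
      by (rule triangle) (auto simp: D r_space)
    then show "d (D (I \<alpha> m)) (r \<alpha>) \<le> \<epsilon> m + e"
      using k \<open>V \<alpha>\<close>[unfolded V_def, rule_format, of m k] by linarith
  qed
  show ?thesis
  proof (rule that[of h r])
    show "h \<in> M \<rightarrow>\<^sub>M cantor TYPE(nat \<times> nat)"
    proof (rule measurable_PiM_single')
      fix p :: "nat \<times> nat"
      show "(\<lambda>x. h x p) \<in> M \<rightarrow>\<^sub>M count_space UNIV"
        unfolding h_def case_prod_beta by (rule pred_sets2[OF cball_sets measurable_ident_sets[OF refl]])
    qed auto
    have "r \<in> cantor TYPE(nat \<times> nat) \<rightarrow>\<^sub>M sigma (space M) {U. openin mtopology U}"
    proof (rule measurable_measure_of)
      show "{U. openin mtopology U} \<subseteq> Pow (space M)" using openin_subset[of mtopology] by auto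
      show "r \<in> space (cantor TYPE(nat \<times> nat)) \<rightarrow> space M" using r_space by auto
      fix U assume "U \<in> {U. openin mtopology U}"
      then have U: "openin mtopology U" by simp
      \<comment> \<open>Membership of the limit in an open set becomes a countable condition on the
        indices. The limit is within \<open>\<epsilon> m\<close> of the centre, so the doubled open
        ball contains it; that ball lies within \<open>3 * \<epsilon> m\<close> of the limit, whence
        the bound \<open>e / 3\<close> below.\<close>
      have "r \<alpha> \<in> U \<longleftrightarrow> (V \<alpha> \<and> (\<exists>m. mball (D (I \<alpha> m)) (2 * \<epsilon> m) \<subseteq> U)) \<or> (\<not> V \<alpha> \<and> D 0 \<in> U)" for \<alpha>
      proof (cases "V \<alpha>")
        case True
        have "r \<alpha> \<in> U \<longleftrightarrow> (\<exists>m. mball (D (I \<alpha> m)) (2 * \<epsilon> m) \<subseteq> U)"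
        proof
          assume "r \<alpha> \<in> U"
          then obtain e where e: "e > 0" "mball (r \<alpha>) e \<subseteq> U" using U by (auto simp: openin_mtopology)
          then have "\<forall>\<^sub>F m in sequentially. \<epsilon> m < e / 3"
            using \<epsilon>lim by (auto dest: order_tendstoD(2)[of _ _ _ "e/3"])
          then obtain m where m: "\<epsilon> m < e / 3" using eventually_happens'[OF sequentially_bot] by blast
          have "mball (D (I \<alpha> m)) (2 * \<epsilon> m) \<subseteq> mball (r \<alpha>) e"
          proof
            fix y assume y: "y \<in> mball (D (I \<alpha> m)) (2 * \<epsilon> m)"
            then have "d (r \<alpha>) y \<le> d (r \<alpha>) (D (I \<alpha> m)) + d (D (I \<alpha> m)) y"
              by (intro triangle) (auto simp: D r_space)
            then show "y \<in> mball (r \<alpha>) e"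
              using y m r_dist[OF True, of m] commute[of "r \<alpha>"] r_space by auto
          qed
          then show "\<exists>m. mball (D (I \<alpha> m)) (2 * \<epsilon> m) \<subseteq> U" using e by blast
        next
          assume "\<exists>m. mball (D (I \<alpha> m)) (2 * \<epsilon> m) \<subseteq> U"
          then obtain m where "mball (D (I \<alpha> m)) (2 * \<epsilon> m) \<subseteq> U" by auto
          moreover have "r \<alpha> \<in> mball (D (I \<alpha> m)) (2 * \<epsilon> m)"
            using r_dist[OF True, of m] \<epsilon>0[of m] D r_space by auto
          ultimately show "r \<alpha> \<in> U" by auto
        qed
        then show ?thesis using True by simp
      qed (simp add: r_def)
      then have "r -` U \<inter> space (cantor TYPE(nat \<times> nat)) =
        {\<alpha> \<in> space (cantor TYPE(nat \<times> nat)). (V \<alpha> \<and> (\<exists>m. mball (D (I \<alpha> m)) (2 * \<epsilon> m) \<subseteq> U)) \<or> (\<not> V \<alpha> \<and> D 0 \<in> U)}"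
        by auto
      also have "\<dots> \<in> sets (cantor TYPE(nat \<times> nat))"
        using I_pred[of "\<lambda>i j. mball (D i) (2 * \<epsilon> m) \<subseteq> U" m m for m, measurable] by measurable
      finally show "r -` U \<inter> space (cantor TYPE(nat \<times> nat)) \<in> sets (cantor TYPE(nat \<times> nat))" .
    qed
    moreover have "sets (sigma (space M) {U. openin mtopology U}) = sets M"
      unfolding d(4) using openin_subset[of mtopology] by (auto simp: sets_measure_of subset_iff)
    ultimately show "r \<in> cantor TYPE(nat \<times> nat) \<rightarrow>\<^sub>M M" by (subst (asm) measurable_cong_sets[OF refl])
    fix x assume x: "x \<in> space M"
    have dx: "d (D (I (h x) m)) x \<le> \<epsilon> m" for m
    proof -
      have "\<exists>i. h x (i, m)" using dense[OF x \<epsilon>0[of m]] x D commute by (auto simp: h_def intro: less_imp_le)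
      then have "h x (I (h x) m, m)" unfolding I_def by (rule LeastI_ex)
      moreover have "h x (i, m) \<Longrightarrow> d (D i) x \<le> \<epsilon> m" for i by (simp add: h_def)
      ultimately show ?thesis by blast
    qed
    have v: "V (h x)" unfolding V_def
    proof (intro allI)
      fix m m'
      have "d (D (I (h x) m)) (D (I (h x) m')) \<le> d (D (I (h x) m)) x + d x (D (I (h x) m'))"
        by (rule triangle) (auto simp: D x)
      then show "d (D (I (h x) m)) (D (I (h x) m')) \<le> \<epsilon> m + \<epsilon> m'"
        using dx[of m] dx[of m'] commute[of x] by auto
    qed
    have "limitin mtopology (\<lambda>m. D (I (h x) m)) x sequentially"
      unfolding limitin_metric
    proof (intro conjI allI impI x)
      fix e :: real assume e: "e > 0"
      have "\<forall>\<^sub>F m in sequentially. \<epsilon> m < e"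
        using \<epsilon>lim e by (auto dest: order_tendstoD(2)[of _ _ _ "e"])
      then show "\<forall>\<^sub>F m in sequentially. D (I (h x) m) \<in> space M \<and> d (D (I (h x) m)) x < e"
        by eventually_elim (use dx D in \<open>auto intro: le_less_trans\<close>)
    qed
    then show "r (h x) = x" using r[OF v] limitin_metric_unique trivial_limit_sequentially by blast
  qed
qed

text \<open>The code \<open>h\<close> is injective, having the left inverse \<open>r\<close>, so
  equality is a countable conjunction of equalities of Boolean coordinates.\<close>

lemma standard_borel_eq_measurable:
  assumes "standard_borel M" "f \<in> N \<rightarrow>\<^sub>M M" "g \<in> N \<rightarrow>\<^sub>M M"
  shows "{x \<in> space N. f x = g x} \<in> sets N"
proof (cases "space M = {}")
  case True
  then have "space N = {}" using assms(2) by (auto simp: measurable_def)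
  then show ?thesis by auto
next
  case False
  obtain h :: "'a \<Rightarrow> nat \<times> nat \<Rightarrow> bool" and r where
    h[measurable]: "h \<in> M \<rightarrow>\<^sub>M cantor TYPE(nat \<times> nat)" and r: "r \<in> cantor TYPE(nat \<times> nat) \<rightarrow>\<^sub>M M"
    "\<And>x. x \<in> space M \<Longrightarrow> r (h x) = x" by (rule standard_borel_retract[OF assms(1) False]) blast
  note assms(2,3)[measurable]
  have "f x = g x \<longleftrightarrow> (\<forall>i. h (f x) i = h (g x) i)" if "x \<in> space N" for x
  proof
    assume "\<forall>i. h (f x) i = h (g x) i"
    then have "h (f x) = h (g x)" by (intro ext) (erule spec)
    then have "r (h (f x)) = r (h (g x))" by simp
    then show "f x = g x"
      using r(2) measurable_space[OF assms(2) that] measurable_space[OF assms(3) that] by simp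
  qed simp
  then have "{x \<in> space N. f x = g x} = {x \<in> space N. \<forall>i. h (f x) i = h (g x) i}" by auto
  also have "\<dots> \<in> sets N" by measurable
  finally show ?thesis .
qed

lemma standard_borel_null_singleton:
  assumes "standard_borel M" "atomless M" "x \<in> space M"
  shows "{x} \<in> null_sets M"
proof -
  have "{y \<in> space M. y = x} \<in> sets M"
    using standard_borel_eq_measurable[OF assms(1) measurable_ident_sets[OF refl] measurable_const[OF assms(3)]] .
  moreover have "{y \<in> space M. y = x} = {x}" using assms(3) by auto
  ultimately have s: "{x} \<in> sets M" by simp
  show ?thesis
  proof (rule ccontr)
    assume "{x} \<notin> null_sets M"
    then obtain B where "B \<subseteq> {x}" "B \<notin> null_sets M" "{x} - B \<notin> null_sets M"
      using assms(2) s unfolding atomless_def by blast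
    then show False by (cases "B = {}") (auto simp: subset_singleton_iff)
  qed
qed

text \<open>A Cantor scheme of closed non-null sets; only the support points of the measure are used,
  so no regularity of the measure is needed.\<close>

lemma atomless_cantor_embedding:
  assumes "standard_borel M" "atomless M" "space M \<notin> null_sets M"
  obtains c :: "(nat \<Rightarrow> bool) \<Rightarrow> 'a" and l where
    "c \<in> cantor TYPE(nat) \<rightarrow>\<^sub>M M" "l \<in> M \<rightarrow>\<^sub>M cantor TYPE(nat)" "\<And>\<alpha>. l (c \<alpha>) = \<alpha>"
proof -
  obtain d where d: "Metric_space (space M) d" "Metric_space.mcomplete (space M) d"
    "second_countable (Metric_space.mtopology (space M) d)"
    "sets M = sigma_sets (space M) {U. openin (Metric_space.mtopology (space M) d) U}"
    by (rule standard_borelE[OF assms(1)])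
  interpret Metric_space "space M" d by fact
  have open_sets: "U \<in> sets M" if "openin mtopology U" for U using that d(4) by auto
  have closed_sets: "A \<in> sets M" if "closedin mtopology A" for A
  proof -
    have "A = space M - (space M - A)" "space M - A \<in> sets M"
      using that by (auto simp: closedin_def intro!: open_sets)
    then show ?thesis by (metis sets.compl_sets)
  qed
  obtain \<B> where B: "countable \<B>" "\<And>V. V \<in> \<B> \<Longrightarrow> openin mtopology V"
    "\<And>U x. openin mtopology U \<Longrightarrow> x \<in> U \<Longrightarrow> \<exists>V\<in>\<B>. x \<in> V \<and> V \<subseteq> U"
    using d(3) unfolding second_countable_def by metis
  define good where "good = (\<lambda>A. closedin mtopology A \<and> A \<notin> null_sets M)"
  have step: "\<exists>A0 A1. good A0 \<and> good A1 \<and> A0 \<subseteq> A \<and> A1 \<subseteq> A \<and> A0 \<inter> A1 = {}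
      \<and> (\<exists>a. A0 \<subseteq> mcball a e) \<and> (\<exists>a. A1 \<subseteq> mcball a e)"
    if A: "good A" and e: "e > 0" for A e
  proof -
    have As: "A \<in> sets M" "A \<notin> null_sets M" "A \<subseteq> space M"
      using A closed_sets closedin_subset[of mtopology A] by (auto simp: good_def)
    \<comment> \<open>The part of \<open>A\<close> inside \<open>N\<close> is null, and every ball
      around a point of \<open>A - N\<close> has non-null trace on \<open>A\<close>. Since
      \<open>A\<close> is non-null and singletons are null, \<open>A - N\<close> contains two points
      to split along.\<close>
    define N where "N = \<Union>{V\<in>\<B>. V \<inter> A \<in> null_sets M}"
    have "(\<Union>V\<in>{V\<in>\<B>. V \<inter> A \<in> null_sets M}. V \<inter> A) \<in> null_sets M"
      using B(1) by (intro null_sets_UN') auto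
    moreover have "N \<inter> A = (\<Union>V\<in>{V\<in>\<B>. V \<inter> A \<in> null_sets M}. V \<inter> A)" by (auto simp: N_def)
    ultimately have N: "N \<inter> A \<in> null_sets M" by simp
    have supp: "mball x \<rho> \<inter> A \<notin> null_sets M" if "x \<in> A - N" "\<rho> > 0" for x \<rho>
    proof
      assume n: "mball x \<rho> \<inter> A \<in> null_sets M"
      have "x \<in> mball x \<rho>" using that As(3) by auto
      then obtain V where V: "V \<in> \<B>" "x \<in> V" "V \<subseteq> mball x \<rho>"
        using B(3)[OF openin_mball] by blast
      have "V \<inter> A \<in> null_sets M"
        by (rule null_sets_subset[OF n]) (use V B(2) open_sets As in auto)
      then show False using V that by (auto simp: N_def)
    qed
    have "A - N \<noteq> {}" using N As by (metis Diff_eq_empty_iff inf.absorb_iff2)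
    then obtain x where x: "x \<in> A - N" by auto
    have "A - N \<noteq> {x}"
    proof
      assume "A - N = {x}"
      then have "A = (N \<inter> A) \<union> {x}" by auto
      then show False using N standard_borel_null_singleton[OF assms(1,2), of x] As x
        by (metis DiffD1 null_sets.Un subsetD)
    qed
    then obtain y where y: "y \<in> A - N" "y \<noteq> x" using x by auto
    \<comment> \<open>A third of the distance keeps the two closed balls disjoint; the bound
      \<open>e\<close> keeps them small.\<close>
    define \<rho> where "\<rho> = min e (d x y / 3)"
    have xs: "x \<in> space M" "y \<in> space M" using x y As by auto
    have xy: "x \<in> space M" "y \<in> space M" "d x y > 0" using xs mdist_pos_less[OF y(2)[symmetric] xs] by auto
    then have \<rho>: "\<rho> > 0" "\<rho> \<le> e" "\<rho> < d x y / 2" using e by (auto simp: \<rho>_def min_def)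
    have "good (mcball z \<rho> \<inter> A)" if "z \<in> A - N" for z
    proof -
      have "closedin mtopology (mcball z \<rho> \<inter> A)" using A by (auto simp: good_def)
      moreover have "mcball z \<rho> \<inter> A \<notin> null_sets M"
      proof
        assume "mcball z \<rho> \<inter> A \<in> null_sets M"
        then have "mball z \<rho> \<inter> A \<in> null_sets M"
          by (rule null_sets_subset) (use mball_subset_mcball[of z \<rho>] As open_sets in auto)
        then show False using supp[OF that \<rho>(1)] by simp
      qed
      ultimately show ?thesis by (simp add: good_def)
    qed
    moreover have "(mcball x \<rho> \<inter> A) \<inter> (mcball y \<rho> \<inter> A) = {}"
    proof (rule ccontr)
      assume "\<not> ?thesis"
      then obtain z where z: "z \<in> space M" "d x z \<le> \<rho>" "d y z \<le> \<rho>" by auto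
      then have "d x y \<le> d x z + d z y" using triangle xy by blast
      then show False using z \<rho> commute[of z y] by auto
    qed
    moreover have "mcball z \<rho> \<subseteq> mcball z e" for z using \<rho> by auto
    ultimately show ?thesis using x y by blast
  qed
  define \<epsilon> :: "nat \<Rightarrow> real" where "\<epsilon> = (\<lambda>m. 1 / real (Suc m))"
  have \<epsilon>0: "\<epsilon> m > 0" for m by (simp add: \<epsilon>_def)
  have \<epsilon>lim: "\<epsilon> \<longlonglongrightarrow> 0" unfolding \<epsilon>_def using LIMSEQ_inverse_real_of_nat by (simp add: inverse_eq_divide)
  have "\<exists>K. good A \<longrightarrow> good (K False) \<and> good (K True) \<and> K False \<subseteq> A \<and> K True \<subseteq> A \<and> K False \<inter> K True = {}
      \<and> (\<exists>a. K False \<subseteq> mcball a (\<epsilon> n)) \<and> (\<exists>a. K True \<subseteq> mcball a (\<epsilon> n))" for A n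
  proof (cases "good A")
    case True
    from step[OF True \<epsilon>0[of n]] obtain A0 A1 where "good A0 \<and> good A1 \<and> A0 \<subseteq> A \<and> A1 \<subseteq> A \<and> A0 \<inter> A1 = {}
      \<and> (\<exists>a. A0 \<subseteq> mcball a (\<epsilon> n)) \<and> (\<exists>a. A1 \<subseteq> mcball a (\<epsilon> n))" by blast
    then show ?thesis by (intro exI[of _ "\<lambda>b. if b then A1 else A0"]) simp
  qed simp
  then obtain K where K: "\<And>A n. good A \<Longrightarrow> good (K A n False) \<and> good (K A n True) \<and> K A n False \<subseteq> A \<and> K A n True \<subseteq> A
      \<and> K A n False \<inter> K A n True = {} \<and> (\<exists>a. K A n False \<subseteq> mcball a (\<epsilon> n)) \<and> (\<exists>a. K A n True \<subseteq> mcball a (\<epsilon> n))"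
    by metis
  have K1': "good (K A n b) \<and> K A n b \<subseteq> A \<and> (\<exists>a. K A n b \<subseteq> mcball a (\<epsilon> n))" if "good A" for A n b
    using K[OF that, of n] by (induct b) blast+
  note K1 = K1'[THEN conjunct1] K1'[THEN conjunct2, THEN conjunct1] K1'[THEN conjunct2, THEN conjunct2]
  \<comment> \<open>The head of the list is the latest digit, and the length of the tail selects the
    radius used at that level of the scheme.\<close>
  define E where "E = rec_list (space M) (\<lambda>b s A. K A (length s) b)"
  have E0: "E [] = space M" and E1: "E (b # s) = K (E s) (length s) b" for b s by (simp_all add: E_def)
  have gE: "good (E s)" for s
  proof (induction s)
    case Nil
    have "closedin mtopology (space M)" using closedin_topspace[of mtopology] by simp
    then show ?case using assms(3) by (simp add: E0 good_def)
  qed (simp add: E1 K1)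
  have E_disj: "s = t" if "length s = length t" "x \<in> E s" "x \<in> E t" for s t x
    using that
  proof (induction s t rule: list_induct2)
    case (Cons a s b t)
    then have "s = t" using K1(2)[OF gE] by (auto simp: E1)
    moreover have "a = b" using Cons.prems K[OF gE, of s "length s"] \<open>s = t\<close>
      by (cases a; cases b) (auto simp: E1)
    ultimately show ?case by simp
  qed simp
  define p where "p = (\<lambda>(\<alpha>::nat \<Rightarrow> bool). rec_nat [] (\<lambda>n s. \<alpha> n # s))"
  have p0: "p \<alpha> 0 = []" and p1: "p \<alpha> (Suc n) = \<alpha> n # p \<alpha> n" for \<alpha> n by (simp_all add: p_def)
  have lp: "length (p \<alpha> n) = n" for \<alpha> n by (induction n) (auto simp: p0 p1)
  have small: "\<exists>a. E (p \<alpha> (Suc n)) \<subseteq> mcball a (\<epsilon> n)" for \<alpha> n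
    using K1(3)[OF gE, of _ "length (p \<alpha> n)"] by (simp add: p1 E1 lp)
  have p_meas[measurable]: "(\<lambda>\<alpha>. p \<alpha> n) \<in> cantor TYPE(nat) \<rightarrow>\<^sub>M count_space UNIV" for n
  proof (induction n)
    case (Suc n)
    note Suc[measurable]
    have "(\<lambda>\<alpha>. (\<lambda>b s. b # s) (\<alpha> n) (p \<alpha> n)) \<in> cantor TYPE(nat) \<rightarrow>\<^sub>M count_space UNIV"
      by (rule measurable_compose_countable'[OF _ Suc countableI_type]) (simp, measurable)
    then show ?case by (simp add: p1)
  qed (simp add: p0)
  have "\<exists>x. x \<in> space M \<and> (\<forall>n. x \<in> E (p \<alpha> n))" for \<alpha>
  proof -
    have "\<Inter>(range (\<lambda>n. E (p \<alpha> n))) \<noteq> {}"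
    proof (rule mcomplete_nest[THEN iffD1, rule_format, OF d(2)], intro conjI allI impI)
      show "closedin mtopology (E (p \<alpha> n))" for n using gE by (auto simp: good_def)
      show "E (p \<alpha> n) \<noteq> {}" for n using gE[of "p \<alpha> n"] by (auto simp: good_def)
      show "decseq (\<lambda>n. E (p \<alpha> n))"
        by (rule decseq_SucI) (use K1(2)[OF gE] in \<open>auto simp: p1 E1\<close>)
      fix e :: real assume "e > 0"
      then have "\<forall>\<^sub>F m in sequentially. \<epsilon> m < e" using \<epsilon>lim by (auto dest: order_tendstoD(2)[of _ _ _ e])
      then obtain m where m: "\<epsilon> m < e" using eventually_happens'[OF sequentially_bot] by blast
      show "\<exists>n a. E (p \<alpha> n) \<subseteq> mcball a e"
        using small[of \<alpha> m] mcball_subset_concentric[of "\<epsilon> m" e] m by (meson less_imp_le order_trans)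
    qed
    then obtain x where x: "\<And>n. x \<in> E (p \<alpha> n)" by auto
    then show ?thesis using x[of 0] unfolding p0 E0 by blast
  qed
  then obtain c where c: "\<And>\<alpha>. c \<alpha> \<in> space M" "\<And>\<alpha> n. c \<alpha> \<in> E (p \<alpha> n)" by metis
  \<comment> \<open>Digit \<open>n\<close> is read off at level \<open>Suc n\<close>: it is true iff
    \<open>x\<close> lies in a cell whose latest digit is \<open>True\<close>. For points of the
    form \<open>c \<alpha>\<close> this cell is unique by \<open>E_disj\<close>.\<close>
  define l where "l = (\<lambda>x n. \<exists>s\<in>{s. length s = n}. x \<in> E (True # s))"
  show ?thesis
  proof (rule that[of c l])
    have "c \<in> cantor TYPE(nat) \<rightarrow>\<^sub>M sigma (space M) {U. openin mtopology U}"
    proof (rule measurable_measure_of)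
      show "{U. openin mtopology U} \<subseteq> Pow (space M)" using openin_subset[of mtopology] by auto
      show "c \<in> space (cantor TYPE(nat)) \<rightarrow> space M" using c by auto
      fix U assume "U \<in> {U. openin mtopology U}"
      then have U: "openin mtopology U" by simp
      have "c \<alpha> \<in> U \<longleftrightarrow> (\<exists>n. E (p \<alpha> n) \<subseteq> U)" for \<alpha>
      proof
        assume "c \<alpha> \<in> U"
        then obtain e where e: "e > 0" "mball (c \<alpha>) e \<subseteq> U" using U by (auto simp: openin_mtopology)
        then have "\<forall>\<^sub>F m in sequentially. \<epsilon> m < e / 2"
          using \<epsilon>lim by (auto dest: order_tendstoD(2)[of _ _ _ "e/2"])
        then obtain m where m: "\<epsilon> m < e / 2" using eventually_happens'[OF sequentially_bot] by blast
        obtain a where a: "E (p \<alpha> (Suc m)) \<subseteq> mcball a (\<epsilon> m)" using small by blast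
        have "E (p \<alpha> (Suc m)) \<subseteq> mball (c \<alpha>) e"
        proof
          fix y assume y: "y \<in> E (p \<alpha> (Suc m))"
          have ya: "y \<in> mcball a (\<epsilon> m)" and ca: "c \<alpha> \<in> mcball a (\<epsilon> m)"
            using a y c(2)[of \<alpha> "Suc m"] by auto
          then have "d (c \<alpha>) y \<le> d (c \<alpha>) a + d a y" by (intro triangle) auto
          then show "y \<in> mball (c \<alpha>) e" using ya ca m commute[of "c \<alpha>" a] by auto
        qed
        then show "\<exists>n. E (p \<alpha> n) \<subseteq> U" using e by blast
      qed (use c in blast)
      then have "c -` U \<inter> space (cantor TYPE(nat)) = {\<alpha> \<in> space (cantor TYPE(nat)). \<exists>n. E (p \<alpha> n) \<subseteq> U}" by auto
      also have "\<dots> \<in> sets (cantor TYPE(nat))"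
      proof -
        have "Measurable.pred (cantor TYPE(nat)) (\<lambda>\<alpha>. E (p \<alpha> n) \<subseteq> U)" for n
          by (rule measurable_compose[OF p_meas]) simp
        then show ?thesis unfolding pred_def[symmetric] by (intro pred_intros_countable)
      qed
      finally show "c -` U \<inter> space (cantor TYPE(nat)) \<in> sets (cantor TYPE(nat))" .
    qed
    moreover have "sets (sigma (space M) {U. openin mtopology U}) = sets M"
      unfolding d(4) using openin_subset[of mtopology] by (auto simp: sets_measure_of subset_iff)
    ultimately show "c \<in> cantor TYPE(nat) \<rightarrow>\<^sub>M M" by (subst (asm) measurable_cong_sets[OF refl])
    show "l \<in> M \<rightarrow>\<^sub>M cantor TYPE(nat)"
    proof (rule measurable_PiM_single')
      fix n
      have "Measurable.pred M (\<lambda>x. x \<in> E (True # s))" for s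
        by (rule pred_sets2[OF _ measurable_ident_sets[OF refl]]) (use gE closed_sets in \<open>auto simp: good_def\<close>)
      then show "(\<lambda>x. l x n) \<in> M \<rightarrow>\<^sub>M count_space UNIV"
        unfolding l_def by (intro pred_intros_countable_bounded) auto
    qed auto
    fix \<alpha>
    show "l (c \<alpha>) = \<alpha>"
    proof
      fix n
      show "l (c \<alpha>) n = \<alpha> n"
      proof
        assume "l (c \<alpha>) n"
        then obtain s where "length s = n" "c \<alpha> \<in> E (True # s)" by (auto simp: l_def)
        then have "True # s = p \<alpha> (Suc n)" using c(2)[of \<alpha> "Suc n"] by (intro E_disj) (auto simp: lp)
        then show "\<alpha> n" by (simp add: p1)
      next
        assume "\<alpha> n"
        then show "l (c \<alpha>) n" using c(2)[of \<alpha> "Suc n"] lp[of \<alpha> n] by (auto simp: l_def p1)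
      qed
    qed
  qed
qed

section \<open>Lifting automorphisms of the measure algebra\<close>

lemma borel_bijI:
  assumes "S \<in> M \<rightarrow>\<^sub>M M" "R \<in> M \<rightarrow>\<^sub>M M" "S \<in> extensional (space M)"
    and RS: "\<And>x. x \<in> space M \<Longrightarrow> R (S x) = x" and SR: "\<And>x. x \<in> space M \<Longrightarrow> S (R x) = x"
  shows "S \<in> borel_bij M" and "\<And>A. A \<in> sets M \<Longrightarrow> S ` A = R -` A \<inter> space M"
proof -
  have sp: "S x \<in> space M" "R x \<in> space M" if "x \<in> space M" for x
    using measurable_space[OF assms(1) that] measurable_space[OF assms(2) that] by auto
  show im: "S ` A = R -` A \<inter> space M" if "A \<in> sets M" for A
  proof (intro equalityI subsetI)
    fix y assume "y \<in> S ` A"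
    then show "y \<in> R -` A \<inter> space M" using sets.sets_into_space[OF that] RS sp by auto
  next
    fix y assume "y \<in> R -` A \<inter> space M"
    then show "y \<in> S ` A" using SR by (intro image_eqI[of _ _ "R y"]) auto
  qed
  have "bij_betw S (space M) (space M)"
    by (rule bij_betw_byWitness[where f' = R]) (use RS SR sp in auto)
  then show "S \<in> borel_bij M"
    using assms im measurable_sets[OF assms(2)] by (simp add: borel_bij_def Bij_def)
qed

section \<open>Borel injections with left inverse, null copies of the space,
  Schroeder-Bernstein\<close>

text \<open>The left inverse makes the image explicit: \<open>y\<close> belongs to it iff
  \<open>j (k y) = y\<close> and \<open>k y\<close> is in \<open>A\<close>. The first condition is
  measurable by \<open>standard_borel_eq_measurable\<close>.\<close>

lemma image_retract_measurable:
  assumes M: "standard_borel M" and j: "j \<in> M \<rightarrow>\<^sub>M M" and k: "k \<in> M \<rightarrow>\<^sub>M M"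
    and kj: "\<And>x. x \<in> space M \<Longrightarrow> k (j x) = x" and A: "A \<in> sets M"
  shows "j ` A \<in> sets M"
proof -
  have "j ` A = {y \<in> space M. j (k y) = y} \<inter> (k -` A \<inter> space M)"
    using sets.sets_into_space[OF A] measurable_space[OF j] kj by force
  moreover have "{y \<in> space M. j (k y) = y} \<in> sets M"
    by (rule standard_borel_eq_measurable[OF M measurable_compose[OF k j] measurable_ident_sets[OF refl]])
  ultimately show ?thesis using measurable_sets[OF k A] by simp
qed

text \<open>A standard Borel space embeds into each of uncountably many disjoint copies of the Cantor set
  inside \<open>M\<close>; all but countably many of them are null.\<close>

lemma null_self_embedding:
  assumes "standard_sigma_finite M"
  obtains j k where "j \<in> M \<rightarrow>\<^sub>M M" "k \<in> M \<rightarrow>\<^sub>M M" "\<And>x. x \<in> space M \<Longrightarrow> k (j x) = x"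
    "j ` space M \<in> null_sets M"
proof -
  have M: "standard_borel M" "atomless M" "sigma_finite_measure M" "emeasure M (space M) = \<infinity>"
    using assms by (auto simp: standard_sigma_finite_def)
  interpret sigma_finite_measure M by fact
  have nn: "space M \<notin> null_sets M" "space M \<noteq> {}" using M(4) by (auto simp: null_sets_def)
  obtain h :: "'a \<Rightarrow> nat \<times> nat \<Rightarrow> bool" and r where
    h[measurable]: "h \<in> M \<rightarrow>\<^sub>M cantor TYPE(nat \<times> nat)" and r[measurable]: "r \<in> cantor TYPE(nat \<times> nat) \<rightarrow>\<^sub>M M"
    and rh: "\<And>x. x \<in> space M \<Longrightarrow> r (h x) = x" by (rule standard_borel_retract[OF M(1) nn(2)]) blast
  obtain c :: "(nat \<Rightarrow> bool) \<Rightarrow> 'a" and l where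
    c[measurable]: "c \<in> cantor TYPE(nat) \<rightarrow>\<^sub>M M" and l[measurable]: "l \<in> M \<rightarrow>\<^sub>M cantor TYPE(nat)"
    and lc: "\<And>\<alpha>. l (c \<alpha>) = \<alpha>" by (rule atomless_cantor_embedding[OF M(1,2) nn(1)]) blast
  \<comment> \<open>Even coordinates carry the label \<open>\<alpha>\<close>, odd ones the code of
    \<open>x\<close>. Distinct labels therefore give disjoint images, while one map \<open>k\<close>
    decodes all of them.\<close>
  define J where "J = (\<lambda>\<alpha> x. c (\<lambda>n. if even n then \<alpha> (n div 2) else h x (prod_decode (n div 2))))"
  define k where "k = (\<lambda>y. r (\<lambda>p. l y (2 * prod_encode p + 1)))"
  have Jm: "J \<alpha> \<in> M \<rightarrow>\<^sub>M M" for \<alpha>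
    unfolding J_def
    by (rule measurable_compose[OF _ c], rule measurable_PiM_single') auto
  have km: "k \<in> M \<rightarrow>\<^sub>M M"
    unfolding k_def
    by (rule measurable_compose[OF _ r], rule measurable_PiM_single') auto
  have kJ: "k (J \<alpha> x) = x" if "x \<in> space M" for \<alpha> x
    using that by (simp add: k_def J_def lc rh)
  have lJ: "l (J \<alpha> x) (2 * n) = \<alpha> n" for \<alpha> x n by (simp add: J_def lc)
  have Z: "J \<alpha> ` space M \<in> sets M" for \<alpha>
    by (rule image_retract_measurable[OF M(1) Jm km kJ]) auto
  have disj: "\<alpha> = \<beta>" if y: "y \<in> J \<alpha> ` space M" "y \<in> J \<beta> ` space M" for \<alpha> \<beta> y
  proof
    fix n
    obtain x x' where "y = J \<alpha> x" "y = J \<beta> x'" using y by blast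
    then show "\<alpha> n = \<beta> n" using lJ by metis
  qed
  have "\<exists>\<alpha>. J \<alpha> ` space M \<in> null_sets M"
  proof (rule ccontr)
    assume "\<not> ?thesis"
    then have "countable (range (\<lambda>\<alpha>. J \<alpha> ` space M))"
      using Z disj by (intro countable_disjoint_nonnull) (auto simp: disjoint_def, blast+)
    moreover have "inj (\<lambda>\<alpha>. J \<alpha> ` space M)"
    proof (rule injI)
      fix \<alpha> \<beta> assume "J \<alpha> ` space M = J \<beta> ` space M"
      then show "\<alpha> = \<beta>" using nn(2) disj by blast
    qed
    ultimately have "countable (UNIV :: (nat \<Rightarrow> bool) set)" by (rule countable_image_inj_on)
    then obtain f :: "nat \<Rightarrow> nat \<Rightarrow> bool" where f: "range f = UNIV" by (metis UNIV_not_empty range_from_nat_into)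
    then obtain n where "f n = (\<lambda>i. \<not> f i i)" by (metis UNIV_I imageE)
    then have "f n n = (\<not> f n n)" by (rule fun_cong)
    then show False by simp
  qed
  then show ?thesis using that[OF Jm km kJ] by blast
qed

text \<open>Because its image lies in both sets, \<open>j\<close> serves as the injection in either
  direction. As in the classical argument, \<open>P\<close> collects the iterates under
  \<open>j\<close> composed with \<open>j\<close> of the part of \<open>E1\<close> not reached from
  \<open>E2\<close>; the bijection is \<open>j\<close> on \<open>P\<close> and the decoder
  \<open>k\<close> elsewhere. Iterates of Borel sets stay Borel by
  \<open>image_retract_measurable\<close>.\<close>

lemma borel_Schroeder_Bernstein:
  assumes M: "standard_borel M" and j: "j \<in> M \<rightarrow>\<^sub>M M" and k: "k \<in> M \<rightarrow>\<^sub>M M"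
    and kj: "\<And>x. x \<in> space M \<Longrightarrow> k (j x) = x"
    and E: "E1 \<in> sets M" "E2 \<in> sets M" "j ` space M \<subseteq> E1" "j ` space M \<subseteq> E2"
  obtains s r where "s \<in> M \<rightarrow>\<^sub>M M" "r \<in> M \<rightarrow>\<^sub>M M"
    "\<And>x. x \<in> E1 \<Longrightarrow> s x \<in> E2 \<and> r (s x) = x" "\<And>y. y \<in> E2 \<Longrightarrow> r y \<in> E1 \<and> s (r y) = y"
proof -
  note im = image_retract_measurable[OF M j k kj]
  have sp: "E1 \<subseteq> space M" "E2 \<subseteq> space M"
    using sets.sets_into_space[OF E(1)] sets.sets_into_space[OF E(2)] by auto
  have jsp: "j x \<in> space M" if "x \<in> space M" for x using measurable_space[OF j that] .
  define Q where "Q = rec_nat (E1 - j ` E2) (\<lambda>_ A. j ` j ` A)"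
  have Q0: "Q 0 = E1 - j ` E2" and Q1: "Q (Suc n) = j ` j ` Q n" for n by (simp_all add: Q_def)
  have Qs: "Q n \<in> sets M" for n
    by (induction n) (use E im in \<open>auto simp: Q0 Q1\<close>)
  have QE: "Q n \<subseteq> E1" for n
  proof (cases n)
    case (Suc m)
    have "Q m \<subseteq> space M" using Qs sets.sets_into_space by blast
    then show ?thesis using E(3) jsp by (auto simp: Suc Q1)
  qed (auto simp: Q0)
  define P where "P = (\<Union>n. Q n)"
  have P: "P \<in> sets M" "P \<subseteq> E1" "j ` P \<in> sets M" using Qs QE im by (auto simp: P_def)
  have P1: "x \<in> P \<or> x \<in> j ` E2" if "x \<in> E1" for x using that by (auto simp: P_def intro: exI[of _ 0] simp: Q0)
  have P2: "j (j w) \<in> P" if "w \<in> P" for w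
    using that Q1 unfolding P_def by (metis UN_iff UNIV_I imageI)
  have P3: "y \<in> j ` P" if "j y \<in> P" "y \<in> E2" for y
  proof -
    obtain n where n: "j y \<in> Q n" using \<open>j y \<in> P\<close> by (auto simp: P_def)
    show ?thesis
    proof (cases n)
      case 0
      then show ?thesis using n that by (auto simp: Q0)
    next
      case (Suc m)
      then obtain w where w: "w \<in> Q m" "j y = j (j w)" using n by (auto simp: Q1)
      then have "w \<in> space M" using QE sp by blast
      then have "y = j w" using w(2) kj jsp that sp by (metis subsetD)
      then show ?thesis using w by (auto simp: P_def)
    qed
  qed
  define s where "s = (\<lambda>x. if x \<in> P then j x else k x)"
  define r where "r = (\<lambda>y. if y \<in> j ` P then k y else j y)"
  show ?thesis
  proof (rule that[of s r])
    show "s \<in> M \<rightarrow>\<^sub>M M" unfolding s_def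
      by (rule measurable_If_set[OF j k]) (use P sets.sets_into_space in \<open>auto simp: Int_absorb2\<close>)
    show "r \<in> M \<rightarrow>\<^sub>M M" unfolding r_def
      by (rule measurable_If_set[OF k j]) (use P(3) in auto)
    show "s x \<in> E2 \<and> r (s x) = x" if "x \<in> E1" for x
    proof (cases "x \<in> P")
      case True
      have "x \<in> space M" using that sp by auto
      then have "j x \<in> E2" using E(4) by auto
      then show ?thesis using True \<open>x \<in> space M\<close> kj by (simp add: s_def r_def)
    next
      case False
      then obtain z where z: "z \<in> E2" "x = j z" using P1 \<open>x \<in> E1\<close> by auto
      then have "z \<notin> j ` P" using False P2 by auto
      moreover have "k x = z" using z kj sp by auto
      ultimately show ?thesis using z False by (simp add: s_def r_def)
    qed
    show "r y \<in> E1 \<and> s (r y) = y" if "y \<in> E2" for y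
    proof (cases "y \<in> j ` P")
      case True
      then obtain w where w: "w \<in> P" "y = j w" by auto
      then have "k y = w" using kj sp P by auto
      then show ?thesis using w True P by (auto simp: s_def r_def)
    next
      case False
      then have "j y \<notin> P" using P3 that by auto
      moreover have "y \<in> space M" using that sp by auto
      moreover have "j y \<in> E1" using E(3) calculation(2) by auto
      ultimately show ?thesis using False kj by (simp add: s_def r_def)
    qed
  qed
qed

text \<open>Countably many coordinate sets of the code separate points, so only countably many
  exceptional null sets have to be collected.\<close>

lemma AE_eq_if_AE_mem_iff:
  assumes M: "standard_borel M" and u: "u \<in> N \<rightarrow>\<^sub>M M" and v: "v \<in> N \<rightarrow>\<^sub>M M"
    and uv: "\<And>B. B \<in> sets M \<Longrightarrow> AE x in N. u x \<in> B \<longleftrightarrow> v x \<in> B"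
  shows "AE x in N. u x = v x"
proof (cases "space M = {}")
  case True
  then have "space N = {}" using u by (auto simp: measurable_def)
  then show ?thesis by (intro AE_I2) simp
next
  case False
  obtain h :: "'a \<Rightarrow> nat \<times> nat \<Rightarrow> bool" and r where
    h[measurable]: "h \<in> M \<rightarrow>\<^sub>M cantor TYPE(nat \<times> nat)" and
    rh: "\<And>x. x \<in> space M \<Longrightarrow> r (h x) = x" by (rule standard_borel_retract[OF M False]) blast
  have "{y \<in> space M. h y i} \<in> sets M" for i by measurable
  then have "AE x in N. \<forall>i. u x \<in> {y \<in> space M. h y i} \<longleftrightarrow> v x \<in> {y \<in> space M. h y i}"
    using uv by (simp only: AE_all_countable) blast
  then show ?thesis using AE_space
  proof eventually_elim
    case (elim x)
    have sp: "u x \<in> space M" "v x \<in> space M" using elim u v measurable_space by metis+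
    then have "h (u x) i = h (v x) i" for i using spec[OF elim(1), of i] by simp
    then have "h (u x) = h (v x)" by (intro ext)
    then show ?case using rh sp by metis
  qed
qed

section \<open>Order automorphisms of the measure algebra\<close>

lemma AE_iff_conv:
  "(AE x in M. P x \<longleftrightarrow> Q x) \<longleftrightarrow> (AE x in M. P x \<longrightarrow> Q x) \<and> (AE x in M. Q x \<longrightarrow> P x)"
proof
  assume "AE x in M. P x \<longleftrightarrow> Q x"
  then show "(AE x in M. P x \<longrightarrow> Q x) \<and> (AE x in M. Q x \<longrightarrow> P x)" by (auto elim: eventually_mono)
next
  assume "(AE x in M. P x \<longrightarrow> Q x) \<and> (AE x in M. Q x \<longrightarrow> P x)"
  then have "AE x in M. P x \<longrightarrow> Q x" "AE x in M. Q x \<longrightarrow> P x" by simp_all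
  then show "AE x in M. P x \<longleftrightarrow> Q x" by eventually_elim blast
qed

text \<open>An automorphism of the measure algebra, acting on representatives and given by its order
  alone. Reflecting the order makes it injective modulo null sets, and with surjectivity it respects
  all Boolean and countable operations, as these are determined by the order.\<close>

locale measure_algebra_iso =
  fixes M :: "'a measure" and \<theta> :: "'a set \<Rightarrow> 'a set"
  assumes closed[measurable, intro]: "A \<in> sets M \<Longrightarrow> \<theta> A \<in> sets M"
    and order: "A \<in> sets M \<Longrightarrow> B \<in> sets M \<Longrightarrow>
      (AE x in M. x \<in> \<theta> A \<longrightarrow> x \<in> \<theta> B) \<longleftrightarrow> (AE x in M. x \<in> A \<longrightarrow> x \<in> B)"
    and surj: "B \<in> sets M \<Longrightarrow> \<exists>A\<in>sets M. AE x in M. x \<in> \<theta> A \<longleftrightarrow> x \<in> B"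
begin

lemma cong:
  assumes "A \<in> sets M" "B \<in> sets M"
  shows "(AE x in M. x \<in> \<theta> A \<longleftrightarrow> x \<in> \<theta> B) \<longleftrightarrow> (AE x in M. x \<in> A \<longleftrightarrow> x \<in> B)"
  unfolding AE_iff_conv order[OF assms] order[OF assms(2,1)] ..

lemma null:
  assumes "A \<in> sets M" "AE x in M. x \<notin> A"
  shows "AE x in M. x \<notin> \<theta> A"
proof -
  obtain E where E: "E \<in> sets M" "AE x in M. x \<in> \<theta> E \<longleftrightarrow> x \<in> {}" using surj[of "{}"] by auto
  have "AE x in M. x \<in> A \<longrightarrow> x \<in> E" using assms(2) by eventually_elim simp
  then have "AE x in M. x \<in> \<theta> A \<longrightarrow> x \<in> \<theta> E" using order[OF assms(1) E(1)] by simp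
  then show ?thesis using E(2) by eventually_elim simp
qed

lemma conull:
  assumes "A \<in> sets M" "AE x in M. x \<in> A"
  shows "AE x in M. x \<in> \<theta> A"
proof -
  obtain E where E: "E \<in> sets M" "AE x in M. x \<in> \<theta> E \<longleftrightarrow> x \<in> space M" using surj[of "space M"] by auto
  have "AE x in M. x \<in> E \<longrightarrow> x \<in> A" using assms(2) by eventually_elim simp
  then have "AE x in M. x \<in> \<theta> E \<longrightarrow> x \<in> \<theta> A" using order[OF E(1) assms(1)] by simp
  then show ?thesis using E(2) AE_space by eventually_elim simp
qed

text \<open>The meet and the join of the two images are images of some \<open>D\<close> and
  \<open>F\<close> by surjectivity. Then \<open>D\<close> is below both \<open>A\<close> and its
  complement, hence null, and \<open>F\<close> is above both, hence conull.\<close>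

lemma compl:
  assumes A: "A \<in> sets M"
  shows "AE x in M. x \<in> \<theta> (space M - A) \<longleftrightarrow> x \<notin> \<theta> A"
proof -
  let ?C = "space M - A"
  have C: "?C \<in> sets M" using A by auto
  obtain D where D: "D \<in> sets M" "AE x in M. x \<in> \<theta> D \<longleftrightarrow> x \<in> \<theta> A \<inter> \<theta> ?C"
    using surj[of "\<theta> A \<inter> \<theta> ?C"] A C by auto
  have "AE x in M. x \<in> \<theta> D \<longrightarrow> x \<in> \<theta> A" "AE x in M. x \<in> \<theta> D \<longrightarrow> x \<in> \<theta> ?C"
    using D(2) by (eventually_elim, simp)+
  then have "AE x in M. x \<in> D \<longrightarrow> x \<in> A" "AE x in M. x \<in> D \<longrightarrow> x \<in> ?C"
    using order A C D(1) by auto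
  then have "AE x in M. x \<notin> D" by eventually_elim auto
  then have 1: "AE x in M. x \<notin> \<theta> D" using null D(1) by auto
  obtain F where F: "F \<in> sets M" "AE x in M. x \<in> \<theta> F \<longleftrightarrow> x \<in> \<theta> A \<union> \<theta> ?C"
    using surj[of "\<theta> A \<union> \<theta> ?C"] A C by auto
  have "AE x in M. x \<in> \<theta> A \<longrightarrow> x \<in> \<theta> F" "AE x in M. x \<in> \<theta> ?C \<longrightarrow> x \<in> \<theta> F"
    using F(2) by (eventually_elim, simp)+
  then have "AE x in M. x \<in> A \<longrightarrow> x \<in> F" "AE x in M. x \<in> ?C \<longrightarrow> x \<in> F"
    using order A C F(1) by auto
  then have "AE x in M. x \<in> F" using AE_space by eventually_elim auto
  then have 2: "AE x in M. x \<in> \<theta> F" using conull F(1) by auto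
  show ?thesis using 1 2 D(2) F(2) by eventually_elim auto
qed

text \<open>Both sides are least upper bounds of the sets \<open>\<theta> (A n)\<close>; the right
  one is pulled back to some \<open>D\<close> to be compared with the union of the
  \<open>A n\<close>.\<close>

lemma UN:
  fixes A :: "nat \<Rightarrow> 'a set"
  assumes A: "\<And>n. A n \<in> sets M"
  shows "AE x in M. x \<in> \<theta> (\<Union>n. A n) \<longleftrightarrow> x \<in> (\<Union>n. \<theta> (A n))"
proof -
  have U: "(\<Union>n. A n) \<in> sets M" using A by auto
  obtain D where D: "D \<in> sets M" "AE x in M. x \<in> \<theta> D \<longleftrightarrow> x \<in> (\<Union>n. \<theta> (A n))"
    using surj[of "\<Union>n. \<theta> (A n)"] A by auto
  have "AE x in M. x \<in> \<theta> (A n) \<longrightarrow> x \<in> \<theta> D" for n using D(2) by eventually_elim auto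
  then have "AE x in M. x \<in> A n \<longrightarrow> x \<in> D" for n using order[OF A D(1)] by blast
  then have "AE x in M. \<forall>n. x \<in> A n \<longrightarrow> x \<in> D" by (rule AE_all_countable[THEN iffD2, OF allI])
  then have "AE x in M. x \<in> (\<Union>n. A n) \<longrightarrow> x \<in> D" by eventually_elim auto
  then have 1: "AE x in M. x \<in> \<theta> (\<Union>n. A n) \<longrightarrow> x \<in> \<theta> D" using order[OF U D(1)] by simp
  have "AE x in M. x \<in> \<theta> (A n) \<longrightarrow> x \<in> \<theta> (\<Union>n. A n)" for n
    by (rule order[OF A U, THEN iffD2]) auto
  then have "AE x in M. \<forall>n. x \<in> \<theta> (A n) \<longrightarrow> x \<in> \<theta> (\<Union>n. A n)" by (rule AE_all_countable[THEN iffD2, OF allI])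
  then show ?thesis using 1 D(2) by eventually_elim auto
qed

lemma inverse:
  obtains \<eta> where "measure_algebra_iso M \<eta>" "\<And>B. B \<in> sets M \<Longrightarrow> AE x in M. x \<in> \<theta> (\<eta> B) \<longleftrightarrow> x \<in> B"
proof -
  obtain \<eta> where \<eta>: "\<And>B. B \<in> sets M \<Longrightarrow> \<eta> B \<in> sets M"
    "\<And>B. B \<in> sets M \<Longrightarrow> AE x in M. x \<in> \<theta> (\<eta> B) \<longleftrightarrow> x \<in> B" using surj by metis
  have "measure_algebra_iso M \<eta>"
  proof
    show "\<eta> A \<in> sets M" if "A \<in> sets M" for A using \<eta>(1) that .
    show "(AE x in M. x \<in> \<eta> A \<longrightarrow> x \<in> \<eta> B) \<longleftrightarrow> (AE x in M. x \<in> A \<longrightarrow> x \<in> B)"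
      if AB: "A \<in> sets M" "B \<in> sets M" for A B
    proof -
      have "(AE x in M. x \<in> \<theta> (\<eta> A) \<longrightarrow> x \<in> \<theta> (\<eta> B)) \<longleftrightarrow> (AE x in M. x \<in> A \<longrightarrow> x \<in> B)"
      proof
        assume "AE x in M. x \<in> \<theta> (\<eta> A) \<longrightarrow> x \<in> \<theta> (\<eta> B)"
        then show "AE x in M. x \<in> A \<longrightarrow> x \<in> B" using AB[THEN \<eta>(2)] by eventually_elim auto
      next
        assume "AE x in M. x \<in> A \<longrightarrow> x \<in> B"
        then show "AE x in M. x \<in> \<theta> (\<eta> A) \<longrightarrow> x \<in> \<theta> (\<eta> B)" using AB[THEN \<eta>(2)] by eventually_elim auto
      qed
      then show ?thesis using order[OF AB[THEN \<eta>(1)]] by simp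
    qed
    show "\<exists>A\<in>sets M. AE x in M. x \<in> \<eta> A \<longleftrightarrow> x \<in> B" if "B \<in> sets M" for B
      using cong[of "\<eta> (\<theta> B)" B] \<eta> that closed[OF that] by (intro bexI[of _ "\<theta> B"]) auto
  qed
  then show ?thesis using that \<eta>(2) by blast
qed

text \<open>The map is built coordinate by coordinate in the Cantor space: \<open>k x\<close> has
  digit \<open>i\<close> exactly when \<open>x\<close> lies in the \<open>\<theta>\<close>-image of
  the set where \<open>h\<close> has digit \<open>i\<close>. Agreement with \<open>\<theta>\<close>
  on these generators spreads to all Borel sets of codes because \<open>\<theta>\<close> respects
  complements and countable unions. Decoding with \<open>r\<close> returns to
  \<open>M\<close>.\<close>

lemma lift_map:
  assumes M: "standard_borel M" "space M \<noteq> {}"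
  obtains f where "f \<in> M \<rightarrow>\<^sub>M M" "\<And>B. B \<in> sets M \<Longrightarrow> AE x in M. f x \<in> B \<longleftrightarrow> x \<in> \<theta> B"
proof -
  obtain h :: "'a \<Rightarrow> nat \<times> nat \<Rightarrow> bool" and r where
    h[measurable]: "h \<in> M \<rightarrow>\<^sub>M cantor TYPE(nat \<times> nat)" and r[measurable]: "r \<in> cantor TYPE(nat \<times> nat) \<rightarrow>\<^sub>M M"
    and rh: "\<And>x. x \<in> space M \<Longrightarrow> r (h x) = x" by (rule standard_borel_retract[OF M]) blast
  have sp: "space (cantor TYPE(nat \<times> nat)) = UNIV" by (simp add: space_PiM)
  define k where "k = (\<lambda>x i. x \<in> \<theta> {y \<in> space M. h y i})"
  have k: "k \<in> M \<rightarrow>\<^sub>M cantor TYPE(nat \<times> nat)"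
  proof (rule measurable_PiM_single')
    show "(\<lambda>x. k x i) \<in> M \<rightarrow>\<^sub>M count_space UNIV" for i
      unfolding k_def by (rule pred_sets2[OF _ measurable_ident_sets[OF refl]]) (intro closed, measurable)
  qed auto
  have key: "AE x in M. k x \<in> E \<longleftrightarrow> x \<in> \<theta> (h -` E \<inter> space M)" if "E \<in> sets (cantor TYPE(nat \<times> nat))" for E
  proof -
    have "E \<in> sigma_sets (\<Pi>\<^sub>E i\<in>UNIV. UNIV) {{f \<in> \<Pi>\<^sub>E i\<in>UNIV. UNIV. f i \<in> A} |i A. i \<in> (UNIV :: (nat \<times> nat) set) \<and> A \<in> sets (count_space (UNIV :: bool set))}"
      using that unfolding sets_PiM_single by simp
    then show ?thesis
    proof (induction rule: sigma_sets.induct)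
      case (Basic E)
      then obtain i and A :: "bool set" where E: "E = {f. f i \<in> A}" by auto
      let ?T = "{y \<in> space M. h y i}"
      have T: "?T \<in> sets M" by measurable
      have "A \<in> Pow {False, True}" by auto
      then consider "A = UNIV" | "A = {}" | "A = {True}" | "A = {False}"
        by (auto simp: Pow_insert UNIV_bool)
      then show ?case
      proof cases
        case 1
        show ?thesis using conull[of "space M"] by (auto simp: E 1)
      next
        case 2
        show ?thesis using null[of "{}"] by (auto simp: E 2)
      next
        case 3
        have "h -` E \<inter> space M = ?T" by (auto simp: E 3)
        then show ?thesis by (simp add: E 3 k_def)
      next
        case 4
        have eq: "h -` E \<inter> space M = space M - ?T" by (auto simp: E 4)
        show ?thesis unfolding eq using compl[OF T] by eventually_elim (simp add: E 4 k_def)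
      qed
    next
      case Empty
      then show ?case using null[of "{}"] by auto
    next
      case (Compl E)
      have E: "h -` E \<inter> space M \<in> sets M"
        by (rule measurable_sets[OF h]) (use Compl.hyps in \<open>simp add: sets_PiM_single\<close>)
      have eq: "h -` ((\<Pi>\<^sub>E i\<in>UNIV. UNIV) - E) \<inter> space M = space M - (h -` E \<inter> space M)" by auto
      show ?case unfolding eq using Compl.IH compl[OF E] by eventually_elim simp
    next
      case (Union E)
      have E: "h -` E n \<inter> space M \<in> sets M" for n
        by (rule measurable_sets[OF h]) (use Union.hyps in \<open>simp add: sets_PiM_single\<close>)
      have eq: "h -` (\<Union>n. E n) \<inter> space M = (\<Union>n. h -` E n \<inter> space M)" by auto
      have "AE x in M. \<forall>n. k x \<in> E n \<longleftrightarrow> x \<in> \<theta> (h -` E n \<inter> space M)"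
        using Union.IH by (simp only: AE_all_countable) blast
      then show ?case using UN[of "\<lambda>n. h -` E n \<inter> space M", OF E] unfolding eq by eventually_elim auto
    qed
  qed
  show ?thesis
  proof (rule that[of "\<lambda>x. r (k x)"])
    show "(\<lambda>x. r (k x)) \<in> M \<rightarrow>\<^sub>M M" by (rule measurable_compose[OF k r])
    fix B assume B: "B \<in> sets M"
    have "r -` B \<in> sets (cantor TYPE(nat \<times> nat))" using measurable_sets[OF r B] by (simp add: sp)
    moreover have "h -` (r -` B) \<inter> space M = B" using rh sets.sets_into_space[OF B] by auto
    ultimately show "AE x in M. r (k x) \<in> B \<longleftrightarrow> x \<in> \<theta> B" using key[of "r -` B"] by simp
  qed
qed

text \<open>The lifts of \<open>\<theta>\<close> and of its inverse are mutually inverse up to null sets; the exceptional null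
  sets are enlarged by a null copy of the whole space and then matched by Schroeder--Bernstein.\<close>

lemma lift_borel_bij:
  assumes "standard_sigma_finite M"
  obtains S where "S \<in> borel_bij M" "\<And>B. B \<in> sets M \<Longrightarrow> AE x in M. S x \<in> B \<longleftrightarrow> x \<in> \<theta> B"
proof -
  have M: "standard_borel M" "space M \<noteq> {}"
    using assms by (auto simp: standard_sigma_finite_def)
  obtain \<eta> where \<eta>: "measure_algebra_iso M \<eta>" "\<And>B. B \<in> sets M \<Longrightarrow> AE x in M. x \<in> \<theta> (\<eta> B) \<longleftrightarrow> x \<in> B"
    by (rule inverse) blast
  interpret I: measure_algebra_iso M \<eta> by fact
  have \<eta>\<theta>: "AE x in M. x \<in> \<eta> (\<theta> B) \<longleftrightarrow> x \<in> B" if "B \<in> sets M" for B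
    using cong[of "\<eta> (\<theta> B)" B] \<eta>(2)[OF closed[OF that]] that by auto
  obtain f where f: "f \<in> M \<rightarrow>\<^sub>M M" "\<And>B. B \<in> sets M \<Longrightarrow> AE x in M. f x \<in> B \<longleftrightarrow> x \<in> \<theta> B"
    by (rule lift_map[OF M]) blast
  obtain g where g: "g \<in> M \<rightarrow>\<^sub>M M" "\<And>B. B \<in> sets M \<Longrightarrow> AE x in M. g x \<in> B \<longleftrightarrow> x \<in> \<eta> B"
    by (rule I.lift_map[OF M]) blast
  have ident: "(\<lambda>x. x) \<in> M \<rightarrow>\<^sub>M M" by simp
  have fg: "AE x in M. f (g x) = x"
  proof (rule AE_eq_if_AE_mem_iff[OF M(1) measurable_compose[OF g(1) f(1)] ident])
    fix B assume B: "B \<in> sets M"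
    have B': "f -` B \<inter> space M \<in> sets M" using measurable_sets[OF f(1) B] .
    have "AE x in M. x \<in> f -` B \<inter> space M \<longleftrightarrow> x \<in> \<theta> B" using f(2)[OF B] AE_space by eventually_elim auto
    then have "AE x in M. x \<in> \<eta> (f -` B \<inter> space M) \<longleftrightarrow> x \<in> \<eta> (\<theta> B)" using I.cong[OF B' closed[OF B]] by simp
    then show "AE x in M. f (g x) \<in> B \<longleftrightarrow> x \<in> B" using g(2)[OF B'] \<eta>\<theta>[OF B] AE_space
    proof eventually_elim
      case (elim x)
      then show ?case using measurable_space[OF g(1)] by auto
    qed
  qed
  have gf: "AE x in M. g (f x) = x"
  proof (rule AE_eq_if_AE_mem_iff[OF M(1) measurable_compose[OF f(1) g(1)] ident])
    fix B assume B: "B \<in> sets M"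
    have B': "g -` B \<inter> space M \<in> sets M" using measurable_sets[OF g(1) B] .
    have "AE x in M. x \<in> g -` B \<inter> space M \<longleftrightarrow> x \<in> \<eta> B" using g(2)[OF B] AE_space by eventually_elim auto
    then have "AE x in M. x \<in> \<theta> (g -` B \<inter> space M) \<longleftrightarrow> x \<in> \<theta> (\<eta> B)" using cong[OF B' I.closed[OF B]] by simp
    then show "AE x in M. g (f x) \<in> B \<longleftrightarrow> x \<in> B" using f(2)[OF B'] \<eta>(2)[OF B] AE_space
    proof eventually_elim
      case (elim x)
      then show ?case using measurable_space[OF f(1)] by auto
    qed
  qed
  obtain j k where jk: "j \<in> M \<rightarrow>\<^sub>M M" "k \<in> M \<rightarrow>\<^sub>M M" "\<And>x. x \<in> space M \<Longrightarrow> k (j x) = x"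
    "j ` space M \<in> null_sets M" by (rule null_self_embedding[OF assms]) blast
  define Z where "Z = j ` space M"
  have Z: "Z \<in> sets M" "AE x in M. x \<notin> Z" using jk(4) AE_not_in by (auto simp: Z_def)
  \<comment> \<open>Outside \<open>E1\<close> one has \<open>g (f x) = x\<close>, with both
    \<open>x\<close> and \<open>f x\<close> outside \<open>Z\<close>. The condition defining the
    complement of \<open>E2\<close> is the same with \<open>f\<close> and \<open>g\<close>
    exchanged, so \<open>f\<close> and \<open>g\<close> are mutually inverse between the two
    complements.\<close>
  define E1 where "E1 = (space M - {y \<in> space M. g (f y) = y}) \<union> Z \<union> ({y \<in> space M. g (f y) = y} \<inter> (f -` Z \<inter> space M))"
  define E2 where "E2 = (space M - {y \<in> space M. f (g y) = y}) \<union> Z \<union> ({y \<in> space M. f (g y) = y} \<inter> (g -` Z \<inter> space M))"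
  have E1: "E1 \<in> sets M"
    unfolding E1_def using standard_borel_eq_measurable[OF M(1) measurable_compose[OF f(1) g(1)] ident]
      measurable_sets[OF f(1) Z(1)] Z(1) by auto
  have E2: "E2 \<in> sets M"
    unfolding E2_def using standard_borel_eq_measurable[OF M(1) measurable_compose[OF g(1) f(1)] ident]
      measurable_sets[OF g(1) Z(1)] Z(1) by auto
  have E1n: "AE x in M. x \<notin> E1"
    using gf Z(2) null[OF Z] f(2)[OF Z(1)] AE_space by eventually_elim (auto simp: E1_def)
  obtain s r where sr: "s \<in> M \<rightarrow>\<^sub>M M" "r \<in> M \<rightarrow>\<^sub>M M"
    "\<And>x. x \<in> E1 \<Longrightarrow> s x \<in> E2 \<and> r (s x) = x" "\<And>y. y \<in> E2 \<Longrightarrow> r y \<in> E1 \<and> s (r y) = y"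
    by (rule borel_Schroeder_Bernstein[OF M(1) jk(1-3) E1 E2]) (auto simp: E1_def E2_def Z_def)
  have fE: "f x \<in> space M - E2 \<and> g (f x) = x" if "x \<in> space M - E1" for x
    using that measurable_space[OF f(1)] by (auto simp: E1_def E2_def)
  have gE: "g x \<in> space M - E1 \<and> f (g x) = x" if "x \<in> space M - E2" for x
    using that measurable_space[OF g(1)] by (auto simp: E1_def E2_def)
  define S where "S = (\<lambda>x\<in>space M. if x \<in> E1 then s x else f x)"
  define R where "R = (\<lambda>x\<in>space M. if x \<in> E2 then r x else g x)"
  have E12: "E1 \<subseteq> space M" "E2 \<subseteq> space M" using E1 E2 sets.sets_into_space by auto
  show ?thesis
  proof (rule that[of S])
    show "S \<in> borel_bij M"
    proof (rule borel_bijI)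
      show "S \<in> M \<rightarrow>\<^sub>M M" unfolding S_def
        by (rule measurable_cong[THEN iffD2, OF _ measurable_If_set[OF sr(1) f(1), of E1]]) (use E1 in auto)
      show "R \<in> M \<rightarrow>\<^sub>M M" unfolding R_def
        by (rule measurable_cong[THEN iffD2, OF _ measurable_If_set[OF sr(2) g(1), of E2]]) (use E2 in auto)
      show "S \<in> extensional (space M)" by (simp add: S_def)
      show "R (S x) = x" if "x \<in> space M" for x
        using that sr(3)[of x] fE[of x] E12 by (cases "x \<in> E1") (auto simp: S_def R_def)
      show "S (R x) = x" if "x \<in> space M" for x
        using that sr(4)[of x] gE[of x] E12 by (cases "x \<in> E2") (auto simp: S_def R_def)
    qed
    fix B assume B: "B \<in> sets M"
    show "AE x in M. S x \<in> B \<longleftrightarrow> x \<in> \<theta> B"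
      using f(2)[OF B] E1n AE_space by eventually_elim (simp add: S_def)
  qed
qed

end

section \<open>Involutions in ergodic full groups\<close>

lemma mp_bij_image:
  assumes T: "T \<in> mp_bij M" and A: "A \<in> sets M"
  shows "T ` A \<in> sets M" "emeasure M (T ` A) = emeasure M A" "T -` A \<inter> space M \<in> sets M"
    "emeasure M (T -` A \<inter> space M) = emeasure M A"
  using T A measurable_sets[OF mp_bijD(3)[OF T] A] by (auto simp: mp_bij_def borel_bij_def)

lemma mp_bij_image_null: "T \<in> mp_bij M \<Longrightarrow> A \<in> null_sets M \<Longrightarrow> T ` A \<in> null_sets M"
  using mp_bij_image[of T M A] by (auto simp: null_sets_def)

lemma mp_bij_inj: "T \<in> mp_bij M \<Longrightarrow> x \<in> space M \<Longrightarrow> y \<in> space M \<Longrightarrow> T x = T y \<longleftrightarrow> x = y"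
  using mp_bijD(2)[of T M] by (auto simp: bij_betw_def inj_on_def)

lemma mp_bij_ext: "T \<in> mp_bij M \<Longrightarrow> T \<in> extensional (space M)"
  using mp_bijD(1)[of T M] by (simp add: Bij_def)

lemma mp_bij_mult: "S \<in> mp_bij M \<Longrightarrow> T \<in> mp_bij M \<Longrightarrow> S \<otimes>\<^bsub>mp_group M\<^esub> T \<in> mp_bij M"
  using monoid.m_closed[OF group.is_monoid[OF group_mp_group[of M]], of S T] by simp

lemma mp_bij_inv: "T \<in> mp_bij M \<Longrightarrow> inv\<^bsub>mp_group M\<^esub> T \<in> mp_bij M"
  using group.inv_closed[OF group_mp_group[of M], of T] by simp

lemma mp_bij_one: "\<one>\<^bsub>mp_group M\<^esub> \<in> mp_bij M"
  using monoid.one_closed[OF group.is_monoid[OF group_mp_group[of M]]] by simp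

text \<open>The glued map is its own inverse, so images are preimages and bijectivity is free. The
  pieces may overlap; after disjointing them the measure of an image is summed piece by piece,
  injectivity keeping the images of the pieces disjoint.\<close>

lemma mp_bij_glueI:
  fixes D :: "nat \<Rightarrow> 'a set" and P :: "nat \<Rightarrow> 'a \<Rightarrow> 'a"
  assumes ext: "T \<in> extensional (space M)"
    and T: "\<And>x. x \<in> space M \<Longrightarrow> T x \<in> space M" "\<And>x. x \<in> space M \<Longrightarrow> T (T x) = x"
    and D: "\<And>n. D n \<in> sets M" "(\<Union>n. D n) = space M"
    and P: "\<And>n. P n \<in> mp_bij M" "\<And>n x. x \<in> D n \<Longrightarrow> T x = P n x"
  shows "T \<in> mp_bij M"
proof -
  have vim: "T -` A \<inter> space M \<in> sets M" if A: "A \<in> sets M" for A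
  proof -
    have "T -` A \<inter> space M = (\<Union>n. D n \<inter> (P n -` A \<inter> space M))"
      using P(2) unfolding D(2)[symmetric] by fastforce
    also have "\<dots> \<in> sets M" using D(1) mp_bij_image(3)[OF P(1) A] by auto
    finally show ?thesis .
  qed
  have Tm: "T \<in> M \<rightarrow>\<^sub>M M" using T(1) vim by (intro measurableI) auto
  have bb: "T \<in> borel_bij M" by (rule borel_bijI(1)[OF Tm Tm ext T(2) T(2)])
  have im: "T ` A = T -` A \<inter> space M" if "A \<in> sets M" for A
    by (rule borel_bijI(2)[OF Tm Tm ext T(2) T(2) that])
  have "emeasure M (T ` A) = emeasure M A" if A: "A \<in> sets M" for A
  proof -
    let ?D = "\<lambda>n. A \<inter> disjointed D n"
    have s: "?D n \<in> sets M" for n using A D(1) sets.range_disjointed_sets[of D M] by auto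
    have un: "(\<Union>n. ?D n) = A"
      using sets.sets_into_space[OF A] UN_disjointed_eq[of D] D(2) by auto
    have dis: "disjoint_family ?D"
      using disjoint_family_disjointed[of D] by (auto simp: disjoint_family_on_def)
    have TP: "T ` ?D n = P n ` ?D n" for n
      using P(2) disjointed_subset[of D n] by (intro image_cong) auto
    have inj: "inj_on T (space M)" by (rule inj_on_inverseI[of _ T]) (rule T(2))
    have "(\<Sum>n. emeasure M (T ` ?D n)) = emeasure M (\<Union>n. T ` ?D n)"
    proof (rule suminf_emeasure)
      show "range (\<lambda>n. T ` ?D n) \<subseteq> sets M" using TP mp_bij_image(1)[OF P(1) s] by auto
      show "disjoint_family (\<lambda>n. T ` ?D n)"
        unfolding disjoint_family_on_def
      proof (intro ballI impI)
        fix m n :: nat assume "m \<noteq> n"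
        then have "?D m \<inter> ?D n = {}" using dis by (auto simp: disjoint_family_on_def)
        moreover have "T ` ?D m \<inter> T ` ?D n = T ` (?D m \<inter> ?D n)"
          using inj_on_image_Int[OF inj, of "?D m" "?D n"] sets.sets_into_space[OF s] by simp
        ultimately show "T ` ?D m \<inter> T ` ?D n = {}" by simp
      qed
    qed
    moreover have "(\<Sum>n. emeasure M (?D n)) = emeasure M (\<Union>n. ?D n)"
      using s dis by (intro suminf_emeasure) auto
    moreover have "(\<Union>n. T ` ?D n) = T ` A" using un by (metis image_UN)
    ultimately show ?thesis by (simp only: TP mp_bij_image(2)[OF P(1) s] un)
  qed
  then show ?thesis using bb im by (auto simp: mp_bij_def)
qed

lemma UN_case_nat: "(\<Union>n. case_nat A e n) = A \<union> (\<Union>n. e n)"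
proof (intro equalityI subsetI)
  fix x assume "x \<in> (\<Union>n. case_nat A e n)"
  then obtain n where "x \<in> case_nat A e n" by blast
  then show "x \<in> A \<union> (\<Union>n. e n)" by (cases n) auto
next
  fix x assume "x \<in> A \<union> (\<Union>n. e n)"
  then consider "x \<in> case_nat A e 0" | n where "x \<in> case_nat A e (Suc n)" by auto
  then show "x \<in> (\<Union>n. case_nat A e n)" by cases blast+
qed

text \<open>Where the maps differ, some digit of the codes of their values differs. There are
  countably many choices of a digit position and its value, so one choice works on a non-null
  set.\<close>

lemma separate_maps:
  assumes M: "standard_borel M" and f: "f \<in> M \<rightarrow>\<^sub>M M" and g: "g \<in> M \<rightarrow>\<^sub>M M"
    and D: "D \<in> sets M" "D \<notin> null_sets M" and ne: "\<And>x. x \<in> D \<Longrightarrow> f x \<noteq> g x"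
  obtains E C where "E \<in> sets M" "C \<in> sets M" "E \<subseteq> D" "E \<notin> null_sets M" "\<And>x. x \<in> E \<Longrightarrow> f x \<in> C \<and> g x \<notin> C"
proof -
  have "space M \<noteq> {}" using D sets.sets_into_space by fastforce
  then obtain h :: "'a \<Rightarrow> nat \<times> nat \<Rightarrow> bool" and r where
    h[measurable]: "h \<in> M \<rightarrow>\<^sub>M cantor TYPE(nat \<times> nat)" and
    rh: "\<And>x. x \<in> space M \<Longrightarrow> r (h x) = x" by (rule standard_borel_retract[OF M]) blast
  note f[measurable] g[measurable] D(1)[measurable]
  define C where "C = (\<lambda>(i, b). {y \<in> space M. h y i = b})"
  define E where "E = (\<lambda>p. D \<inter> ((f -` C p \<inter> space M) - (g -` C p \<inter> space M)))"
  have Cs: "C p \<in> sets M" for p unfolding C_def case_prod_beta by measurable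
  have Es: "E p \<in> sets M" for p
    unfolding E_def by (rule sets.Int[OF D(1) sets.Diff[OF measurable_sets[OF f Cs] measurable_sets[OF g Cs]]])
  have "D \<subseteq> (\<Union>p. E p)"
  proof
    fix x assume x: "x \<in> D"
    then have sp: "x \<in> space M" "f x \<in> space M" "g x \<in> space M"
      using sets.sets_into_space[OF D(1)] measurable_space[OF f] measurable_space[OF g] by auto
    have "h (f x) \<noteq> h (g x)"
    proof
      assume "h (f x) = h (g x)"
      then have "r (h (f x)) = r (h (g x))" by simp
      then show False using ne[OF x] rh[OF sp(2)] rh[OF sp(3)] by simp
    qed
    then obtain i where "h (f x) i \<noteq> h (g x) i" by blast
    then have "x \<in> E (i, h (f x) i)" using x sp by (auto simp: E_def C_def)
    then show "x \<in> (\<Union>p. E p)" by blast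
  qed
  moreover have "(\<Union>p. E p) \<in> null_sets M" if "\<forall>p. E p \<in> null_sets M" using that by (intro null_sets_UN) blast
  ultimately obtain p where "E p \<notin> null_sets M" using D null_sets_subset by blast
  then show ?thesis using that[of "E p" "C p"] Es Cs by (auto simp: E_def)
qed

section \<open>The full group of an ergodic relation, at the level of bijections\<close>

text \<open>This abstracts an orbit relation. Ergodicity is asked only of the full group, which
  contains the bijections of the acting group and thus has fewer invariant sets.\<close>

locale ergodic_relation =
  fixes M :: "'a measure" and R :: "'a \<Rightarrow> 'a \<Rightarrow> bool"
  assumes ssf: "standard_sigma_finite M"
    and R_refl: "\<And>x. x \<in> space M \<Longrightarrow> R x x"
    and R_sym: "\<And>x y. x \<in> space M \<Longrightarrow> y \<in> space M \<Longrightarrow> R x y \<Longrightarrow> R y x"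
    and R_trans: "\<And>x y z. x \<in> space M \<Longrightarrow> y \<in> space M \<Longrightarrow> z \<in> space M \<Longrightarrow> R x y \<Longrightarrow> R y z \<Longrightarrow> R x z"
    and R_ergodic: "\<And>A. A \<in> sets M \<Longrightarrow>
      (\<And>T. T \<in> mp_bij M \<Longrightarrow> (AE x in M. R x (T x)) \<Longrightarrow> sym_diff (T ` A) A \<in> null_sets M) \<Longrightarrow>
      A \<in> null_sets M \<or> space M - A \<in> null_sets M"
begin

sublocale sigma_finite_measure M using ssf unfolding standard_sigma_finite_def by blast

lemma M_standard: "standard_borel M" and M_atomless: "atomless M"
  using ssf unfolding standard_sigma_finite_def by blast+

definition F :: "('a \<Rightarrow> 'a) set" where
  "F = {T \<in> mp_bij M. AE x in M. R x (T x)}"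

lemma F_mp: "T \<in> F \<Longrightarrow> T \<in> mp_bij M" by (simp add: F_def)

lemma F_meas: "T \<in> F \<Longrightarrow> T \<in> M \<rightarrow>\<^sub>M M" by (rule mp_bijD(3)[OF F_mp])

lemma F_sp: "T \<in> F \<Longrightarrow> x \<in> space M \<Longrightarrow> T x \<in> space M" by (rule mp_bijD(4)[OF F_mp])

lemma F_inj: "T \<in> F \<Longrightarrow> x \<in> space M \<Longrightarrow> y \<in> space M \<Longrightarrow> T x = T y \<longleftrightarrow> x = y"
  by (rule mp_bij_inj[OF F_mp])

lemma F_AE: "T \<in> F \<Longrightarrow> AE x in M. Q x \<Longrightarrow> AE x in M. Q (T x)"
  by (rule mp_bij_AE[OF F_mp])

abbreviation mul (infixl "\<odot>" 70) where "S \<odot> T \<equiv> S \<otimes>\<^bsub>mp_group M\<^esub> T"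
abbreviation inve where "inve T \<equiv> inv\<^bsub>mp_group M\<^esub> T"
abbreviation ident where "ident \<equiv> \<one>\<^bsub>mp_group M\<^esub>"

lemma F_mul: assumes "S \<in> F" "T \<in> F" shows "S \<odot> T \<in> F"
proof -
  have "AE x in M. R (T x) (S (T x))" using assms F_AE[of T "\<lambda>x. R x (S x)"] by (auto simp: F_def)
  moreover have "AE x in M. R x (T x)" using assms by (auto simp: F_def)
  ultimately have "AE x in M. R x ((S \<odot> T) x)" using AE_space
  proof eventually_elim
    case (elim x)
    then show ?case using R_trans[of x "T x" "S (T x)"] F_sp assms
      by (simp add: mult_mp_group[OF F_mp F_mp])
  qed
  then show ?thesis using mp_bij_mult[OF F_mp F_mp, OF assms] by (simp add: F_def)
qed

lemma mul_app: "S \<in> F \<Longrightarrow> T \<in> F \<Longrightarrow> x \<in> space M \<Longrightarrow> (S \<odot> T) x = S (T x)"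
  by (simp add: mult_mp_group F_mp)

lemma inve_app: "T \<in> F \<Longrightarrow> x \<in> space M \<Longrightarrow> T (inve T x) = x" "T \<in> F \<Longrightarrow> x \<in> space M \<Longrightarrow> inve T (T x) = x"
  by (simp_all add: inv_mp_group F_mp)

lemma F_inve: assumes "T \<in> F" shows "inve T \<in> F"
proof -
  have i: "inve T \<in> mp_bij M" using mp_bij_inv F_mp assms by blast
  have "AE x in M. R (inve T x) (T (inve T x))" using assms mp_bij_AE[OF i, of "\<lambda>x. R x (T x)"] by (auto simp: F_def)
  then have "AE x in M. R x (inve T x)" using AE_space
  proof eventually_elim
    case (elim x)
    then show ?case using R_sym[of "inve T x" x] inve_app(1)[OF assms] mp_bijD(4)[OF i] by simp
  qed
  then show ?thesis using i by (simp add: F_def)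
qed

lemma ident_app: "x \<in> space M \<Longrightarrow> ident x = x" by (rule one_mp_group)

lemma F_ident: "ident \<in> F"
proof -
  have "AE x in M. R x (ident x)" using AE_space by eventually_elim (simp add: ident_app R_refl)
  then show ?thesis using mp_bij_one by (simp add: F_def)
qed

lemma F_glueI:
  fixes D :: "nat \<Rightarrow> 'a set" and P :: "nat \<Rightarrow> 'a \<Rightarrow> 'a"
  assumes ext: "T \<in> extensional (space M)"
    and T: "\<And>x. x \<in> space M \<Longrightarrow> T x \<in> space M" "\<And>x. x \<in> space M \<Longrightarrow> T (T x) = x"
    and D: "\<And>n. D n \<in> sets M" "(\<Union>n. D n) = space M"
    and P: "\<And>n. P n \<in> F" "\<And>n x. x \<in> D n \<Longrightarrow> T x = P n x"
  shows "T \<in> F"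
proof -
  have "T \<in> mp_bij M" by (rule mp_bij_glueI[OF ext T D F_mp[OF P(1)] P(2)])
  moreover have "AE x in M. R x (P n x)" for n using P(1) by (auto simp: F_def)
  then have "AE x in M. \<forall>n. R x (P n x)" by (rule AE_all_countable[THEN iffD2, OF allI])
  then have "AE x in M. R x (T x)" using AE_space
  proof eventually_elim
    case (elim x)
    then obtain n where "x \<in> D n" using D(2) by blast
    then show ?case using elim P(2) by simp
  qed
  ultimately show ?thesis by (simp add: F_def)
qed

section \<open>Restrictions of involutions and exchanges of disjoint sets\<close>

text \<open>The part of \<open>D\<close> on which \<open>P\<close> is an honest involution into
  \<open>D\<close>. Algebraic involutions are involutions only almost everywhere, while
  \<open>F_glueI\<close> needs the cut map to be one at every point.\<close>

definition dom_cut :: "('a \<Rightarrow> 'a) \<Rightarrow> 'a set \<Rightarrow> 'a set" where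
  "dom_cut P D = {x \<in> D. P (P x) = x \<and> P x \<in> D}"

definition cut :: "('a \<Rightarrow> 'a) \<Rightarrow> 'a set \<Rightarrow> 'a \<Rightarrow> 'a" where
  "cut P D = (\<lambda>x\<in>space M. if x \<in> dom_cut P D then P x else x)"

lemma dom_cut_iff: "P (P x) = x \<Longrightarrow> P x \<in> dom_cut P D \<longleftrightarrow> x \<in> dom_cut P D"
  by (auto simp: dom_cut_def)

lemma dom_cut_sets:
  assumes P: "P \<in> F" and D: "D \<in> sets M"
  shows "dom_cut P D \<in> sets M"
proof -
  have "dom_cut P D = D \<inter> {x \<in> space M. P (P x) = x} \<inter> (P -` D \<inter> space M)"
    using sets.sets_into_space[OF D] by (auto simp: dom_cut_def)
  moreover have "{x \<in> space M. P (P x) = x} \<in> sets M"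
    by (rule standard_borel_eq_measurable[OF M_standard measurable_compose[OF F_meas F_meas, OF P P]
          measurable_ident_sets[OF refl]])
  ultimately show ?thesis using D measurable_sets[OF F_meas[OF P] D] by auto
qed

lemma cut_app: "x \<in> space M \<Longrightarrow> cut P D x = (if x \<in> dom_cut P D then P x else x)"
  by (simp add: cut_def)

lemma cut_cut:
  assumes P: "P \<in> F" and x: "x \<in> space M"
  shows "cut P D (cut P D x) = x"
  using F_sp[OF P x] x dom_cut_iff[of P x D] by (auto simp: cut_app) (auto simp: dom_cut_def)

lemma cut_F:
  assumes P: "P \<in> F" and D: "D \<in> sets M"
  shows "cut P D \<in> F"
proof (rule F_glueI[where D = "\<lambda>n. if n = 0 then dom_cut P D else space M - dom_cut P D"
      and P = "\<lambda>n. if n = 0 then P else ident"])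
  note s = dom_cut_sets[OF P D]
  show "cut P D \<in> extensional (space M)" by (simp add: cut_def)
  show "cut P D x \<in> space M" if "x \<in> space M" for x using that F_sp[OF P that] by (simp add: cut_app)
  show "cut P D (cut P D x) = x" if "x \<in> space M" for x by (rule cut_cut[OF P that])
  show "(if n = 0 then dom_cut P D else space M - dom_cut P D) \<in> sets M" for n :: nat using s by auto
  show "(\<Union>n::nat. if n = 0 then dom_cut P D else space M - dom_cut P D) = space M"
    using sets.sets_into_space[OF s] by (auto split: if_splits)
  show "(if n = 0 then P else ident) \<in> F" for n :: nat using P F_ident by simp
  show "cut P D x = (if n = 0 then P else ident) x" if "x \<in> (if n = 0 then dom_cut P D else space M - dom_cut P D)"
    for n :: nat and x
    using that sets.sets_into_space[OF s] by (auto simp: cut_app ident_app split: if_splits)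
qed

definition swap :: "('a \<Rightarrow> 'a) \<Rightarrow> 'a set \<Rightarrow> 'a \<Rightarrow> 'a" where
  "swap g B = (\<lambda>x\<in>space M. if x \<in> B then g x else if x \<in> g ` B then inve g x else x)"

lemma swap_F:
  assumes g: "g \<in> F" and B: "B \<in> sets M" and disj: "g ` B \<inter> B = {}"
  shows "swap g B \<in> F" "\<And>x. x \<in> space M \<Longrightarrow> swap g B (swap g B x) = x"
proof -
  have Bs: "B \<subseteq> space M" using sets.sets_into_space[OF B] .
  have gB: "g ` B \<in> sets M" using mp_bij_image(1)[OF F_mp[OF g] B] .
  have gBs: "g ` B \<subseteq> space M" using sets.sets_into_space[OF gB] .
  have ig: "inve g x \<in> B" if "x \<in> g ` B" for x using that Bs inve_app(2)[OF g] by auto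
  show inv: "swap g B (swap g B x) = x" if "x \<in> space M" for x
    using that Bs gBs ig disj inve_app[OF g] F_sp[OF g] by (auto simp: swap_def)
  show "swap g B \<in> F"
  proof (rule F_glueI[where D = "\<lambda>n. if n = 0 then B else if n = 1 then g ` B else space M - B - g ` B"
        and P = "\<lambda>n. if n = 0 then g else if n = 1 then inve g else ident"])
    show "swap g B \<in> extensional (space M)" by (simp add: swap_def)
    show "swap g B x \<in> space M" if "x \<in> space M" for x
      using that F_sp[OF g that] F_sp[OF F_inve[OF g] that] by (simp add: swap_def)
    show "swap g B (swap g B x) = x" if "x \<in> space M" for x by (rule inv[OF that])
    show "(if n = 0 then B else if n = 1 then g ` B else space M - B - g ` B) \<in> sets M" for n :: nat
      using B gB by auto
    have "(\<Union>n::nat. if n = 0 then B else if n = 1 then g ` B else space M - B - g ` B) \<subseteq> space M"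
      using Bs gBs by (auto split: if_splits)
    moreover have "x \<in> (\<Union>n::nat. if n = 0 then B else if n = 1 then g ` B else space M - B - g ` B)"
      if "x \<in> space M" for x
      using that by (cases "x \<in> B"; cases "x \<in> g ` B")
        (auto intro: UN_I[of 0] UN_I[of 1] UN_I[of 2])
    ultimately show "(\<Union>n::nat. if n = 0 then B else if n = 1 then g ` B else space M - B - g ` B) = space M" by blast
    show "(if n = 0 then g else if n = 1 then inve g else ident) \<in> F" for n :: nat
      using g F_ident F_inve by simp
    show "swap g B x = (if n = 0 then g else if n = 1 then inve g else ident) x"
      if "x \<in> (if n = 0 then B else if n = 1 then g ` B else space M - B - g ` B)" for n :: nat and x
      using that Bs gBs disj by (auto simp: swap_def ident_app split: if_splits)
  qed
qed

text \<open>Otherwise the essential union of all translates \<open>g ` A1\<close>, \<open>g \<in> F\<close>, would be an invariant set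
  that is neither null nor conull.\<close>

lemma transfer_nonnull:
  assumes A1: "A1 \<in> sets M" "A1 \<notin> null_sets M" and A2: "A2 \<in> sets M" "A2 \<notin> null_sets M"
  obtains g where "g \<in> F" "A1 \<inter> (g -` A2 \<inter> space M) \<notin> null_sets M"
proof (rule ccontr)
  assume neg: "\<not> thesis"
  have "\<forall>g\<in>F. A1 \<inter> (g -` A2 \<inter> space M) \<in> null_sets M" using neg that by blast
  then have contra: "A1 \<inter> (g -` A2 \<inter> space M) \<in> null_sets M" if "g \<in> F" for g using that by blast
  obtain \<D> where D: "countable \<D>" "disjoint \<D>" "\<D> \<subseteq> sets M" "\<And>E. E \<in> \<D> \<Longrightarrow> \<exists>g\<in>F. E \<subseteq> g ` A1"
    "\<And>E. E \<in> sets M \<Longrightarrow> \<exists>g\<in>F. E \<subseteq> g ` A1 \<Longrightarrow> E \<inter> \<Union>\<D> = {} \<Longrightarrow> E \<in> null_sets M"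
    by (rule exhaustion[of "\<lambda>E. \<exists>g\<in>F. E \<subseteq> g ` A1"]) blast
  define U where "U = \<Union>\<D>"
  have A1s: "A1 \<subseteq> space M" using sets.sets_into_space[OF A1(1)] .
  have U: "U \<in> sets M" using D(1,3) unfolding U_def by (intro sets.countable_Union)
  have "(\<Union>E\<in>\<D>. E \<inter> A2) \<in> null_sets M"
  proof (rule null_sets_UN'[OF D(1)])
    fix E assume E: "E \<in> \<D>"
    then obtain g where g: "g \<in> F" "E \<subseteq> g ` A1" using D(4) by blast
    have "E \<inter> A2 \<subseteq> g ` (A1 \<inter> (g -` A2 \<inter> space M))"
    proof
      fix y assume y: "y \<in> E \<inter> A2"
      then obtain a where "a \<in> A1" "y = g a" using g(2) by blast
      then show "y \<in> g ` (A1 \<inter> (g -` A2 \<inter> space M))" using y A1s by blast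
    qed
    moreover have "g ` (A1 \<inter> (g -` A2 \<inter> space M)) \<in> null_sets M"
      using mp_bij_image_null[OF F_mp[OF g(1)] contra[OF g(1)]] .
    moreover have "E \<inter> A2 \<in> sets M" using E D(3) A2(1) by (intro sets.Int) auto
    ultimately show "E \<inter> A2 \<in> null_sets M" using null_sets_subset by blast
  qed
  moreover have "(\<Union>E\<in>\<D>. E \<inter> A2) = U \<inter> A2" by (auto simp: U_def)
  ultimately have UA2: "U \<inter> A2 \<in> null_sets M" by simp
  have le: "h ` U - U \<in> null_sets M" if h: "h \<in> F" for h
  proof -
    have "(\<Union>E\<in>\<D>. h ` E - U) \<in> null_sets M"
    proof (rule null_sets_UN'[OF D(1)])
      fix E assume E: "E \<in> \<D>"
      then obtain g where g: "g \<in> F" "E \<subseteq> g ` A1" using D(4) by blast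
      have "h ` E - U \<subseteq> (h \<odot> g) ` A1"
      proof
        fix y assume "y \<in> h ` E - U"
        then obtain a where a: "a \<in> A1" "y = h (g a)" using g(2) by blast
        then have "y = (h \<odot> g) a" using A1s mul_app[OF h g(1)] by (simp add: subset_iff)
        then show "y \<in> (h \<odot> g) ` A1" using a(1) by (rule image_eqI)
      qed
      then have 1: "\<exists>g\<in>F. h ` E - U \<subseteq> g ` A1" using F_mul[OF h g(1)] by blast
      have "E \<in> sets M" using E D(3) by blast
      then have 2: "h ` E - U \<in> sets M" by (rule sets.Diff[OF mp_bij_image(1)[OF F_mp[OF h]] U])
      have 3: "(h ` E - U) \<inter> \<Union>\<D> = {}" unfolding U_def by blast
      show "h ` E - U \<in> null_sets M" by (rule D(5)[OF 2 1 3])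
    qed
    moreover have "(\<Union>E\<in>\<D>. h ` E - U) = h ` U - U" by (auto simp: U_def)
    ultimately show ?thesis by simp
  qed
  have Us: "U \<subseteq> space M" using sets.sets_into_space[OF U] .
  have "sym_diff (h ` U) U \<in> null_sets M" if "h \<in> mp_bij M" "AE x in M. R x (h x)" for h
  proof -
    have h: "h \<in> F" using that by (simp add: F_def)
    \<comment> \<open>The other half of the symmetric difference is the \<open>h\<close>-image of
      the first half taken for the inverse of \<open>h\<close>.\<close>
    have "U - h ` U \<subseteq> h ` (inve h ` U - U)"
    proof
      fix x assume x: "x \<in> U - h ` U"
      then have xs: "x \<in> space M" using Us by auto
      have "x = h (inve h x)" using inve_app(1)[OF h xs] by simp
      moreover have "inve h x \<notin> U" using x inve_app(1)[OF h xs] by (metis DiffD2 imageI)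
      ultimately show "x \<in> h ` (inve h ` U - U)" using x by blast
    qed
    moreover have "h ` (inve h ` U - U) \<in> null_sets M"
      using mp_bij_image_null[OF F_mp[OF h] le[OF F_inve[OF h]]] .
    moreover have "U - h ` U \<in> sets M" by (rule sets.Diff[OF U mp_bij_image(1)[OF F_mp[OF h] U]])
    ultimately have "U - h ` U \<in> null_sets M" using null_sets_subset by blast
    then show ?thesis using le[OF h] by auto
  qed
  then have "U \<in> null_sets M \<or> space M - U \<in> null_sets M" using R_ergodic[OF U] by blast
  then show False
  proof
    assume n: "U \<in> null_sets M"
    have A1U: "A1 - U \<in> null_sets M"
    proof (rule D(5)[OF sets.Diff[OF A1(1) U]])
      have "ident ` A1 = A1" using A1s by (force simp: ident_app image_iff)
      then show "\<exists>g\<in>F. A1 - U \<subseteq> g ` A1" using F_ident by blast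
      show "(A1 - U) \<inter> \<Union>\<D> = {}" unfolding U_def by blast
    qed
    have "A1 \<in> null_sets M"
      by (rule null_sets_subset[OF null_sets.Un[OF n A1U] A1(1)]) blast
    then show False using A1 by simp
  next
    assume n: "space M - U \<in> null_sets M"
    have "A2 \<in> null_sets M"
      by (rule null_sets_subset[OF null_sets.Un[OF n UA2] A2(1)]) (use sets.sets_into_space[OF A2(1)] in blast)
    then show False using A2 by simp
  qed
qed

section \<open>Involutions with prescribed support\<close>

text \<open>Atomlessness splits \<open>E\<close> into two non-null parts,
  \<open>transfer_nonnull\<close> moves a non-null piece \<open>B\<close> of the first into the
  second, and swapping \<open>B\<close> with its image gives the involution.\<close>

lemma nontrivial_involution:
  assumes E: "E \<in> sets M" "E \<notin> null_sets M"
  obtains \<rho> B where "\<rho> \<in> F" "\<And>x. x \<in> space M \<Longrightarrow> \<rho> (\<rho> x) = x" "\<And>x. x \<in> space M - E \<Longrightarrow> \<rho> x = x"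
    "B \<in> sets M" "B \<subseteq> E" "B \<notin> null_sets M" "\<And>x. x \<in> B \<Longrightarrow> \<rho> x \<in> E - B"
proof -
  obtain A1 where A1: "A1 \<in> sets M" "A1 \<subseteq> E" "A1 \<notin> null_sets M" "E - A1 \<notin> null_sets M"
    using M_atomless E unfolding atomless_def by blast
  have A2: "E - A1 \<in> sets M" using E A1 by auto
  obtain g where g: "g \<in> F" "A1 \<inter> (g -` (E - A1) \<inter> space M) \<notin> null_sets M"
    by (rule transfer_nonnull[OF A1(1,3) A2 A1(4)])
  define B where "B = A1 \<inter> (g -` (E - A1) \<inter> space M)"
  have B: "B \<in> sets M" unfolding B_def using A1(1) measurable_sets[OF F_meas[OF g(1)] A2] by auto
  have Bs: "B \<subseteq> space M" by (auto simp: B_def)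
  have gB: "g ` B \<subseteq> E - A1" by (auto simp: B_def)
  have disj: "g ` B \<inter> B = {}" using gB by (auto simp: B_def)
  show ?thesis
  proof (rule that[of "swap g B" B])
    show "swap g B \<in> F" "\<And>x. x \<in> space M \<Longrightarrow> swap g B (swap g B x) = x"
      using swap_F[OF g(1) B disj] by auto
    show "swap g B x = x" if "x \<in> space M - E" for x
      using that gB A1(2) by (auto simp: swap_def B_def)
    show "B \<in> sets M" by fact
    show "B \<subseteq> E" using A1(2) by (auto simp: B_def)
    show "B \<notin> null_sets M" using g(2) by (simp add: B_def)
    show "swap g B x \<in> E - B" if "x \<in> B" for x
      using that Bs gB by (auto simp: swap_def B_def)
  qed
qed

text \<open>This supplies elements inside \<open>E\<close> that squares can detect. Take an
  involution \<rho> that sends \<open>B\<close> off itself and an involution \<sigma> living on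
  \<open>B\<close>. On \<open>B'\<close> the square of their product returns \<sigma> x: \<sigma>
  keeps the point in \<open>B\<close>, \<rho> takes it out of \<open>B\<close>, where \<sigma> does
  nothing, and \<rho> brings it back. The inverse is supplied as a second element of
  \<open>F\<close>.\<close>

lemma order_four:
  assumes E: "E \<in> sets M" "E \<notin> null_sets M"
  obtains \<psi> \<psi>' where "\<psi> \<in> F" "\<psi>' \<in> F" "\<And>x. x \<in> space M \<Longrightarrow> \<psi> (\<psi>' x) = x" "\<And>x. x \<in> space M \<Longrightarrow> \<psi>' (\<psi> x) = x"
    "\<And>x. x \<in> space M - E \<Longrightarrow> \<psi> x = x" "\<not> (AE x in M. \<psi> (\<psi> x) = x)"
proof -
  obtain \<rho> B where r: "\<rho> \<in> F" "\<And>x. x \<in> space M \<Longrightarrow> \<rho> (\<rho> x) = x" "\<And>x. x \<in> space M - E \<Longrightarrow> \<rho> x = x"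
    "B \<in> sets M" "B \<subseteq> E" "B \<notin> null_sets M" "\<And>x. x \<in> B \<Longrightarrow> \<rho> x \<in> E - B"
    by (rule nontrivial_involution[OF E]) blast
  obtain \<sigma> B' where s: "\<sigma> \<in> F" "\<And>x. x \<in> space M \<Longrightarrow> \<sigma> (\<sigma> x) = x" "\<And>x. x \<in> space M - B \<Longrightarrow> \<sigma> x = x"
    "B' \<in> sets M" "B' \<subseteq> B" "B' \<notin> null_sets M" "\<And>x. x \<in> B' \<Longrightarrow> \<sigma> x \<in> B - B'"
    by (rule nontrivial_involution[OF r(4,6)]) blast
  have B's: "B' \<subseteq> space M" "B \<subseteq> space M" using s(4) r(4) sets.sets_into_space by blast+
  show ?thesis
  proof (rule that[of "\<rho> \<odot> \<sigma>" "\<sigma> \<odot> \<rho>"])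
    show "\<rho> \<odot> \<sigma> \<in> F" "\<sigma> \<odot> \<rho> \<in> F" using F_mul r(1) s(1) by auto
    show "(\<rho> \<odot> \<sigma>) ((\<sigma> \<odot> \<rho>) x) = x" "(\<sigma> \<odot> \<rho>) ((\<rho> \<odot> \<sigma>) x) = x" if "x \<in> space M" for x
      using that r(1,2) s(1,2) by (simp_all add: mul_app F_sp)
    show "(\<rho> \<odot> \<sigma>) x = x" if "x \<in> space M - E" for x
    proof -
      have "\<sigma> x = x" using that s(3) r(5) by auto
      then show ?thesis using that r(1,3) s(1) by (simp add: mul_app)
    qed
    show "\<not> (AE x in M. (\<rho> \<odot> \<sigma>) ((\<rho> \<odot> \<sigma>) x) = x)"
    proof
      assume "AE x in M. (\<rho> \<odot> \<sigma>) ((\<rho> \<odot> \<sigma>) x) = x"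
      then have "AE x in M. x \<notin> B'" using AE_space
      proof eventually_elim
        case (elim x)
        show ?case
        proof
          assume x: "x \<in> B'"
          have \<sigma>x: "\<sigma> x \<in> B" "\<sigma> x \<noteq> x" using s(7)[OF x] x by auto
          then have "\<rho> (\<sigma> x) \<in> E - B" "\<rho> (\<sigma> x) \<in> space M" using r(7) F_sp[OF r(1)] B's by auto
          then have "\<sigma> (\<rho> (\<sigma> x)) = \<rho> (\<sigma> x)" using s(3) by auto
          then have "(\<rho> \<odot> \<sigma>) ((\<rho> \<odot> \<sigma>) x) = \<sigma> x"
            using elim(2) r(1,2) s(1) by (simp add: mul_app F_sp)
          then show False using elim \<sigma>x by simp
        qed
      qed
      then show False using s(4,6) AE_iff_null_sets by blast
    qed
  qed
qed

definition supp :: "('a \<Rightarrow> 'a) \<Rightarrow> 'a set" where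
  "supp T = {x \<in> space M. T x \<noteq> x}"

lemma supp_sets: assumes "T \<in> F" shows "supp T \<in> sets M"
proof -
  have "supp T = space M - {x \<in> space M. T x = x}" by (auto simp: supp_def)
  then show ?thesis
    using standard_borel_eq_measurable[OF M_standard F_meas[OF assms] measurable_ident_sets[OF refl]] by auto
qed

text \<open>Exhaust \<open>A\<close> by supports of involutions and glue these over the countable
  disjoint family. A non-null remainder would contain the support of a further non-trivial
  involution.\<close>

lemma involution_with_support:
  assumes A: "A \<in> sets M"
  obtains \<pi> where "\<pi> \<in> F" "\<And>x. x \<in> space M \<Longrightarrow> \<pi> (\<pi> x) = x" "AE x in M. \<pi> x \<noteq> x \<longleftrightarrow> x \<in> A"
proof -
  \<comment> \<open>The support is required to be exactly \<open>E\<close>: an involution preserves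
    its support, so the pieces do not interfere when glued.\<close>
  define good where "good = (\<lambda>E. E \<subseteq> A \<and> (\<exists>\<rho>\<in>F. (\<forall>x\<in>space M. \<rho> (\<rho> x) = x) \<and> supp \<rho> = E))"
  obtain \<D> where D: "countable \<D>" "disjoint \<D>" "\<D> \<subseteq> sets M" "\<And>E. E \<in> \<D> \<Longrightarrow> good E"
    "\<And>E. E \<in> sets M \<Longrightarrow> good E \<Longrightarrow> E \<inter> \<Union>\<D> = {} \<Longrightarrow> E \<in> null_sets M"
    by (rule exhaustion[of good]) blast
  obtain \<rho> where \<rho>: "\<And>E. E \<in> \<D> \<Longrightarrow> \<rho> E \<in> F" "\<And>E x. E \<in> \<D> \<Longrightarrow> x \<in> space M \<Longrightarrow> \<rho> E (\<rho> E x) = x"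
    "\<And>E. E \<in> \<D> \<Longrightarrow> supp (\<rho> E) = E" using D(4) unfolding good_def by metis
  define U where "U = \<Union>\<D>"
  have U: "U \<in> sets M" using D(1,3) unfolding U_def by (intro sets.countable_Union)
  have UA: "U \<subseteq> A" using D(4) by (auto simp: U_def good_def)
  define \<pi> where "\<pi> = (\<lambda>x\<in>space M. if x \<in> U then \<rho> (THE E. E \<in> \<D> \<and> x \<in> E) x else x)"
  have the: "(THE E. E \<in> \<D> \<and> x \<in> E) = E" if "E \<in> \<D>" "x \<in> E" for x E
    using that D(2) unfolding disjoint_def by (intro the_equality) blast+
  have \<pi>1: "\<pi> x = \<rho> E x" if "E \<in> \<D>" "x \<in> E" for x E
  proof -
    have "x \<in> space M" using that D(3) sets.sets_into_space by blast
    then show ?thesis using that the[OF that] by (auto simp: \<pi>_def U_def)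
  qed
  have \<pi>2: "\<pi> x = x" if "x \<in> space M - U" for x using that by (auto simp: \<pi>_def)
  have \<rho>E: "\<rho> E x \<in> E" if "E \<in> \<D>" "x \<in> E" for x E
  proof -
    have "x \<in> supp (\<rho> E)" using \<rho>(3) that by simp
    then have "x \<in> space M" "\<rho> E x \<noteq> x" by (auto simp: supp_def)
    then have "\<rho> E x \<in> supp (\<rho> E)" using \<rho>(2)[OF that(1)] F_sp[OF \<rho>(1)[OF that(1)]] by (auto simp: supp_def)
    then show ?thesis using \<rho>(3) that by simp
  qed
  have \<pi>\<pi>: "\<pi> x \<in> space M \<and> \<pi> (\<pi> x) = x" if x: "x \<in> space M" for x
  proof (cases "x \<in> U")
    case True
    then obtain E where E: "E \<in> \<D>" "x \<in> E" by (auto simp: U_def)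
    then show ?thesis using \<pi>1[OF E] \<pi>1[OF E(1) \<rho>E[OF E]] \<rho>(2)[OF E(1) x] F_sp[OF \<rho>(1)[OF E(1)] x] by simp
  next
    case False
    then show ?thesis using \<pi>2 x by simp
  qed
  have "\<pi> \<in> F"
  proof (cases "\<D> = {}")
    case True
    then have "U = {}" by (simp add: U_def)
    have "\<pi> = ident"
    proof (rule extensionalityI)
      show "\<pi> \<in> extensional (space M)" by (simp add: \<pi>_def)
      show "ident \<in> extensional (space M)" by (rule mp_bij_ext[OF mp_bij_one])
      show "\<pi> x = ident x" if "x \<in> space M" for x using that \<pi>2 \<open>U = {}\<close> by (simp add: ident_app)
    qed
    then show ?thesis using F_ident by simp
  next
    case False
    let ?e = "from_nat_into \<D>"
    have e: "?e n \<in> \<D>" for n using from_nat_into[OF False] .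
    have re: "range ?e = \<D>" using range_from_nat_into[OF False D(1)] .
    show ?thesis
    proof (rule F_glueI[where D = "case_nat (space M - U) ?e" and P = "case_nat ident (\<lambda>n. \<rho> (?e n))"])
      show "\<pi> \<in> extensional (space M)" by (simp add: \<pi>_def)
      show "case_nat (space M - U) ?e n \<in> sets M" for n using U e D(3) by (cases n) auto
      show "(\<Union>n. case_nat (space M - U) ?e n) = space M"
        unfolding UN_case_nat using re sets.sets_into_space[OF U] by (auto simp: U_def)
      show "case_nat ident (\<lambda>n. \<rho> (?e n)) n \<in> F" for n using F_ident \<rho>(1) e by (cases n) auto
      show "\<pi> x = case_nat ident (\<lambda>n. \<rho> (?e n)) n x" if "x \<in> case_nat (space M - U) ?e n" for n x
        using that \<pi>2 \<pi>1 e by (cases n) (auto simp: ident_app)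
    qed (use \<pi>\<pi> in auto)
  qed
  have \<pi>U: "\<pi> x \<noteq> x \<longleftrightarrow> x \<in> U" if "x \<in> space M" for x
  proof (cases "x \<in> U")
    case True
    then obtain E where E: "E \<in> \<D>" "x \<in> E" by (auto simp: U_def)
    then have "x \<in> supp (\<rho> E)" using \<rho>(3) by simp
    then show ?thesis using True \<pi>1[OF E] by (simp add: supp_def)
  qed (use \<pi>2 that in auto)
  have "A - U \<in> null_sets M"
  proof (rule ccontr)
    assume n: "A - U \<notin> null_sets M"
    have AU: "A - U \<in> sets M" using A U by auto
    obtain \<sigma> B where s: "\<sigma> \<in> F" "\<And>x. x \<in> space M \<Longrightarrow> \<sigma> (\<sigma> x) = x" "\<And>x. x \<in> space M - (A - U) \<Longrightarrow> \<sigma> x = x"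
      "B \<in> sets M" "B \<subseteq> A - U" "B \<notin> null_sets M" "\<And>x. x \<in> B \<Longrightarrow> \<sigma> x \<in> (A - U) - B"
      by (rule nontrivial_involution[OF AU n]) blast
    have sub: "supp \<sigma> \<subseteq> A - U" using s(3) by (auto simp: supp_def)
    then have "good (supp \<sigma>)" using s(1,2) by (auto simp: good_def)
    moreover have "supp \<sigma> \<inter> \<Union>\<D> = {}" using sub by (auto simp: U_def)
    ultimately have "supp \<sigma> \<in> null_sets M" using D(5) supp_sets[OF s(1)] by blast
    moreover have "\<sigma> x \<noteq> x" if "x \<in> B" for x using s(7)[OF that] that by auto
    then have "B \<subseteq> supp \<sigma>" using sets.sets_into_space[OF s(4)] by (auto simp: supp_def)
    ultimately show False using s(4,6) null_sets_subset by blast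
  qed
  then have "AE x in M. x \<notin> A - U" by (rule AE_not_in)
  then have "AE x in M. \<pi> x \<noteq> x \<longleftrightarrow> x \<in> A"
    using AE_space
  proof eventually_elim
    case (elim x)
    then show ?case using \<pi>U UA by blast
  qed
  then show ?thesis using that \<open>\<pi> \<in> F\<close> \<pi>\<pi> by blast
qed

end

section \<open>Local subgroups\<close>

text \<open>Let \<open>p\<close> be an involution of a full group. The members of \<open>locU\<close> live on the support of \<open>p\<close> and
  include all restrictions of \<open>p\<close> to \<open>p\<close>-invariant sets; hence the members of \<open>locV\<close> square to the
  identity there but are arbitrary elsewhere, and \<open>locW\<close> is the group of all elements supported in the
  support of \<open>p\<close>.\<close>

definition locU :: "('b, 'c) monoid_scheme \<Rightarrow> 'b \<Rightarrow> 'b set" where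
  "locU \<GG> p = {u \<in> carrier \<GG>. u \<otimes>\<^bsub>\<GG>\<^esub> p = p \<otimes>\<^bsub>\<GG>\<^esub> u \<and> u \<otimes>\<^bsub>\<GG>\<^esub> u = \<one>\<^bsub>\<GG>\<^esub> \<and>
     (\<forall>c\<in>carrier \<GG>. \<forall>d\<in>carrier \<GG>. c \<otimes>\<^bsub>\<GG>\<^esub> d = \<one>\<^bsub>\<GG>\<^esub> \<longrightarrow> c \<otimes>\<^bsub>\<GG>\<^esub> p = p \<otimes>\<^bsub>\<GG>\<^esub> c \<longrightarrow>
        u \<otimes>\<^bsub>\<GG>\<^esub> (c \<otimes>\<^bsub>\<GG>\<^esub> u \<otimes>\<^bsub>\<GG>\<^esub> d) = c \<otimes>\<^bsub>\<GG>\<^esub> u \<otimes>\<^bsub>\<GG>\<^esub> d \<otimes>\<^bsub>\<GG>\<^esub> u)}"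

definition locV :: "('b, 'c) monoid_scheme \<Rightarrow> 'b \<Rightarrow> 'b set" where
  "locV \<GG> p = {v \<in> carrier \<GG>. \<forall>u\<in>locU \<GG> p. v \<otimes>\<^bsub>\<GG>\<^esub> u = u \<otimes>\<^bsub>\<GG>\<^esub> v}"

definition locW :: "('b, 'c) monoid_scheme \<Rightarrow> 'b \<Rightarrow> 'b set" where
  "locW \<GG> p = {w \<in> carrier \<GG>. \<forall>v\<in>locV \<GG> p. w \<otimes>\<^bsub>\<GG>\<^esub> (v \<otimes>\<^bsub>\<GG>\<^esub> v) = v \<otimes>\<^bsub>\<GG>\<^esub> v \<otimes>\<^bsub>\<GG>\<^esub> w}"

text \<open>The three sets are described by products and the unit alone, an inverse being a
  \<open>d\<close> with product \<open>\<one>\<close>, and each refers only to the preceding one. An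
  isomorphism therefore carries them over one after the other.\<close>

lemma iso_locW:
  assumes G: "group \<GG>" and H: "group \<HH>" and h: "h \<in> iso \<GG> \<HH>" and p: "p \<in> carrier \<GG>" and w: "w \<in> carrier \<GG>"
  shows "h w \<in> locW \<HH> (h p) \<longleftrightarrow> w \<in> locW \<GG> p"
proof -
  interpret G: group \<GG> by fact
  interpret H: group \<HH> by fact
  have hom: "h \<in> hom \<GG> \<HH>" and bij: "bij_betw h (carrier \<GG>) (carrier \<HH>)" using h by (auto simp: iso_def)
  have img: "carrier \<HH> = h ` carrier \<GG>" using bij by (simp add: bij_betw_def)
  have m: "h x \<otimes>\<^bsub>\<HH>\<^esub> h y = h (x \<otimes>\<^bsub>\<GG>\<^esub> y)" if "x \<in> carrier \<GG>" "y \<in> carrier \<GG>" for x y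
    using hom that by (simp add: hom_def)
  have one: "\<one>\<^bsub>\<HH>\<^esub> = h \<one>\<^bsub>\<GG>\<^esub>" using hom_one[OF hom G H] by simp
  have inj: "h x = h y \<longleftrightarrow> x = y" if "x \<in> carrier \<GG>" "y \<in> carrier \<GG>" for x y
    using bij that by (auto simp: bij_betw_def inj_on_def)
  have U: "h u \<in> locU \<HH> (h p) \<longleftrightarrow> u \<in> locU \<GG> p" if "u \<in> carrier \<GG>" for u
    unfolding locU_def img one using that p
    by (simp add: m inj inj_on_image_mem_iff[OF bij_betw_imp_inj_on[OF bij]] cong: ball_cong)
  have Usub: "locU \<HH> (h p) \<subseteq> h ` carrier \<GG>" "locU \<GG> p \<subseteq> carrier \<GG>" by (auto simp: locU_def img)
  have UU: "locU \<HH> (h p) = h ` locU \<GG> p" using U Usub by (auto simp: image_iff) blast+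
  have V: "h v \<in> locV \<HH> (h p) \<longleftrightarrow> v \<in> locV \<GG> p" if "v \<in> carrier \<GG>" for v
    unfolding locV_def UU img using that Usub(2)
    by (auto simp: m inj subset_iff)
  have Vsub: "locV \<HH> (h p) \<subseteq> h ` carrier \<GG>" "locV \<GG> p \<subseteq> carrier \<GG>" by (auto simp: locV_def img)
  have VV: "locV \<HH> (h p) = h ` locV \<GG> p" using V Vsub by (auto simp: image_iff) blast+
  show ?thesis
    unfolding locW_def VV img using w Vsub(2)
    by (auto simp: m inj subset_iff)
qed

lemma ae_class_eq_iff:
  assumes "S \<in> mp_bij M" "T \<in> mp_bij M"
  shows "ae_class M S = ae_class M T \<longleftrightarrow> (AE x in M. S x = T x)"
proof
  assume eq: "ae_class M S = ae_class M T"
  have "S \<in> ae_class M S" using assms by (simp add: ae_class_eq)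
  then show "AE x in M. S x = T x" using eq assms by (simp add: ae_class_eq)
next
  assume *: "AE x in M. S x = T x"
  have "(AE x in M. U x = S x) \<longleftrightarrow> (AE x in M. U x = T x)" for U
  proof
    assume "AE x in M. U x = S x"
    then show "AE x in M. U x = T x" using * by eventually_elim simp
  next
    assume "AE x in M. U x = T x"
    then show "AE x in M. U x = S x" using * by eventually_elim simp
  qed
  then show "ae_class M S = ae_class M T" using assms by (simp add: ae_class_eq)
qed

lemma ae_class_one: "ae_class M \<one>\<^bsub>mp_group M\<^esub> = \<one>\<^bsub>aut_group M\<^esub>"
  using group.coset_mult_one[OF group_mp_group
      subgroup.subset[OF normal_imp_subgroup[OF normal_ae_identities[of M]]]]
  by (simp add: ae_class_def aut_group_def FactGroup_def)

section \<open>The full group as an abstract group of classes\<close>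

context ergodic_relation
begin

abbreviation "cls \<equiv> ae_class M"

definition full :: "('a \<Rightarrow> 'a) set monoid" where
  "full = aut_group M\<lparr>carrier := cls ` F\<rparr>"

lemma full_carrier: "carrier full = cls ` F" by (simp add: full_def)

lemma cls_eq: "S \<in> F \<Longrightarrow> T \<in> F \<Longrightarrow> cls S = cls T \<longleftrightarrow> (AE x in M. S x = T x)"
  by (rule ae_class_eq_iff[OF F_mp F_mp])

lemma cls_mul: "S \<in> F \<Longrightarrow> T \<in> F \<Longrightarrow> cls S \<otimes>\<^bsub>full\<^esub> cls T = cls (S \<odot> T)"
  using mult_aut_group[OF F_mp F_mp] by (simp add: full_def)

lemma cls_one: "\<one>\<^bsub>full\<^esub> = cls ident"
  by (simp add: full_def ae_class_one)

lemma full_group: "group full"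
proof -
  interpret A: group "aut_group M" by (rule group_aut_group)
  have "subgroup (cls ` F) (aut_group M)"
  proof (rule A.subgroupI)
    show "cls ` F \<subseteq> carrier (aut_group M)" using F_mp by (auto simp: carrier_aut_group)
    show "cls ` F \<noteq> {}" using F_ident by auto
  next
    fix C assume "C \<in> cls ` F"
    then obtain T where T: "T \<in> F" "C = cls T" by auto
    have "cls (inve T) \<otimes>\<^bsub>aut_group M\<^esub> C = cls (inve T \<odot> T)"
      using mult_aut_group[OF F_mp F_mp] T F_inve by simp
    also have "inve T \<odot> T = ident" using group.l_inv[OF group_mp_group[of M], of T] F_mp[OF T(1)] by simp
    finally have "cls (inve T) \<otimes>\<^bsub>aut_group M\<^esub> C = \<one>\<^bsub>aut_group M\<^esub>" by (simp add: ae_class_one)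
    then have "inv\<^bsub>aut_group M\<^esub> C = cls (inve T)"
      using T F_inve F_mp by (intro A.inv_equality) (auto simp: carrier_aut_group)
    then show "inv\<^bsub>aut_group M\<^esub> C \<in> cls ` F" using F_inve T by blast
  next
    fix C C' assume "C \<in> cls ` F" "C' \<in> cls ` F"
    then show "C \<otimes>\<^bsub>aut_group M\<^esub> C' \<in> cls ` F"
      using mult_aut_group[OF F_mp F_mp] F_mul by auto
  qed
  then show ?thesis unfolding full_def by (rule subgroup.subgroup_is_group) (rule group_aut_group)
qed

lemma locU_iff:
  assumes "P \<in> F" "u \<in> F"
  shows "cls u \<in> locU full (cls P) \<longleftrightarrow> (AE x in M. u (P x) = P (u x)) \<and> (AE x in M. u (u x) = x) \<and>
    (\<forall>c\<in>F. \<forall>d\<in>F. (AE x in M. c (d x) = x) \<longrightarrow> (AE x in M. c (P x) = P (c x)) \<longrightarrow>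
      (AE x in M. u (c (u (d x))) = c (u (d (u x)))))"
  using assms unfolding locU_def full_carrier
  by (simp add: cls_mul cls_one cls_eq F_mul F_ident mul_app ident_app F_sp cong: ball_cong AE_cong)

lemma locV_iff:
  assumes "P \<in> F" "v \<in> F"
  shows "cls v \<in> locV full (cls P) \<longleftrightarrow> (\<forall>u\<in>F. cls u \<in> locU full (cls P) \<longrightarrow> (AE x in M. v (u x) = u (v x)))"
proof -
  have "cls v \<in> locV full (cls P) \<longleftrightarrow> (\<forall>u\<in>F. cls u \<in> locU full (cls P) \<longrightarrow> cls v \<otimes>\<^bsub>full\<^esub> cls u = cls u \<otimes>\<^bsub>full\<^esub> cls v)"
    using assms unfolding locV_def full_carrier by (auto simp: locU_def full_carrier)
  then show ?thesis using assms
    by (simp add: cls_mul cls_eq F_mul mul_app F_sp cong: ball_cong AE_cong)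
qed

lemma locW_iff:
  assumes "P \<in> F" "w \<in> F"
  shows "cls w \<in> locW full (cls P) \<longleftrightarrow> (\<forall>v\<in>F. cls v \<in> locV full (cls P) \<longrightarrow> (AE x in M. w (v (v x)) = v (v (w x))))"
proof -
  have "cls w \<in> locW full (cls P) \<longleftrightarrow> (\<forall>v\<in>F. cls v \<in> locV full (cls P) \<longrightarrow>
      cls w \<otimes>\<^bsub>full\<^esub> (cls v \<otimes>\<^bsub>full\<^esub> cls v) = cls v \<otimes>\<^bsub>full\<^esub> cls v \<otimes>\<^bsub>full\<^esub> cls w)"
    using assms unfolding locW_def full_carrier by (auto simp: locV_def full_carrier)
  then show ?thesis using assms
    by (simp add: cls_mul cls_eq F_mul mul_app F_sp cong: ball_cong AE_cong)
qed

section \<open>Supports recovered from commutation relations\<close>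

text \<open>Separate \<open>T\<close> from the identity: \<open>T\<close> maps \<open>E\<close> into
  \<open>C\<close>, while \<open>E\<close> itself misses \<open>C\<close>.\<close>

lemma displaced_subset:
  assumes T: "T \<in> F" and D: "D \<in> sets M" "D \<notin> null_sets M" "\<And>x. x \<in> D \<Longrightarrow> T x \<noteq> x"
  obtains E where "E \<in> sets M" "E \<subseteq> D" "E \<notin> null_sets M" "\<And>x. x \<in> E \<Longrightarrow> T x \<notin> E"
proof -
  obtain E C where E: "E \<in> sets M" "C \<in> sets M" "E \<subseteq> D" "E \<notin> null_sets M" "\<And>x. x \<in> E \<Longrightarrow> T x \<in> C \<and> x \<notin> C"
    by (rule separate_maps[OF M_standard F_meas[OF T] measurable_ident_sets[OF refl] D(1,2)])
      (use D(3) in blast)+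
  show ?thesis using that[of E] E by blast
qed

lemma supported_maps_to:
  assumes \<psi>: "\<psi> \<in> F" "\<And>x. x \<in> space M - E \<Longrightarrow> \<psi> x = x" and x: "x \<in> E" "x \<in> space M"
  shows "\<psi> x \<in> E"
proof (rule ccontr)
  assume n: "\<psi> x \<notin> E"
  then have "\<psi> (\<psi> x) = \<psi> x" using \<psi> F_sp[OF \<psi>(1) x(2)] by auto
  then have "\<psi> x = x" using F_inj[OF \<psi>(1) F_sp[OF \<psi>(1) x(2)] x(2)] by simp
  then show False using n x by simp
qed

text \<open>If \<open>u\<close> moved points fixed by \<open>P\<close>, it would displace a non-null
  set \<open>E\<close> of them. The element \<psi> of \<open>order_four\<close> on \<open>E\<close>
  commutes with \<open>P\<close>, so \<open>u\<close> must commute with its conjugate by \<psi>. On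
  \<open>E\<close> the two products reduce to \<psi>' and \<psi>, which forces \<psi> to square to
  the identity.\<close>

lemma locU_supp:
  assumes P: "P \<in> F" "AE x in M. P (P x) = x" and u: "u \<in> F" "cls u \<in> locU full (cls P)"
  shows "AE x in M. u x \<noteq> x \<longrightarrow> P x \<noteq> x"
proof (rule ccontr)
  assume neg: "\<not> ?thesis"
  define D where "D = supp u - supp P"
  have D: "D \<in> sets M" using supp_sets P(1) u(1) by (auto simp: D_def)
  have Dn: "D \<notin> null_sets M"
  proof
    assume "D \<in> null_sets M"
    then have "AE x in M. x \<notin> D" by (rule AE_not_in)
    then have "AE x in M. u x \<noteq> x \<longrightarrow> P x \<noteq> x" using AE_space by eventually_elim (auto simp: D_def supp_def)
    then show False using neg by simp
  qed
  have Du: "u x \<noteq> x" if "x \<in> D" for x using that by (auto simp: D_def supp_def)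
  obtain E where E: "E \<in> sets M" "E \<subseteq> D" "E \<notin> null_sets M" "\<And>x. x \<in> E \<Longrightarrow> u x \<notin> E"
    by (rule displaced_subset[OF u(1) D Dn Du]) blast+
  have PE: "P x = x" if "x \<in> E" for x using that E(2) by (auto simp: D_def supp_def)
  obtain \<psi> \<psi>' where \<psi>: "\<psi> \<in> F" "\<psi>' \<in> F" "\<And>x. x \<in> space M \<Longrightarrow> \<psi> (\<psi>' x) = x" "\<And>x. x \<in> space M \<Longrightarrow> \<psi>' (\<psi> x) = x"
    "\<And>x. x \<in> space M - E \<Longrightarrow> \<psi> x = x" "\<not> (AE x in M. \<psi> (\<psi> x) = x)"
    by (rule order_four[OF E(1,3)]) blast
  have \<psi>'E: "\<psi>' x = x" if "x \<in> space M - E" for x using \<psi>(4,5) that by (metis DiffD1)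
  have \<psi>in: "\<psi> x \<in> E" "\<psi>' x \<in> E" if "x \<in> E" "x \<in> space M" for x
    using supported_maps_to[OF \<psi>(1) _ that] supported_maps_to[OF \<psi>(2) _ that] \<psi>(5) \<psi>'E by blast+
  have "AE x in M. \<psi> (P x) = P (\<psi> x)" using P(2) AE_space
  proof eventually_elim
    case (elim x)
    show ?case
    proof (cases "x \<in> E")
      case True
      then show ?thesis using PE \<psi>in(1) elim by simp
    next
      case False
      then have "P x \<notin> E" using PE elim by metis
      then show ?thesis using False \<psi>(5) elim F_sp[OF P(1)] by simp
    qed
  qed
  moreover have "AE x in M. \<psi> (\<psi>' x) = x" using \<psi>(3) by (rule AE_I2)
  ultimately have *: "AE x in M. u (\<psi> (u (\<psi>' x))) = \<psi> (u (\<psi>' (u x)))"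
    using u(2) \<psi>(1,2) unfolding locU_iff[OF P(1) u(1)] by blast
  have uu: "AE x in M. u (u x) = x" using u(2) unfolding locU_iff[OF P(1) u(1)] by blast
  have "AE x in M. \<psi> (\<psi> x) = x" using * uu F_AE[OF \<psi>(2) uu] AE_space
  proof eventually_elim
    case (elim x)
    show ?case
    proof (cases "x \<in> E")
      case True
      have sp: "u x \<in> space M" "\<psi>' x \<in> space M" "u (\<psi>' x) \<in> space M" "\<psi> x \<in> space M" using elim(4) F_sp u(1) \<psi>(1,2) by auto
      have e1: "\<psi>' x \<in> E" using \<psi>in(2) True elim(4) .
      have "\<psi> (u (\<psi>' x)) = u (\<psi>' x)" using \<psi>(5) E(4)[OF e1] sp by simp
      then have l: "u (\<psi> (u (\<psi>' x))) = \<psi>' x" using elim(3) by simp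
      have "\<psi>' (u x) = u x" using \<psi>'E E(4)[OF True] sp by simp
      then have "\<psi> (u (\<psi>' (u x))) = \<psi> x" using elim(2) by simp
      then have "\<psi> x = \<psi>' x" using l elim(1) by simp
      then show ?thesis using \<psi>(3) elim(4) by simp
    next
      case False
      then show ?thesis using \<psi>(5) elim(4) by simp
    qed
  qed
  then show False using \<psi>(6) by simp
qed

text \<open>Conjugating a restriction of \<open>P\<close> to an invariant set by something that
  commutes with \<open>P\<close> gives again a restriction of \<open>P\<close> to an invariant set,
  and any two such restrictions commute.\<close>

lemma cut_locU:
  assumes P: "P \<in> F" "AE x in M. P (P x) = x" and D: "D \<in> sets M"
  shows "cls (cut P D) \<in> locU full (cls P)"
proof -
  let ?q = "cut P D" and ?D = "dom_cut P D"
  have q: "?q \<in> F" by (rule cut_F[OF P(1) D])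
  have "AE x in M. ?q (P x) = P (?q x)" using P(2) AE_space
  proof eventually_elim
    case (elim x)
    then show ?case using dom_cut_iff[of P x D] F_sp[OF P(1)] by (simp add: cut_app)
  qed
  moreover have "AE x in M. ?q (?q x) = x" using cut_cut[OF P(1)] by (intro AE_I2)
  moreover have "AE x in M. ?q (c (?q (d x))) = c (?q (d (?q x)))"
    if cd: "c \<in> F" "d \<in> F" "AE x in M. c (d x) = x" "AE x in M. c (P x) = P (c x)" for c d
    using P(2) F_AE[OF cd(2) P(2)] cd(3) F_AE[OF P(1) cd(3)] F_AE[OF cd(2,4)] AE_space
  proof eventually_elim
    case (elim x)
    note sp = F_sp[OF cd(1)] F_sp[OF cd(2)] F_sp[OF P(1)] elim(6)
    \<comment> \<open>Being inverse to \<open>c\<close>, the map \<open>d\<close> commutes with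
      \<open>P\<close> as well. All points involved are then \<open>x\<close>, \<open>d x\<close>
      and their \<open>P\<close>-images, and the identity is checked by cases.\<close>
    have "c (d (P x)) = c (P (d x))" using elim by simp
    then have dP: "d (P x) = P (d x)" using F_inj[OF cd(1)] sp by simp
    have cP: "c (P (d x)) = P x" using elim by simp
    have qx: "?q x = (if x \<in> ?D then P x else x)" "?q (P x) = (if x \<in> ?D then x else P x)"
      using cut_app dom_cut_iff[of P x D, OF elim(1)] sp elim(1) by auto
    have qy: "?q (d x) = (if d x \<in> ?D then P (d x) else d x)" "?q (P (d x)) = (if d x \<in> ?D then d x else P (d x))"
      using cut_app dom_cut_iff[of P "d x" D, OF elim(2)] sp elim(2) by auto
    show ?case using qx qy dP cP elim(3) by auto
  qed
  ultimately show ?thesis unfolding locU_iff[OF P(1) q] by blast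
qed

text \<open>Since \<open>v\<close> commutes with every restriction of \<open>P\<close>, it cannot
  move a point of the support of \<open>P\<close> out of a \<open>P\<close>-invariant set, which
  leaves only \<open>x\<close> and \<open>P x\<close> as values. As \<open>v\<close> also commutes
  with \<open>P\<close>, it squares to the identity in both cases.\<close>

lemma locV_square:
  assumes P: "P \<in> F" "AE x in M. P (P x) = x" and v: "v \<in> F" "cls v \<in> locV full (cls P)"
  shows "AE x in M. P x \<noteq> x \<longrightarrow> v (v x) = x"
proof -
  have comm: "AE x in M. v (cut P D x) = cut P D (v x)" if "D \<in> sets M" for D
    using v(2) cut_locU[OF P that] cut_F[OF P(1) that] unfolding locV_iff[OF P(1) v(1)] by blast
  have vP: "AE x in M. v (P x) = P (v x)"
    using comm[of "space M", OF sets.top] P(2) F_AE[OF v(1) P(2)] AE_space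
  proof eventually_elim
    case (elim x)
    then show ?case using F_sp[OF P(1)] F_sp[OF v(1)] by (simp add: cut_app dom_cut_def)
  qed
  \<comment> \<open>The points of the support of \<open>P\<close> that \<open>v\<close> sends
    neither to themselves nor to their \<open>P\<close>-image.\<close>
  define D where "D = supp P \<inter> supp v \<inter> {x \<in> space M. v x \<noteq> P x}"
  have "{x \<in> space M. v x \<noteq> P x} = space M - {x \<in> space M. v x = P x}" by auto
  then have D: "D \<in> sets M"
    using standard_borel_eq_measurable[OF M_standard F_meas[OF v(1)] F_meas[OF P(1)]] supp_sets P(1) v(1)
    by (auto simp: D_def)
  have "D \<in> null_sets M"
  proof (rule ccontr)
    assume Dn: "D \<notin> null_sets M"
    have D1: "v x \<noteq> x" if "x \<in> D" for x using that by (auto simp: D_def supp_def)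
    have D2: "v x \<noteq> P x" if "x \<in> D" for x using that by (auto simp: D_def supp_def)
    obtain E1 C1 where E1: "E1 \<in> sets M" "C1 \<in> sets M" "E1 \<subseteq> D" "E1 \<notin> null_sets M"
      "\<And>x. x \<in> E1 \<Longrightarrow> v x \<in> C1 \<and> x \<notin> C1"
      by (rule separate_maps[OF M_standard F_meas[OF v(1)] measurable_ident_sets[OF refl] D Dn])
        (use D1 in blast)+
    have D2': "v x \<noteq> P x" if "x \<in> E1" for x using that E1(3) D2 by blast
    obtain E C2 where E: "E \<in> sets M" "C2 \<in> sets M" "E \<subseteq> E1" "E \<notin> null_sets M"
      "\<And>x. x \<in> E \<Longrightarrow> v x \<in> C2 \<and> P x \<notin> C2"
      by (rule separate_maps[OF M_standard F_meas[OF v(1)] F_meas[OF P(1)] E1(1,4) D2']) blast+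
    define B where "B = E \<union> P ` E"
    have B: "B \<in> sets M" using E(1) mp_bij_image(1)[OF F_mp[OF P(1)] E(1)] by (simp add: B_def)
    have "AE x in M. x \<notin> E" using comm[OF B] P(2) AE_space
    proof eventually_elim
      case (elim x)
      show ?case
      proof
        assume x: "x \<in> E"
        have "x \<in> dom_cut P B" using x elim by (auto simp: dom_cut_def B_def)
        then have q: "cut P B x = P x" using elim by (simp add: cut_app)
        have "v x \<in> C1" "v x \<in> C2" using x E(3) E(5)[OF x] E1(5)[of x] by auto
        moreover have "y \<notin> C1 \<or> y \<notin> C2" if "y \<in> B" for y
        proof (cases "y \<in> E")
          case True
          then show ?thesis using E(3) E1(5)[of y] by blast
        next
          case False
          then obtain z where "z \<in> E" "y = P z" using \<open>y \<in> B\<close> by (auto simp: B_def)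
          then show ?thesis using E(5)[of z] by blast
        qed
        ultimately have "v x \<notin> B" by blast
        then have "v x \<notin> dom_cut P B" by (simp add: dom_cut_def)
        then have "cut P B (v x) = v x" using F_sp[OF v(1) elim(3)] by (simp add: cut_app)
        then have "v (P x) = v x" using elim(1) q by simp
        then have "P x = x" using F_inj[OF v(1)] F_sp[OF P(1)] elim(3) by simp
        moreover have "P x \<noteq> x" using x E(3) E1(3) by (auto simp: D_def supp_def)
        ultimately show False by simp
      qed
    qed
    then show False using E AE_iff_null_sets by blast
  qed
  then have "AE x in M. x \<notin> D" by (rule AE_not_in)
  then show ?thesis using vP P(2) AE_space
  proof eventually_elim
    case (elim x)
    then show ?case by (cases "v x = x") (auto simp: D_def supp_def)
  qed
qed

text \<open>If \<open>T\<close> lives on the support of \<open>P\<close>, it commutes with the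
  squares from \<open>locV\<close>, which are trivial there. Conversely, suppose \<open>T\<close>
  displaces a non-null set \<open>E\<close> of fixed points of \<open>P\<close>. The element \<psi>
  of \<open>order_four\<close> on \<open>E\<close> commutes with \<open>locU\<close>, whose members
  fix \<open>E\<close> by \<open>locU_supp\<close>, so its square must commute with
  \<open>T\<close>; as \<open>T\<close> takes \<open>E\<close> off itself, this square would be
  trivial.\<close>

lemma locW_supp:
  assumes P: "P \<in> F" "AE x in M. P (P x) = x" and T: "T \<in> F"
  shows "cls T \<in> locW full (cls P) \<longleftrightarrow> (AE x in M. T x \<noteq> x \<longrightarrow> P x \<noteq> x)"
proof
  assume TP: "AE x in M. T x \<noteq> x \<longrightarrow> P x \<noteq> x"
  have "AE x in M. T (v (v x)) = v (v (T x))" if v: "v \<in> F" "cls v \<in> locV full (cls P)" for v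
  proof -
    note sq = locV_square[OF P v]
    show ?thesis
      using sq F_AE[OF T sq] F_AE[OF v(1) F_AE[OF v(1) sq]] TP F_AE[OF T TP] F_AE[OF v(1) F_AE[OF v(1) TP]] AE_space
    proof eventually_elim
      case (elim x)
      note sp = F_sp[OF v(1)] F_sp[OF T] elim(7)
      show ?case
      proof (cases "P x = x")
        case True
        then have Tx: "T x = x" using elim(4) by blast
        \<comment> \<open>The square of \<open>v\<close> does not carry \<open>x\<close> into the
          support of \<open>P\<close>: there it is the identity, so by injectivity \<open>x\<close>
          would already lie in that support.\<close>
        have "T (v (v x)) = v (v x)"
        proof (rule ccontr)
          assume "T (v (v x)) \<noteq> v (v x)"
          then have "v (v (v (v x))) = v (v x)" using elim by blast
          then have "v (v x) = x" using F_inj[OF v(1)] sp by simp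
          then show False using \<open>T (v (v x)) \<noteq> v (v x)\<close> Tx by simp
        qed
        then show ?thesis using Tx by simp
      next
        case False
        then have vv: "v (v x) = x" using elim by blast
        show ?thesis
        proof (cases "T x = x")
          case False
          then have "T (T x) \<noteq> T x" using F_inj[OF T] sp by simp
          then have "v (v (T x)) = T x" using elim by blast
          then show ?thesis using vv by simp
        qed (use vv in simp)
      qed
    qed
  qed
  then show "cls T \<in> locW full (cls P)" unfolding locW_iff[OF P(1) T] by blast
next
  assume W: "cls T \<in> locW full (cls P)"
  show "AE x in M. T x \<noteq> x \<longrightarrow> P x \<noteq> x"
  proof (rule ccontr)
    assume neg: "\<not> ?thesis"
    define D where "D = supp T - supp P"
    have D: "D \<in> sets M" using supp_sets P(1) T by (auto simp: D_def)
    have Dn: "D \<notin> null_sets M"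
    proof
      assume "D \<in> null_sets M"
      then have "AE x in M. x \<notin> D" by (rule AE_not_in)
      then have "AE x in M. T x \<noteq> x \<longrightarrow> P x \<noteq> x" using AE_space by eventually_elim (auto simp: D_def supp_def)
      then show False using neg by simp
    qed
    have DT: "T x \<noteq> x" if "x \<in> D" for x using that by (auto simp: D_def supp_def)
    obtain E where E: "E \<in> sets M" "E \<subseteq> D" "E \<notin> null_sets M" "\<And>x. x \<in> E \<Longrightarrow> T x \<notin> E"
      by (rule displaced_subset[OF T D Dn DT]) blast+
    have PE: "P x = x" if "x \<in> E" for x using that E(2) by (auto simp: D_def supp_def)
    obtain \<psi> \<psi>' where \<psi>: "\<psi> \<in> F" "\<psi>' \<in> F" "\<And>x. x \<in> space M \<Longrightarrow> \<psi> (\<psi>' x) = x" "\<And>x. x \<in> space M \<Longrightarrow> \<psi>' (\<psi> x) = x"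
      "\<And>x. x \<in> space M - E \<Longrightarrow> \<psi> x = x" "\<not> (AE x in M. \<psi> (\<psi> x) = x)"
      by (rule order_four[OF E(1,3)]) blast
    have \<psi>in: "\<psi> x \<in> E" if "x \<in> E" "x \<in> space M" for x
      using supported_maps_to[OF \<psi>(1) _ that] \<psi>(5) by blast
    have "AE x in M. \<psi> (u x) = u (\<psi> x)" if u: "u \<in> F" "cls u \<in> locU full (cls P)" for u
    proof -
      note su = locU_supp[OF P u]
      show ?thesis using su F_AE[OF \<psi>(1) su] F_AE[OF u(1) su] AE_space
      proof eventually_elim
        case (elim x)
        show ?case
        proof (cases "x \<in> E")
          case True
          then show ?thesis using PE \<psi>in[OF True elim(4)] elim by metis
        next
          case False
          have "u x \<notin> E"
          proof
            assume ux: "u x \<in> E"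
            then have "u (u x) = u x" using PE elim(3) by blast
            then have "u x = x" using F_inj[OF u(1)] F_sp[OF u(1)] elim(4) by simp
            then show False using ux False by simp
          qed
          then show ?thesis using False \<psi>(5) elim(4) F_sp[OF u(1)] by simp
        qed
      qed
    qed
    then have "cls \<psi> \<in> locV full (cls P)" unfolding locV_iff[OF P(1) \<psi>(1)] by blast
    then have "AE x in M. T (\<psi> (\<psi> x)) = \<psi> (\<psi> (T x))"
      using W \<psi>(1) unfolding locW_iff[OF P(1) T] by blast
    then have "AE x in M. \<psi> (\<psi> x) = x" using AE_space
    proof eventually_elim
      case (elim x)
      note sp = F_sp[OF \<psi>(1)] F_sp[OF T] elim(2)
      show ?case
      proof (cases "x \<in> E")
        case True
        then have "\<psi> (T x) = T x" using E(4) \<psi>(5) sp by simp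
        then have "T (\<psi> (\<psi> x)) = T x" using elim(1) by simp
        then show ?thesis using F_inj[OF T] sp by simp
      qed (use \<psi>(5) sp in simp)
    qed
    then show False using \<psi>(6) by simp
  qed
qed

end

section \<open>Spatial realisation of isomorphisms\<close>

locale full_group_iso = X: ergodic_relation M R + Y: ergodic_relation M R'
  for M :: "'a measure" and R R' :: "'a \<Rightarrow> 'a \<Rightarrow> bool" +
  fixes \<Psi> :: "('a \<Rightarrow> 'a) set \<Rightarrow> ('a \<Rightarrow> 'a) set"
  assumes \<Psi>_iso: "\<Psi> \<in> iso X.full Y.full"
begin

text \<open>The isomorphism acts on classes. Working with a relation between representatives avoids
  a chosen representative of each image, and products of related pairs remain related.\<close>

definition rel :: "('a \<Rightarrow> 'a) \<Rightarrow> ('a \<Rightarrow> 'a) \<Rightarrow> bool" where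
  "rel T T' \<longleftrightarrow> T \<in> X.F \<and> T' \<in> Y.F \<and> \<Psi> (ae_class M T) = ae_class M T'"

lemma relD: "rel T T' \<Longrightarrow> T \<in> X.F" "rel T T' \<Longrightarrow> T' \<in> Y.F" "rel T T' \<Longrightarrow> \<Psi> (ae_class M T) = ae_class M T'"
  by (simp_all add: rel_def)

lemma \<Psi>_bij: "bij_betw \<Psi> (ae_class M ` X.F) (ae_class M ` Y.F)"
  using \<Psi>_iso by (simp add: iso_def X.full_carrier Y.full_carrier)

lemma \<Psi>_hom: "\<Psi> \<in> hom X.full Y.full"
  using \<Psi>_iso by (simp add: iso_def)

lemma rel_ex: assumes "T \<in> X.F" obtains T' where "rel T T'"
proof -
  have "\<Psi> (ae_class M T) \<in> ae_class M ` Y.F" using \<Psi>_bij assms by (auto simp: bij_betw_def)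
  then show ?thesis using that assms by (auto simp: rel_def)
qed

lemma rel_ex': assumes "T' \<in> Y.F" obtains T where "rel T T'"
proof -
  have "ae_class M T' \<in> \<Psi> ` ae_class M ` X.F" using \<Psi>_bij assms by (auto simp: bij_betw_def)
  then obtain T where "T \<in> X.F" "\<Psi> (ae_class M T) = ae_class M T'" by auto
  then show ?thesis using that assms by (auto simp: rel_def)
qed

lemma rel_mul:
  assumes "rel S S'" "rel T T'"
  shows "rel (S \<otimes>\<^bsub>mp_group M\<^esub> T) (S' \<otimes>\<^bsub>mp_group M\<^esub> T')"
proof -
  have c: "ae_class M S \<in> carrier X.full" "ae_class M T \<in> carrier X.full"
    using assms relD(1) by (auto simp: X.full_carrier)
  have "\<Psi> (ae_class M S \<otimes>\<^bsub>X.full\<^esub> ae_class M T) = \<Psi> (ae_class M S) \<otimes>\<^bsub>Y.full\<^esub> \<Psi> (ae_class M T)"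
    by (rule hom_mult[OF \<Psi>_hom c])
  then show ?thesis
    using assms X.F_mul Y.F_mul by (simp add: rel_def X.cls_mul Y.cls_mul)
qed

lemma rel_ident: "rel X.ident X.ident"
  using hom_one[OF \<Psi>_hom X.full_group Y.full_group] X.F_ident Y.F_ident
  by (simp add: rel_def X.cls_one Y.cls_one)

lemma rel_AE_iff:
  assumes "rel S S'" "rel T T'"
  shows "(AE x in M. S x = T x) \<longleftrightarrow> (AE x in M. S' x = T' x)"
proof -
  note F = relD(1)[OF assms(1)] relD(1)[OF assms(2)] relD(2)[OF assms(1)] relD(2)[OF assms(2)]
  have "inj_on \<Psi> (ae_class M ` X.F)" using \<Psi>_bij by (simp add: bij_betw_def)
  then have "ae_class M S = ae_class M T \<longleftrightarrow> \<Psi> (ae_class M S) = \<Psi> (ae_class M T)"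
    using F by (auto simp: inj_on_def)
  also have "\<dots> \<longleftrightarrow> ae_class M S' = ae_class M T'" using relD(3) assms by simp
  finally show ?thesis using X.cls_eq[OF F(1,2)] Y.cls_eq[OF F(3,4)] by simp
qed

lemma rel_mul_ident:
  assumes "rel S S'" "rel T T'"
  shows "(AE x in M. S (T x) = x) \<longleftrightarrow> (AE x in M. S' (T' x) = x)"
proof -
  note F = relD(1)[OF assms(1)] relD(1)[OF assms(2)] relD(2)[OF assms(1)] relD(2)[OF assms(2)]
  show ?thesis
    using rel_AE_iff[OF rel_mul[OF assms] rel_ident]
    by (simp add: X.mul_app[OF F(1,2)] Y.mul_app[OF F(3,4)] X.ident_app cong: AE_cong)
qed

text \<open>By \<open>locW_supp\<close>, inclusion of supports is membership in \<open>locW\<close>,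
  which isomorphisms preserve and reflect.\<close>

lemma rel_supp:
  assumes P: "rel P P'" "AE x in M. P (P x) = x" and Q: "rel Q Q'" "AE x in M. Q (Q x) = x"
  shows "(AE x in M. P x \<noteq> x \<longrightarrow> Q x \<noteq> x) \<longleftrightarrow> (AE x in M. P' x \<noteq> x \<longrightarrow> Q' x \<noteq> x)"
proof -
  note F = relD(1)[OF P(1)] relD(1)[OF Q(1)] relD(2)[OF P(1)] relD(2)[OF Q(1)]
  have Q': "AE x in M. Q' (Q' x) = x" using Q(2) rel_mul_ident[OF Q(1) Q(1)] by simp
  have "\<Psi> (ae_class M P) \<in> locW Y.full (\<Psi> (ae_class M Q)) \<longleftrightarrow> ae_class M P \<in> locW X.full (ae_class M Q)"
    by (rule iso_locW[OF X.full_group Y.full_group \<Psi>_iso]) (use F in \<open>auto simp: X.full_carrier\<close>)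
  then show ?thesis
    using X.locW_supp[OF F(2) Q(2) F(1)] Y.locW_supp[OF F(4) Q' F(3)] relD(3)[OF P(1)] relD(3)[OF Q(1)]
    by simp
qed

lemma rel_supp_eq:
  assumes P: "rel P P'" "AE x in M. P (P x) = x" and Q: "rel Q Q'" "AE x in M. Q (Q x) = x"
  shows "(AE x in M. P x \<noteq> x \<longleftrightarrow> Q x \<noteq> x) \<longleftrightarrow> (AE x in M. P' x \<noteq> x \<longleftrightarrow> Q' x \<noteq> x)"
  unfolding AE_iff_conv rel_supp[OF P Q] rel_supp[OF Q P] ..

text \<open>The automorphism sends \<open>B\<close> to the support of the image of an involution
  supported on \<open>B\<close>; by \<open>rel_supp_eq\<close> the choice of this involution is
  immaterial. Equivariance comes from conjugation, since conjugating an involution by an element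
  moves its support by that element.\<close>

lemma support_map:
  obtains \<theta> where "measure_algebra_iso M \<theta>"
    "\<And>T T' B. rel T T' \<Longrightarrow> B \<in> sets M \<Longrightarrow> AE x in M. x \<in> \<theta> (T -` B \<inter> space M) \<longleftrightarrow> T' x \<in> \<theta> B"
proof -
  have "\<exists>P P'. rel P P' \<and> (\<forall>x\<in>space M. P (P x) = x) \<and> (AE x in M. P x \<noteq> x \<longleftrightarrow> x \<in> B)" if B: "B \<in> sets M" for B
  proof -
    obtain P where P: "P \<in> X.F" "\<And>x. x \<in> space M \<Longrightarrow> P (P x) = x" "AE x in M. P x \<noteq> x \<longleftrightarrow> x \<in> B"
      by (rule X.involution_with_support[OF B]) blast
    obtain P' where "rel P P'" by (rule rel_ex[OF P(1)])
    then show ?thesis using P by blast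
  qed
  then have "\<forall>B\<in>sets M. \<exists>p. rel (fst p) (snd p) \<and> (\<forall>x\<in>space M. fst p (fst p x) = x) \<and>
      (AE x in M. fst p x \<noteq> x \<longleftrightarrow> x \<in> B)" by simp
  then obtain p where p: "\<forall>B\<in>sets M. rel (fst (p B)) (snd (p B)) \<and> (\<forall>x\<in>space M. fst (p B) (fst (p B) x) = x) \<and>
      (AE x in M. fst (p B) x \<noteq> x \<longleftrightarrow> x \<in> B)" by (rule bchoice[THEN exE])
  define \<pi> \<tau> where "\<pi> = (\<lambda>B. fst (p B))" and "\<tau> = (\<lambda>B. snd (p B))"
  have \<pi>: "\<And>B. B \<in> sets M \<Longrightarrow> rel (\<pi> B) (\<tau> B)"
    "\<And>B x. B \<in> sets M \<Longrightarrow> x \<in> space M \<Longrightarrow> \<pi> B (\<pi> B x) = x"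
    "\<And>B. B \<in> sets M \<Longrightarrow> AE x in M. \<pi> B x \<noteq> x \<longleftrightarrow> x \<in> B"
    using p unfolding \<pi>_def \<tau>_def by blast+
  have \<pi>\<pi>: "AE x in M. \<pi> B (\<pi> B x) = x" if "B \<in> sets M" for B using \<pi>(2)[OF that] by (rule AE_I2)
  have \<tau>\<tau>: "AE x in M. \<tau> B (\<tau> B x) = x" if "B \<in> sets M" for B
    using rel_mul_ident[OF \<pi>(1) \<pi>(1), OF that that] \<pi>\<pi>[OF that] by simp
  define \<theta> where "\<theta> = (\<lambda>B. Y.supp (\<tau> B))"
  have \<theta>: "AE x in M. x \<in> \<theta> B \<longleftrightarrow> \<tau> B x \<noteq> x" for B
    using AE_space by eventually_elim (simp add: \<theta>_def Y.supp_def)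
  show ?thesis
  proof (rule that[of \<theta>])
    show "measure_algebra_iso M \<theta>"
    proof
      show "\<theta> A \<in> sets M" if "A \<in> sets M" for A
        unfolding \<theta>_def by (rule Y.supp_sets[OF relD(2)[OF \<pi>(1)[OF that]]])
      show "(AE x in M. x \<in> \<theta> A \<longrightarrow> x \<in> \<theta> B) \<longleftrightarrow> (AE x in M. x \<in> A \<longrightarrow> x \<in> B)"
        if A: "A \<in> sets M" and B: "B \<in> sets M" for A B
      proof -
        have "(AE x in M. x \<in> A \<longrightarrow> x \<in> B) \<longleftrightarrow> (AE x in M. \<pi> A x \<noteq> x \<longrightarrow> \<pi> B x \<noteq> x)"
        proof
          assume "AE x in M. x \<in> A \<longrightarrow> x \<in> B"
          then show "AE x in M. \<pi> A x \<noteq> x \<longrightarrow> \<pi> B x \<noteq> x"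
            using \<pi>(3)[OF A] \<pi>(3)[OF B] by eventually_elim blast
        next
          assume "AE x in M. \<pi> A x \<noteq> x \<longrightarrow> \<pi> B x \<noteq> x"
          then show "AE x in M. x \<in> A \<longrightarrow> x \<in> B"
            using \<pi>(3)[OF A] \<pi>(3)[OF B] by eventually_elim blast
        qed
        also have "\<dots> \<longleftrightarrow> (AE x in M. \<tau> A x \<noteq> x \<longrightarrow> \<tau> B x \<noteq> x)"
          by (rule rel_supp[OF \<pi>(1)[OF A] \<pi>\<pi>[OF A] \<pi>(1)[OF B] \<pi>\<pi>[OF B]])
        also have "\<dots> \<longleftrightarrow> (AE x in M. x \<in> \<theta> A \<longrightarrow> x \<in> \<theta> B)"
          by (rule AE_cong) (simp add: \<theta>_def Y.supp_def)
        finally show ?thesis by simp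
      qed
      show "\<exists>A\<in>sets M. AE x in M. x \<in> \<theta> A \<longleftrightarrow> x \<in> B" if B: "B \<in> sets M" for B
      proof -
        obtain Q' where Q': "Q' \<in> Y.F" "\<And>x. x \<in> space M \<Longrightarrow> Q' (Q' x) = x" "AE x in M. Q' x \<noteq> x \<longleftrightarrow> x \<in> B"
          by (rule Y.involution_with_support[OF B]) blast
        obtain Q where Q: "rel Q Q'" by (rule rel_ex'[OF Q'(1)])
        have "AE x in M. Q' (Q' x) = x" using Q'(2) by (rule AE_I2)
        then have QQ: "AE x in M. Q (Q x) = x" using rel_mul_ident[OF Q Q] by simp
        \<comment> \<open>The involutions \<open>Q\<close> and \<open>\<pi> ?A\<close> may differ
          but share their support modulo null sets, so their images share theirs. This gives
          surjectivity.\<close>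
        let ?A = "X.supp Q"
        have A: "?A \<in> sets M" by (rule X.supp_sets[OF relD(1)[OF Q]])
        have "AE x in M. \<pi> ?A x \<noteq> x \<longleftrightarrow> Q x \<noteq> x"
          using \<pi>(3)[OF A] AE_space by eventually_elim (simp add: X.supp_def)
        then have "AE x in M. \<tau> ?A x \<noteq> x \<longleftrightarrow> Q' x \<noteq> x"
          using rel_supp_eq[OF \<pi>(1)[OF A] \<pi>\<pi>[OF A] Q QQ] by simp
        then have "AE x in M. x \<in> \<theta> ?A \<longleftrightarrow> x \<in> B" using \<theta>[of ?A] Q'(3) by eventually_elim blast
        then show ?thesis using A by blast
      qed
    qed
    fix T T' B assume T: "rel T T'" and B: "B \<in> sets M"
    note F = relD(1)[OF T] relD(2)[OF T]
    let ?C = "T -` B \<inter> space M"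
    have C: "?C \<in> sets M" using measurable_sets[OF X.F_meas[OF F(1)] B] .
    \<comment> \<open>A representative of the image of the inverse, which is inverse to
      \<open>T'\<close> only almost everywhere.\<close>
    obtain U' where U: "rel (X.inve T) U'" by (rule rel_ex[OF X.F_inve[OF F(1)]])
    have "AE x in M. X.inve T (T x) = x" using X.inve_app(2)[OF F(1)] by (rule AE_I2)
    then have UT: "AE x in M. U' (T' x) = x" using rel_mul_ident[OF U T] by simp
    note FB = relD(1)[OF \<pi>(1)[OF B]] relD(2)[OF \<pi>(1)[OF B]]
    note FU = relD(1)[OF U] relD(2)[OF U]
    \<comment> \<open>The conjugate of \<open>\<pi> B\<close> has the same support as
      \<open>\<pi> ?C\<close>, and its image \<open>Q'\<close> is supported on the
      \<open>T'\<close>-preimage of \<open>\<theta> B\<close>. Comparing the images of these two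
      involutions gives equivariance.\<close>
    define Q where "Q = X.inve T \<otimes>\<^bsub>mp_group M\<^esub> (\<pi> B \<otimes>\<^bsub>mp_group M\<^esub> T)"
    define Q' where "Q' = U' \<otimes>\<^bsub>mp_group M\<^esub> (\<tau> B \<otimes>\<^bsub>mp_group M\<^esub> T')"
    have Q: "rel Q Q'" unfolding Q_def Q'_def by (intro rel_mul U \<pi>(1) B T)
    have Qx: "Q x = X.inve T (\<pi> B (T x))" if "x \<in> space M" for x
      using that F FB FU by (simp add: Q_def X.mul_app X.F_mul)
    have Q'x: "Q' x = U' (\<tau> B (T' x))" if "x \<in> space M" for x
      using that F FB FU by (simp add: Q'_def Y.mul_app Y.F_mul)
    have sp: "T x \<in> space M" "\<pi> B x \<in> space M" "X.inve T x \<in> space M" if "x \<in> space M" for x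
      using that X.F_sp[OF F(1)] X.F_sp[OF FB(1)] X.F_sp[OF FU(1)] by auto
    have "Q (Q x) = x" if "x \<in> space M" for x
      using that sp by (simp add: Qx X.inve_app[OF F(1)] \<pi>(2)[OF B])
    then have QQ: "AE x in M. Q (Q x) = x" by (rule AE_I2)
    have "AE x in M. \<pi> ?C x \<noteq> x \<longleftrightarrow> Q x \<noteq> x"
      using \<pi>(3)[OF C] X.F_AE[OF F(1) \<pi>(3)[OF B]] AE_space
    proof eventually_elim
      case (elim x)
      have "Q x = x \<longleftrightarrow> \<pi> B (T x) = T x"
        using elim(3) sp X.inve_app[OF F(1)] by (metis Qx)
      then show ?case using elim by auto
    qed
    then have 1: "AE x in M. \<tau> ?C x \<noteq> x \<longleftrightarrow> Q' x \<noteq> x"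
      using rel_supp_eq[OF \<pi>(1)[OF C] \<pi>\<pi>[OF C] Q QQ] by simp
    show "AE x in M. x \<in> \<theta> ?C \<longleftrightarrow> T' x \<in> \<theta> B"
      using 1 \<theta>[of ?C] Y.F_AE[OF F(2) \<theta>[of B]] UT AE_space
    proof eventually_elim
      case (elim x)
      have s: "T' x \<in> space M" "\<tau> B (T' x) \<in> space M" using elim(5) Y.F_sp F(2) FB(2) by auto
      have "Q' x = x \<longleftrightarrow> U' (\<tau> B (T' x)) = U' (T' x)" using elim by (simp add: Q'x)
      also have "\<dots> \<longleftrightarrow> \<tau> B (T' x) = T' x" using Y.F_inj[OF FU(2) s(2,1)] .
      finally show ?case using elim by blast
    qed
  qed
qed

text \<open>Since \<theta> is the preimage map of \<open>S\<close>, equivariance of \<theta> says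
  that \<open>S\<close> after \<open>T'\<close> and \<open>T\<close> after \<open>S\<close> have the
  same preimages modulo null sets; on a standard Borel space such maps agree almost
  everywhere.\<close>

lemma spatial:
  obtains S where "S \<in> borel_bij M"
    "\<And>B. B \<in> sets M \<Longrightarrow> (AE x in M. S x \<notin> B) \<longleftrightarrow> (AE x in M. x \<notin> B)"
    "\<And>T T'. rel T T' \<Longrightarrow> AE x in M. S (T' x) = T (S x)"
proof -
  obtain \<theta> where \<theta>: "measure_algebra_iso M \<theta>"
    "\<And>T T' B. rel T T' \<Longrightarrow> B \<in> sets M \<Longrightarrow> AE x in M. x \<in> \<theta> (T -` B \<inter> space M) \<longleftrightarrow> T' x \<in> \<theta> B"
    by (rule support_map) blast
  interpret measure_algebra_iso M \<theta> by (rule \<theta>(1))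
  obtain S where S: "S \<in> borel_bij M" "\<And>B. B \<in> sets M \<Longrightarrow> AE x in M. S x \<in> B \<longleftrightarrow> x \<in> \<theta> B"
    by (rule lift_borel_bij[OF X.ssf]) blast
  have Sm: "S \<in> M \<rightarrow>\<^sub>M M" using S(1) by (simp add: borel_bij_def)
  show ?thesis
  proof (rule that[OF S(1)])
    fix B assume B: "B \<in> sets M"
    show "(AE x in M. S x \<notin> B) \<longleftrightarrow> (AE x in M. x \<notin> B)"
    proof
      assume "AE x in M. x \<notin> B"
      then have "AE x in M. x \<notin> \<theta> B" using null B by blast
      then show "AE x in M. S x \<notin> B" using S(2)[OF B] by eventually_elim blast
    next
      assume "AE x in M. S x \<notin> B"
      then have "AE x in M. x \<in> \<theta> B \<longrightarrow> x \<in> \<theta> {}" using S(2)[OF B] by eventually_elim blast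
      then have "AE x in M. x \<in> B \<longrightarrow> x \<in> {}" using order[OF B, of "{}"] by simp
      then show "AE x in M. x \<notin> B" by eventually_elim blast
    qed
  next
    fix T T' assume T: "rel T T'"
    note F = relD(1)[OF T] relD(2)[OF T]
    show "AE x in M. S (T' x) = T (S x)"
    proof (rule AE_eq_if_AE_mem_iff[OF X.M_standard measurable_compose[OF Y.F_meas[OF F(2)] Sm]
          measurable_compose[OF Sm X.F_meas[OF F(1)]]])
      fix B assume B: "B \<in> sets M"
      let ?C = "T -` B \<inter> space M"
      have C: "?C \<in> sets M" using measurable_sets[OF X.F_meas[OF F(1)] B] .
      show "AE x in M. S (T' x) \<in> B \<longleftrightarrow> T (S x) \<in> B"
        using S(2)[OF C] Y.F_AE[OF F(2) S(2)[OF B]] \<theta>(2)[OF T B] AE_space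
      proof eventually_elim
        case (elim x)
        have "S x \<in> space M" using measurable_space[OF Sm elim(4)] .
        then have "T (S x) \<in> B \<longleftrightarrow> S x \<in> ?C" by simp
        then show ?case using elim by blast
      qed
    qed
  qed
qed

end

section \<open>The image measure and its density\<close>

text \<open>Each sublevel set at a rational level is invariant, hence null or conull. Outside one
  null set all values therefore lie on the same side of every rational and so coincide.\<close>

lemma (in ergodic_relation) invariant_function_const:
  fixes f :: "'a \<Rightarrow> ennreal"
  assumes f: "f \<in> borel_measurable M" and inv: "\<And>T. T \<in> F \<Longrightarrow> AE x in M. f (T x) = f x"
  obtains c where "AE x in M. f x = c"
proof -
  define q where "q = (\<lambda>r::rat. ennreal (real_of_rat r))"
  define E where "E = (\<lambda>r. {x \<in> space M. f x \<le> q r})"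
  have E: "E r \<in> sets M" for r unfolding E_def using f by measurable
  have "(AE x in M. x \<in> E r) \<or> (AE x in M. x \<notin> E r)" for r
  proof -
    have "sym_diff (T ` E r) (E r) \<in> null_sets M" if "T \<in> mp_bij M" "AE x in M. R x (T x)" for T
    proof -
      have T: "T \<in> F" using that by (simp add: F_def)
      have s: "sym_diff (T ` E r) (E r) \<in> sets M" using mp_bij_image(1)[OF F_mp[OF T] E] E by blast
      have "AE x in M. x \<notin> sym_diff (T ` E r) (E r)"
        using F_AE[OF F_inve[OF T] inv[OF T]] AE_space
      proof eventually_elim
        case (elim x)
        have sp: "inve T x \<in> space M" using F_sp[OF F_inve[OF T] elim(2)] .
        have "x \<in> T ` E r \<longleftrightarrow> inve T x \<in> E r"
        proof
          assume "x \<in> T ` E r"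
          then show "inve T x \<in> E r" using inve_app(2)[OF T] by (auto simp: E_def)
        next
          assume "inve T x \<in> E r"
          then show "x \<in> T ` E r" using inve_app(1)[OF T elim(2)] by (metis imageI)
        qed
        also have "\<dots> \<longleftrightarrow> x \<in> E r" using elim sp inve_app(1)[OF T elim(2)] by (simp add: E_def)
        finally show ?case by blast
      qed
      then show ?thesis using AE_iff_null_sets[OF s] by simp
    qed
    then have "E r \<in> null_sets M \<or> space M - E r \<in> null_sets M" by (rule R_ergodic[OF E])
    then show ?thesis
    proof
      assume "E r \<in> null_sets M"
      then show ?thesis using AE_not_in by blast
    next
      assume "space M - E r \<in> null_sets M"
      then have "AE x in M. x \<notin> space M - E r" by (rule AE_not_in)
      then have "AE x in M. x \<in> E r" using AE_space by eventually_elim blast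
      then show ?thesis by blast
    qed
  qed
  then have "\<exists>b. AE x in M. f x \<le> q r \<longleftrightarrow> b" for r
  proof -
    consider "AE x in M. x \<in> E r" | "AE x in M. x \<notin> E r" using \<open>\<And>r. (AE x in M. x \<in> E r) \<or> (AE x in M. x \<notin> E r)\<close> by blast
    then show ?thesis
    proof cases
      case 1
      then have "AE x in M. f x \<le> q r \<longleftrightarrow> True" by eventually_elim (simp add: E_def)
      then show ?thesis by blast
    next
      case 2
      then have "AE x in M. f x \<le> q r \<longleftrightarrow> False" using AE_space by eventually_elim (simp add: E_def)
      then show ?thesis by blast
    qed
  qed
  then obtain b where "\<And>r. AE x in M. f x \<le> q r \<longleftrightarrow> b r" by metis
  then have b: "AE x in M. \<forall>r. f x \<le> q r \<longleftrightarrow> b r" by (rule AE_all_countable[THEN iffD2, OF allI])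
  \<comment> \<open>The space is not null, so some point satisfies the almost-everywhere statement;
    the value of \<open>f\<close> there is the constant.\<close>
  have "emeasure M (space M) \<noteq> 0" using ssf by (simp add: standard_sigma_finite_def)
  then have "ae_filter M \<noteq> bot" by (simp add: ae_filter_eq_bot_iff)
  then obtain z where z: "\<forall>r. f z \<le> q r \<longleftrightarrow> b r" using eventually_happens'[OF _ b] by blast
  have "AE x in M. f x = f z" using b
  proof eventually_elim
    case (elim x)
    then have e: "f x \<le> q r \<longleftrightarrow> f z \<le> q r" for r using z by blast
    show ?case
    proof (rule ccontr)
      assume "f x \<noteq> f z"
      then consider "f x < f z" | "f z < f x" by (metis linorder_neqE)
      then show False
      proof cases
        case 1
        then obtain r where "f x < q r" "q r < f z" using ennreal_rat_dense unfolding q_def by blast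
        then show False using e[of r] by auto
      next
        case 2
        then obtain r where "f z < q r" "q r < f x" using ennreal_rat_dense unfolding q_def by blast
        then show False using e[of r] by auto
      qed
    qed
  qed
  then show ?thesis using that by blast
qed

text \<open>\<open>S\<^sub>*M\<close> is again invariant under the ergodic full group, so its density is constant.\<close>

lemma (in full_group_iso) distr_eq_scale:
  assumes S: "S \<in> borel_bij M"
    and ns: "\<And>B. B \<in> sets M \<Longrightarrow> (AE x in M. S x \<notin> B) \<longleftrightarrow> (AE x in M. x \<notin> B)"
    and conj: "\<And>T T'. rel T T' \<Longrightarrow> AE x in M. S (T' x) = T (S x)"
  obtains k :: real where "k > 0" "distr M M S = scale_measure (ennreal k) M"
proof -
  have Sm: "S \<in> M \<rightarrow>\<^sub>M M" and Simg: "\<And>A. A \<in> sets M \<Longrightarrow> S ` A \<in> sets M" and Sb: "bij_betw S (space M) (space M)"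
    using S by (auto simp: borel_bij_def Bij_def)
  define \<nu> where "\<nu> = distr M M S"
  have sets\<nu>: "sets \<nu> = sets M" by (simp add: \<nu>_def)
  have e\<nu>: "emeasure \<nu> A = emeasure M (S -` A \<inter> space M)" if "A \<in> sets M" for A
    unfolding \<nu>_def by (rule emeasure_distr[OF Sm that])
  have ac: "absolutely_continuous M \<nu>"
    unfolding absolutely_continuous_def
  proof
    fix A assume A: "A \<in> null_sets M"
    then have As: "A \<in> sets M" by auto
    have "AE x in M. S x \<notin> A" using ns[OF As] AE_not_in[OF A] by simp
    then have "AE x in M. x \<notin> S -` A \<inter> space M" by eventually_elim auto
    then have "S -` A \<inter> space M \<in> null_sets M" using AE_iff_null_sets[OF measurable_sets[OF Sm As]] by simp
    then show "A \<in> null_sets \<nu>" using e\<nu>[OF As] As by (auto simp: null_sets_def sets\<nu>)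
  qed
  obtain f where f: "f \<in> borel_measurable M" "density M f = \<nu>"
    using X.Radon_Nikodym[OF ac sets\<nu>] by blast
  have inv: "AE x in M. f (T x) = f x" if T: "T \<in> X.F" for T
  proof -
    obtain T' where T': "rel T T'" by (rule rel_ex[OF T])
    note T'F = relD(2)[OF T']
    have Tm: "T \<in> M \<rightarrow>\<^sub>M M" by (rule X.F_meas[OF T])
    have fT: "(\<lambda>x. f (T x)) \<in> borel_measurable M" by (rule measurable_compose[OF Tm f(1)])
    have dT: "distr M M T = M"
      by (rule measure_eqI) (simp_all add: emeasure_distr[OF Tm] mp_bij_image(4)[OF X.F_mp[OF T]])
    \<comment> \<open>Pulling back along \<open>S\<close> turns \<open>T\<close> into
      \<open>T'\<close>, which preserves \<open>M\<close>; hence \<open>T\<close> preserves the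
      image measure.\<close>
    have \<nu>T: "emeasure \<nu> (T -` B \<inter> space M) = emeasure \<nu> B" if B: "B \<in> sets M" for B
    proof -
      have TB: "T -` B \<inter> space M \<in> sets M" by (rule measurable_sets[OF Tm B])
      have SB: "S -` B \<inter> space M \<in> sets M" by (rule measurable_sets[OF Sm B])
      have "emeasure \<nu> (T -` B \<inter> space M) = emeasure M (S -` (T -` B \<inter> space M) \<inter> space M)"
        by (rule e\<nu>[OF TB])
      also have "\<dots> = emeasure M (T' -` (S -` B \<inter> space M) \<inter> space M)"
      proof (rule emeasure_eq_AE)
        show "AE x in M. x \<in> S -` (T -` B \<inter> space M) \<inter> space M \<longleftrightarrow> x \<in> T' -` (S -` B \<inter> space M) \<inter> space M"
          using conj[OF T'] AE_space
        proof eventually_elim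
          case (elim x)
          then show ?case using measurable_space[OF Sm elim(2)] Y.F_sp[OF T'F elim(2)] by auto
        qed
        show "S -` (T -` B \<inter> space M) \<inter> space M \<in> sets M" by (rule measurable_sets[OF Sm TB])
        show "T' -` (S -` B \<inter> space M) \<inter> space M \<in> sets M" by (rule measurable_sets[OF Y.F_meas[OF T'F] SB])
      qed
      also have "\<dots> = emeasure M (S -` B \<inter> space M)" by (rule mp_bij_image(4)[OF Y.F_mp[OF T'F] SB])
      also have "\<dots> = emeasure \<nu> B" by (rule e\<nu>[OF B, symmetric])
      finally show ?thesis .
    qed
    have "density M (\<lambda>x. f (T x)) = density M f"
    proof (rule measure_eqI)
      fix B assume "B \<in> sets (density M (\<lambda>x. f (T x)))"
      then have B: "B \<in> sets M" by simp
      \<comment> \<open>Writing \<open>B\<close> as the preimage of its own image allows the change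
        of variables along \<open>T\<close>. The functions \<open>f\<close> and \<open>f\<close>
        after \<open>T\<close> then have the same density measure and agree by uniqueness of
        densities.\<close>
      have TB: "T ` B \<in> sets M" by (rule mp_bij_image(1)[OF X.F_mp[OF T] B])
      have TTB: "T -` (T ` B) \<inter> space M = B"
        using X.F_inj[OF T] sets.sets_into_space[OF B] by auto
      have "emeasure (density M (\<lambda>x. f (T x))) B = (\<integral>\<^sup>+x. f (T x) * indicator B x \<partial>M)"
        by (rule emeasure_density[OF fT B])
      also have "\<dots> = (\<integral>\<^sup>+x. f (T x) * indicator (T ` B) (T x) \<partial>M)"
      proof (rule nn_integral_cong)
        fix x assume "x \<in> space M"
        then have "T x \<in> T ` B \<longleftrightarrow> x \<in> B" using TTB by blast
        then show "f (T x) * indicator B x = f (T x) * indicator (T ` B) (T x)" by (simp add: indicator_def)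
      qed
      also have "\<dots> = (\<integral>\<^sup>+y. f y * indicator (T ` B) y \<partial>distr M M T)"
        using f(1) TB by (subst nn_integral_distr[OF Tm]) auto
      also have "\<dots> = emeasure (density M f) (T ` B)" unfolding dT using emeasure_density[OF f(1) TB] by simp
      also have "\<dots> = emeasure (density M f) B" using \<nu>T[OF TB] unfolding TTB f(2) by simp
      finally show "emeasure (density M (\<lambda>x. f (T x))) B = emeasure (density M f) B" .
    qed simp
    then show ?thesis by (rule X.density_unique[OF fT f(1)])
  qed
  obtain c where c: "AE x in M. f x = c" by (rule X.invariant_function_const[OF f(1) inv])
  have \<nu>c: "emeasure \<nu> A = c * emeasure M A" if "A \<in> sets M" for A
  proof -
    have "emeasure \<nu> A = (\<integral>\<^sup>+x. f x * indicator A x \<partial>M)" using emeasure_density[OF f(1) that] f(2) by simp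
    also have "\<dots> = (\<integral>\<^sup>+x. c * indicator A x \<partial>M)"
    proof (rule nn_integral_cong_AE)
      show "AE x in M. f x * indicator A x = c * indicator A x" using c by eventually_elim simp
    qed
    also have "\<dots> = c * emeasure M A" by (rule nn_integral_cmult_indicator[OF that])
    finally show ?thesis .
  qed
  have top: "emeasure M (space M) = \<infinity>" using X.ssf by (simp add: standard_sigma_finite_def)
  have "S -` space M \<inter> space M = space M" using measurable_space[OF Sm] by auto
  then have "c * emeasure M (space M) \<noteq> 0" using \<nu>c[of "space M"] e\<nu>[of "space M"] top by simp
  then have c0: "c \<noteq> 0" by auto
  \<comment> \<open>A set of positive finite measure excludes an infinite constant: the constant
    times the measure of its \<open>S\<close>-image is the measure of the set.\<close>
  have "\<exists>A\<in>sets M. emeasure M A \<noteq> 0 \<and> emeasure M A \<noteq> \<infinity>"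
  proof (rule ccontr)
    assume neg: "\<not> ?thesis"
    obtain \<A> where A: "countable \<A>" "\<A> \<subseteq> sets M" "\<Union>\<A> = space M" "\<forall>a\<in>\<A>. emeasure M a \<noteq> \<infinity>"
      using X.sigma_finite_countable by (elim exE conjE)
    have "(\<Union>a\<in>\<A>. a) \<in> null_sets M"
      by (rule null_sets_UN'[OF A(1)]) (use A neg in \<open>auto simp: null_sets_def\<close>)
    then show False using A(3) top by (simp add: null_sets_def)
  qed
  then obtain A where A: "A \<in> sets M" "emeasure M A \<noteq> 0" "emeasure M A \<noteq> \<infinity>" by blast
  have SA: "S ` A \<in> sets M" by (rule Simg[OF A(1)])
  have "S -` (S ` A) \<inter> space M = A"
    using Sb sets.sets_into_space[OF A(1)] by (auto simp: bij_betw_def inj_on_def)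
  then have eA: "c * emeasure M (S ` A) = emeasure M A" using \<nu>c[OF SA] e\<nu>[OF SA] by simp
  have cinf: "c \<noteq> \<infinity>"
  proof
    assume "c = \<infinity>"
    then show False using eA A by (cases "emeasure M (S ` A) = 0") (auto simp: ennreal_top_mult)
  qed
  obtain k where k: "c = ennreal k" "k \<ge> 0" using cinf by (cases c) auto
  show ?thesis
  proof (rule that)
    show "k > 0" using k c0 by (cases "k = 0") auto
    show "distr M M S = scale_measure (ennreal k) M"
      by (rule measure_eqI) (use \<nu>c k in \<open>simp_all add: \<nu>_def\<close>)
  qed
qed

section \<open>Conjugation by bijections that scale the measure\<close>

lemma mp_bijI:
  assumes V: "V \<in> M \<rightarrow>\<^sub>M M" and W: "W \<in> M \<rightarrow>\<^sub>M M" and ext: "V \<in> extensional (space M)"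
    and WV: "\<And>x. x \<in> space M \<Longrightarrow> W (V x) = x" and VW: "\<And>x. x \<in> space M \<Longrightarrow> V (W x) = x"
    and e: "\<And>A. A \<in> sets M \<Longrightarrow> emeasure M (V -` A \<inter> space M) = emeasure M A"
  shows "V \<in> mp_bij M"
proof -
  note bb = borel_bijI[OF V W ext WV VW]
  have "emeasure M (V ` A) = emeasure M A" if A: "A \<in> sets M" for A
  proof -
    have VA: "V ` A \<in> sets M" using bb(1) A by (simp add: borel_bij_def)
    have "V -` (V ` A) \<inter> space M = A"
    proof (intro equalityI subsetI)
      fix x assume "x \<in> V -` (V ` A) \<inter> space M"
      then obtain y where y: "y \<in> A" "V x = V y" "x \<in> space M" by auto
      then have ys: "y \<in> space M" using sets.sets_into_space[OF A] by auto
      have "x = W (V x)" by (rule WV[OF y(3), symmetric])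
      also have "\<dots> = y" unfolding y(2) by (rule WV[OF ys])
      finally show "x \<in> A" using y(1) by simp
    qed (use sets.sets_into_space[OF A] in auto)
    then show ?thesis using e[OF VA] by simp
  qed
  then show ?thesis using bb(1) e by (simp add: mp_bij_def)
qed

text \<open>Although \<open>S\<close> only scales the measure, the factor it contributes is undone
  by its inverse. In the computation \<open>k\<close> stands on both sides and is cancelled, so it
  has to be neither zero nor infinite.\<close>

lemma conjugate_mp_bij:
  assumes S: "S \<in> M \<rightarrow>\<^sub>M M" and S': "S' \<in> M \<rightarrow>\<^sub>M M"
    and S'S: "\<And>x. x \<in> space M \<Longrightarrow> S' (S x) = x" and SS': "\<And>x. x \<in> space M \<Longrightarrow> S (S' x) = x"
    and k: "k \<noteq> 0" "k \<noteq> \<infinity>" and scale: "\<And>A. A \<in> sets M \<Longrightarrow> emeasure M (S -` A \<inter> space M) = k * emeasure M A"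
    and U: "U \<in> mp_bij M"
  shows "(\<lambda>x\<in>space M. S (U (S' x))) \<in> mp_bij M"
proof (rule mp_bijI)
  let ?U' = "inv\<^bsub>mp_group M\<^esub> U"
  have U': "?U' \<in> mp_bij M" by (rule mp_bij_inv[OF U])
  note sp = measurable_space[OF S] measurable_space[OF S'] mp_bijD(4)[OF U] mp_bijD(4)[OF U']
  have m: "(\<lambda>x. S (W (S' x))) \<in> M \<rightarrow>\<^sub>M M" if "W \<in> mp_bij M" for W
    by (rule measurable_compose[OF measurable_compose[OF S' mp_bijD(3)[OF that]] S])
  show "(\<lambda>x\<in>space M. S (U (S' x))) \<in> M \<rightarrow>\<^sub>M M" "(\<lambda>x. S (?U' (S' x))) \<in> M \<rightarrow>\<^sub>M M"
    using m[OF U] m[OF U'] by (simp_all cong: measurable_cong)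
  show "(\<lambda>x\<in>space M. S (U (S' x))) \<in> extensional (space M)" by simp
  show "S (?U' (S' ((\<lambda>x\<in>space M. S (U (S' x))) x))) = x" if "x \<in> space M" for x
    using that sp by (simp add: S'S SS' inv_mp_group[OF U])
  show "(\<lambda>x\<in>space M. S (U (S' x))) (S (?U' (S' x))) = x" if "x \<in> space M" for x
    using that sp by (simp add: S'S SS' inv_mp_group[OF U])
  fix A assume A: "A \<in> sets M"
  have SA: "S -` A \<inter> space M \<in> sets M" by (rule measurable_sets[OF S A])
  let ?B = "U -` (S -` A \<inter> space M) \<inter> space M"
  have B: "?B \<in> sets M" by (rule mp_bij_image(3)[OF U SA])
  have C: "S' -` ?B \<inter> space M \<in> sets M" by (rule measurable_sets[OF S' B])
  have "(\<lambda>x\<in>space M. S (U (S' x))) -` A \<inter> space M = S' -` ?B \<inter> space M" using sp by auto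
  moreover have "S -` (S' -` ?B \<inter> space M) \<inter> space M = ?B" using sp by (auto simp: S'S)
  then have "k * emeasure M (S' -` ?B \<inter> space M) = emeasure M ?B" using scale[OF C] by simp
  moreover have "emeasure M ?B = k * emeasure M A" using mp_bij_image(4)[OF U SA] scale[OF A] by simp
  ultimately show "emeasure M ((\<lambda>x\<in>space M. S (U (S' x))) -` A \<inter> space M) = emeasure M A"
    using k by (simp add: ennreal_mult_cancel_left)
qed

lemma mult_mult_BijGroup:
  assumes "A \<in> Bij X" "B \<in> Bij X" "C \<in> Bij X"
  shows "A \<otimes>\<^bsub>BijGroup X\<^esub> B \<otimes>\<^bsub>BijGroup X\<^esub> C = (\<lambda>x\<in>X. A (B (C x)))"
proof -
  have "C x \<in> X" if "x \<in> X" for x using assms(3) that by (auto simp: Bij_def bij_betw_def)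
  then show ?thesis
    unfolding mult_BijGroup[OF assms(1,2)] mult_BijGroup[OF compose_Bij[OF assms(1,2)] assms(3)]
    by (auto simp: compose_def fun_eq_iff)
qed

section \<open>From actions to relations, and the final assembly\<close>

text \<open>Every representative of a group element moves almost every point inside its orbit. A set
  invariant under the full group is thus invariant under the acting group.\<close>

lemma (in ergodic_mp_action) ergodic_relation_orbit:
  assumes "standard_sigma_finite M"
  shows "ergodic_relation M (\<lambda>x y. y \<in> orbit G \<phi> x)"
proof
  show "standard_sigma_finite M" by fact
  show "x \<in> orbit G \<phi> x" if "x \<in> space M" for x using orbit_refl[OF that] .
  show "x \<in> orbit G \<phi> y" if "x \<in> space M" "y \<in> space M" "y \<in> orbit G \<phi> x" for x y
    using orbit_sym[OF that] .
  show "z \<in> orbit G \<phi> x"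
    if "x \<in> space M" "y \<in> space M" "z \<in> space M" "y \<in> orbit G \<phi> x" "z \<in> orbit G \<phi> y" for x y z
    using orbit_trans[OF that] .
  fix A assume A: "A \<in> sets M"
    and inv: "\<And>T. T \<in> mp_bij M \<Longrightarrow> (AE x in M. T x \<in> orbit G \<phi> x) \<Longrightarrow> sym_diff (T ` A) A \<in> null_sets M"
  have "sym_diff (T ` A) A \<in> null_sets M"
    if C: "C \<in> (\<lambda>g. ae_class M (\<phi> g)) ` carrier G" and T: "T \<in> C" for C T
  proof -
    obtain g where g: "g \<in> carrier G" "C = ae_class M (\<phi> g)" using C by auto
    have T': "T \<in> mp_bij M" "AE x in M. T x = \<phi> g x"
      using T g(2) ae_class_eq[OF measure_preserving[OF g(1)]] by auto
    have "AE x in M. T x \<in> orbit G \<phi> x"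
      using T'(2) by eventually_elim (use g(1) in \<open>auto simp: orbit_def\<close>)
    then show ?thesis by (rule inv[OF T'(1)])
  qed
  then show "A \<in> null_sets M \<or> space M - A \<in> null_sets M"
    using ergodic_image A unfolding ergodic_def by blast
qed

lemma orbit_full_group_eq_full:
  assumes "ergodic_relation M (\<lambda>x y. y \<in> orbit G \<phi> x)"
  shows "orbit_full_group G M \<phi> = ergodic_relation.full M (\<lambda>x y. y \<in> orbit G \<phi> x)"
proof -
  interpret ergodic_relation M "\<lambda>x y. y \<in> orbit G \<phi> x" by fact
  have "{C \<in> carrier (aut_group M). \<forall>T\<in>C. AE x in M. T x \<in> orbit G \<phi> x} = carrier (orbit_full_group G M \<phi>)"
    by (simp add: orbit_full_group_def)
  also have "\<dots> = ae_class M ` F"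
  proof (intro equalityI subsetI)
    fix C assume C: "C \<in> carrier (orbit_full_group G M \<phi>)"
    then have "C \<in> carrier (aut_group M)" by (simp add: orbit_full_group_def)
    then obtain T where T: "T \<in> mp_bij M" "C = ae_class M T" by (auto simp: carrier_aut_group)
    then have "T \<in> F" using C ae_class_in_orbit_full_group[OF T(1)] by (auto simp: F_def)
    then show "C \<in> ae_class M ` F" using T(2) by blast
  next
    fix C assume "C \<in> ae_class M ` F"
    then obtain T where "T \<in> F" "C = ae_class M T" by auto
    then show "C \<in> carrier (orbit_full_group G M \<phi>)"
      using ae_class_in_orbit_full_group[of T M G \<phi>] by (auto simp: F_def)
  qed
  finally show ?thesis by (simp add: orbit_full_group_def full_def)
qed

theorem theorem3:
  fixes M :: "'a measure"
    and G :: "('g, 'm) monoid_scheme" and \<tau>\<^sub>G :: "'g topology" and \<phi> :: "'g \<Rightarrow> 'a \<Rightarrow> 'a"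
    and H :: "('h, 'n) monoid_scheme" and \<tau>\<^sub>H :: "'h topology" and \<psi> :: "'h \<Rightarrow> 'a \<Rightarrow> 'a"
    and \<Phi> :: "('a \<Rightarrow> 'a) set \<Rightarrow> ('a \<Rightarrow> 'a) set"
  assumes "standard_sigma_finite M"
    and "ergodic_mp_action G \<tau>\<^sub>G M \<phi>"
    and "ergodic_mp_action H \<tau>\<^sub>H M \<psi>"
    and "\<Phi> \<in> iso (orbit_full_group G M \<phi>) (orbit_full_group H M \<psi>)"
  shows "\<exists>S\<in>borel_bij M.
           (\<exists>k::real. k > 0 \<and> distr M M S = scale_measure (ennreal k) M) \<and>
           (\<forall>C\<in>carrier (orbit_full_group G M \<phi>).
              \<Phi> C = (\<lambda>T. S \<otimes>\<^bsub>BijGroup (space M)\<^esub> T \<otimes>\<^bsub>BijGroup (space M)\<^esub> inv\<^bsub>BijGroup (space M)\<^esub> S) ` C)"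
proof -
  define RG where "RG = (\<lambda>x y. y \<in> orbit G \<phi> x)"
  define RH where "RH = (\<lambda>x y. y \<in> orbit H \<psi> x)"
  have eG: "ergodic_relation M RG" unfolding RG_def
    by (rule ergodic_mp_action.ergodic_relation_orbit[OF assms(2,1)])
  have eH: "ergodic_relation M RH" unfolding RH_def
    by (rule ergodic_mp_action.ergodic_relation_orbit[OF assms(3,1)])
  \<comment> \<open>The roles are exchanged: the relation of \<open>H\<close> is the source and that
    of \<open>G\<close> the target, in keeping with the contravariance of the lift.\<close>
  interpret X: ergodic_relation M RH by (rule eH)
  interpret Y: ergodic_relation M RG by (rule eG)
  have fG: "orbit_full_group G M \<phi> = Y.full"
    unfolding RG_def by (rule orbit_full_group_eq_full[OF eG[unfolded RG_def]])
  have fH: "orbit_full_group H M \<psi> = X.full"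
    unfolding RH_def by (rule orbit_full_group_eq_full[OF eH[unfolded RH_def]])
  have iso: "\<Phi> \<in> iso Y.full X.full" using assms(4) unfolding fG fH .
  \<comment> \<open>For the inverse isomorphism, related pairs have \<open>T\<close> in the image
    class \<open>\<Phi> C\<close> and \<open>T'\<close> in \<open>C\<close>. The relation between
    \<open>S\<close>, \<open>T'\<close> and \<open>T\<close> from \<open>spatial\<close> then reads
    as conjugation of \<open>C\<close> by \<open>S\<close> itself.\<close>
  define \<Psi> where "\<Psi> = inv_into (carrier Y.full) \<Phi>"
  have "\<Psi> \<in> iso X.full Y.full" unfolding \<Psi>_def by (rule group.iso_set_sym[OF Y.full_group iso])
  then interpret full_group_iso M RH RG \<Psi> by unfold_locales
  obtain S where S: "S \<in> borel_bij M"
    "\<And>B. B \<in> sets M \<Longrightarrow> (AE x in M. S x \<notin> B) \<longleftrightarrow> (AE x in M. x \<notin> B)"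
    "\<And>T T'. rel T T' \<Longrightarrow> AE x in M. S (T' x) = T (S x)" by (rule spatial) blast
  obtain k :: real where k: "k > 0" "distr M M S = scale_measure (ennreal k) M"
    by (rule distr_eq_scale[OF S]) blast+
  let ?\<BB> = "BijGroup (space M)"
  have SBij: "S \<in> Bij (space M)" and Sm: "S \<in> M \<rightarrow>\<^sub>M M" and Simg: "\<And>A. A \<in> sets M \<Longrightarrow> S ` A \<in> sets M"
    using S(1) by (auto simp: borel_bij_def)
  have Sb: "bij_betw S (space M) (space M)" using SBij by (simp add: Bij_def)
  define S' where "S' = inv\<^bsub>?\<BB>\<^esub> S"
  have S'_eq: "S' = (\<lambda>x\<in>space M. inv_into (space M) S x)" unfolding S'_def by (rule inv_BijGroup[OF SBij])
  have S'Bij: "S' \<in> Bij (space M)" unfolding S'_eq by (rule restrict_inv_into_Bij[OF SBij])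
  have S'S: "S' (S x) = x" if "x \<in> space M" for x
    using that Sb by (auto simp: S'_eq bij_betw_def)
  have SS': "S (S' x) = x" if "x \<in> space M" for x
    using that Sb by (auto simp: S'_eq bij_betw_def f_inv_into_f)
  have S'sp: "S' x \<in> space M" if "x \<in> space M" for x using S'Bij that by (auto simp: Bij_def bij_betw_def)
  have S'vim: "S' -` A \<inter> space M = S ` A" if "A \<in> sets M" for A
  proof (intro equalityI subsetI)
    fix x assume "x \<in> S' -` A \<inter> space M"
    then show "x \<in> S ` A" using SS' by (intro image_eqI[of _ _ "S' x"]) auto
  next
    fix x assume "x \<in> S ` A"
    then show "x \<in> S' -` A \<inter> space M"
      using S'S sets.sets_into_space[OF that] measurable_space[OF Sm] by auto
  qed
  have S'm: "S' \<in> M \<rightarrow>\<^sub>M M"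
    by (rule measurableI) (use S'sp S'vim Simg in auto)
  have sc: "emeasure M (S -` A \<inter> space M) = ennreal k * emeasure M A" if "A \<in> sets M" for A
    using emeasure_distr[OF Sm that] k(2) by simp
  have sc': "emeasure M (S' -` A \<inter> space M) = ennreal (1 / k) * emeasure M A" if A: "A \<in> sets M" for A
  proof -
    have "S -` (S' -` A \<inter> space M) \<inter> space M = A"
      using sets.sets_into_space[OF A] S'S measurable_space[OF Sm] by auto
    then have "emeasure M A = ennreal k * emeasure M (S' -` A \<inter> space M)"
      using sc[OF measurable_sets[OF S'm A]] by simp
    then have "ennreal (1 / k) * emeasure M A = ennreal (1 / k) * ennreal k * emeasure M (S' -` A \<inter> space M)"
      by (simp add: mult.assoc)
    also have "ennreal (1 / k) * ennreal k = 1" using k(1) by (simp add: ennreal_mult[symmetric])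
    finally show ?thesis by simp
  qed
  have AE_S': "AE x in M. Q (S' x)" if Q: "AE x in M. Q x" for Q
  proof -
    obtain N where N: "{x \<in> space M. \<not> Q x} \<subseteq> N" "N \<in> null_sets M" using Q by (auto simp: eventually_ae_filter)
    have "S' -` N \<inter> space M \<in> null_sets M"
      using sc'[of N] N(2) measurable_sets[OF S'm, of N] by (auto simp: null_sets_def)
    moreover have "{x \<in> space M. \<not> Q (S' x)} \<subseteq> S' -` N \<inter> space M" using N(1) S'sp by auto
    ultimately show ?thesis unfolding eventually_ae_filter by blast
  qed
  have AE_S: "AE x in M. Q (S x)" if Q: "AE x in M. Q x" for Q
  proof -
    obtain N where N: "{x \<in> space M. \<not> Q x} \<subseteq> N" "N \<in> null_sets M" using Q by (auto simp: eventually_ae_filter)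
    have "S -` N \<inter> space M \<in> null_sets M"
      using sc[of N] N(2) measurable_sets[OF Sm, of N] by (auto simp: null_sets_def)
    moreover have "{x \<in> space M. \<not> Q (S x)} \<subseteq> S -` N \<inter> space M" using N(1) measurable_space[OF Sm] by auto
    ultimately show ?thesis unfolding eventually_ae_filter by blast
  qed
  have conj: "S \<otimes>\<^bsub>?\<BB>\<^esub> U \<otimes>\<^bsub>?\<BB>\<^esub> S' = (\<lambda>x\<in>space M. S (U (S' x)))" if "U \<in> Bij (space M)" for U
    by (rule mult_mult_BijGroup[OF SBij that S'Bij])
  have "\<Phi> C = (\<lambda>T. S \<otimes>\<^bsub>?\<BB>\<^esub> T \<otimes>\<^bsub>?\<BB>\<^esub> S') ` C" if C: "C \<in> carrier Y.full" for C
  proof -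
    have "\<Phi> C \<in> carrier X.full" using iso C by (auto simp: iso_def bij_betw_def)
    then obtain T where T: "T \<in> X.F" "\<Phi> C = ae_class M T" by (auto simp: X.full_carrier)
    obtain T' where T': "T' \<in> Y.F" "C = ae_class M T'" using C by (auto simp: Y.full_carrier)
    have "\<Psi> (\<Phi> C) = C" unfolding \<Psi>_def using iso C by (auto simp: iso_def bij_betw_def)
    then have r: "rel T T'" using T T' by (simp add: rel_def)
    note TT = S(3)[OF r]
    \<comment> \<open>The classes are compared as sets of bijections, so each representative of the
      image, whatever its values on a null set, must be an exact conjugate of some member of
      \<open>C\<close>.\<close>
    show ?thesis unfolding T(2)
    proof (intro equalityI subsetI)
      fix V assume V: "V \<in> ae_class M T"
      then have V': "V \<in> mp_bij M" "AE x in M. V x = T x" using ae_class_eq[OF X.F_mp[OF T(1)]] by auto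
      have VB: "V \<in> Bij (space M)" by (rule mp_bijD(1)[OF V'(1)])
      \<comment> \<open>Conjugating \<open>V\<close> back by \<open>S\<close> gives the member of
        \<open>C\<close> whose exact conjugate is \<open>V\<close>.\<close>
      let ?U = "\<lambda>x\<in>space M. S' (V (S x))"
      have U: "?U \<in> mp_bij M"
        by (rule conjugate_mp_bij[OF S'm Sm SS' S'S _ _ sc' V'(1)]) (use k in auto)
      have "AE x in M. ?U x = T' x" using AE_S[OF V'(2)] TT AE_space
      proof eventually_elim
        case (elim x)
        have "S' (S (T' x)) = T' x" by (rule S'S[OF Y.F_sp[OF T'(1) elim(3)]])
        then show ?case using elim by simp
      qed
      then have UC: "?U \<in> C" using U T'(2) ae_class_eq[OF Y.F_mp[OF T'(1)]] by auto
      have "V = S \<otimes>\<^bsub>?\<BB>\<^esub> ?U \<otimes>\<^bsub>?\<BB>\<^esub> S'"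
      proof -
        have "S \<otimes>\<^bsub>?\<BB>\<^esub> ?U \<otimes>\<^bsub>?\<BB>\<^esub> S' = (\<lambda>x\<in>space M. S (?U (S' x)))" by (rule conj[OF mp_bijD(1)[OF U]])
        also have "\<dots> = V"
        proof (rule extensionalityI)
          show "V \<in> extensional (space M)" by (rule mp_bij_ext[OF V'(1)])
          show "(\<lambda>x\<in>space M. S (?U (S' x))) x = V x" if "x \<in> space M" for x
            using that S'sp SS' mp_bijD(4)[OF V'(1) that] by simp
        qed simp
        finally show ?thesis by simp
      qed
      then show "V \<in> (\<lambda>T. S \<otimes>\<^bsub>?\<BB>\<^esub> T \<otimes>\<^bsub>?\<BB>\<^esub> S') ` C" using UC by blast
    next
      fix V assume "V \<in> (\<lambda>T. S \<otimes>\<^bsub>?\<BB>\<^esub> T \<otimes>\<^bsub>?\<BB>\<^esub> S') ` C"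
      then obtain U where U: "U \<in> C" "V = S \<otimes>\<^bsub>?\<BB>\<^esub> U \<otimes>\<^bsub>?\<BB>\<^esub> S'" by auto
      then have U': "U \<in> mp_bij M" "AE x in M. U x = T' x"
        using T'(2) ae_class_eq[OF Y.F_mp[OF T'(1)]] by auto
      have V: "V = (\<lambda>x\<in>space M. S (U (S' x)))" using U(2) conj[OF mp_bijD(1)[OF U'(1)]] by simp
      have "V \<in> mp_bij M" unfolding V
        by (rule conjugate_mp_bij[OF Sm S'm S'S SS' _ _ sc U'(1)]) (use k in auto)
      moreover have "AE x in M. V x = T x" using AE_S'[OF U'(2)] AE_S'[OF TT] AE_space
        by eventually_elim (simp add: V SS')
      ultimately show "V \<in> ae_class M T" using ae_class_eq[OF X.F_mp[OF T(1)]] by auto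
    qed
  qed
  then show ?thesis using S(1) k unfolding fG S'_def by blast
qed

end
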